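(* The invariants $K[Q]$ and $K[K]$ of unoriented links are topologically equivalent. Specifically, for every unoriented link diagram $L$ with $n\ge 1$ components, $$K[Q](L)(z,w,a,E) = \left(\frac{z}{w}\right)^{n-1} K[K](L)(w,a,\widehat{E}),\qquad \widehat{E}=E\,\frac{z}{w}.$$
   Context: $z,w,a,E$ are indeterminates. Two link invariants are topologically equivalent if they distinguish exactly the same pairs of links. Regular isotopy is the equivalence relation on planar link diagrams generated by planar isotopy and Reidemeister moves II and III. For a crossing, swinging the overcrossing arc counterclockwise sweeps two of the four local regions; joining these two regions is the $A$-smoothing, joining the other two is the $B$-smoothing. A crossing (drawn in the plane as an X) is of positive type if its $A$-smoothing is horizontal (one arc on top and one arc at the bottom) and of negative type if its $A$-smoothing is vertical. An unoriented Conway quadruple $L_+,L_-,L_0,L_\infty$ consists of four unoriented diagrams identical except near one specified crossing, which is of positive type in $L_+$, switched in $L_-$, and replaced in $L_0$ and $L_\infty$ by, respectively, the $A$-smoothing (horizontal) and the $B$-smoothing (vertical) of the crossing of $L_+$. A union of $r$ unlinked knots $\mathcal{K}^r=\sqcup_{i=1}^r K_i$ is an $r$-component link diagram representing a split link whose $r$ split components are (possibly non-trivial) knots. $Q=Q(w,a)$, the (known) regular isotopy version of the Kauffman polynomial, is the regular isotopy invariant of unoriented links determined by: $Q(L_+)+Q(L_-)=w\,(Q(L_0)+Q(L_\infty))$ for every unoriented Conway quadruple (any crossing); $Q(\text{diagram with a positive curl})=a\,Q(\text{diagram without the curl})$ and $Q(\text{diagram with a negative curl})=a^{-1}Q(\text{diagram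 without the curl})$ (a curl is a Reidemeister I kink, its sign being the sign of its crossing for either orientation of the strand); $Q=1$ on the standard crossingless unknot diagram. $K[Q]=K[Q](z,w,a,E)$ is the unique regular isotopy invariant of unoriented links, with values in Laurent polynomials in $z,w,a,E$, such that: (1) $K[Q](L_+)+K[Q](L_-)=z\,\big(K[Q](L_0)+K[Q](L_\infty)\big)$ for every unoriented Conway quadruple whose specified crossing involves two different components; (2) $K[Q](\mathcal{K}^r)=E^{1-r}Q(\mathcal{K}^r)$ for every union $\mathcal{K}^r$ of $r\geq1$ unlinked knots. $K[K]=K[K](z,a,E)$ denotes the 3-variable invariant obtained from $K[Q]$ in the case $w=z$ (so that $Q(w,a)$ becomes the Kauffman polynomial $K(z,a)$); $K[K](L)(w,a,\widehat{E})$ is its value with $z$ replaced by $w$ and $E$ by $\widehat{E}$. *)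

theory Defs
  imports Main "HOL-Library.Poly_Mapping"
begin

section \<open>Laurent polynomials in four indeterminates\<close>

datatype indet = Iz | Iw | Ia | IE

text \<open>
  The Laurent polynomial ring over the integers in $z, w, a, E$, as the group ring of the
  exponent vectors: a finitely supported map from exponent vectors to coefficients. The product
  of \<^theory>\<open>HOL-Library.Poly_Mapping\<close> is convolution.
\<close>

type_synonym laurent = "(indet \<Rightarrow>\<^sub>0 int) \<Rightarrow>\<^sub>0 int"

definition var :: "indet \<Rightarrow> laurent" where
  "var v = Poly_Mapping.single (Poly_Mapping.single v 1) 1"

definition indets :: "laurent \<Rightarrow> indet set" where
  "indets p = (\<Union>m \<in> Poly_Mapping.keys p. Poly_Mapping.keys m)"

text \<open>Inverses and integer powers are only meant for units of the ring, such as monomials.\<close>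

definition unit_inv :: "laurent \<Rightarrow> laurent" where
  "unit_inv x = (THE y. x * y = 1)"

definition unit_powi :: "laurent \<Rightarrow> int \<Rightarrow> laurent" where
  "unit_powi x i = (if 0 \<le> i then x ^ nat i else unit_inv x ^ nat (- i))"

text \<open>\<open>substitute s p\<close> replaces every indeterminate \<open>v\<close> in \<open>p\<close> by the unit \<open>s v\<close>.\<close>

definition substitute :: "(indet \<Rightarrow> laurent) \<Rightarrow> laurent \<Rightarrow> laurent" where
  "substitute s p = (\<Sum>m \<in> Poly_Mapping.keys p.
     of_int (Poly_Mapping.lookup p m) *
     (\<Prod>v \<in> Poly_Mapping.keys m. unit_powi (s v) (Poly_Mapping.lookup m v)))"


section \<open>Link diagrams\<close>

text \<open>
  An unoriented planar link diagram in general position with respect to the height function is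
  cut by horizontal lines into slices, each containing exactly one local minimum (\<open>Cup\<close>),
  local maximum (\<open>Cap\<close>) or crossing; the diagram is the list of its slices, read from bottom
  to top. In the slice \<open>(k, p)\<close> the piece \<open>p\<close> has exactly \<open>k\<close> strands to its left, and all
  strands other than those of \<open>p\<close> run straight through.

  Both strands of a crossing run upwards, so the crossing is drawn as an X. If the strand from
  bottom right to top left is the upper one, turning it counterclockwise sweeps the left and the
  right region, the smoothing joining these is horizontal, and the type is \<open>Pos\<close>. If the strand
  from bottom left to top right is the upper one, the type is \<open>Neg\<close>. This type is a matter of
  how the unoriented crossing is drawn and is not its sign: when both strands are oriented
  upwards, a crossing of type \<open>Neg\<close> has sign $+1$.
\<close>

datatype crossing_type = Pos | Neg

datatype piece = Cup | Cap | Cross crossing_type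

type_synonym diagram = "(nat \<times> piece) list"

fun flip :: "crossing_type \<Rightarrow> crossing_type" where
  "flip Pos = Neg"
| "flip Neg = Pos"

fun ins :: "piece \<Rightarrow> nat" where
  "ins Cup = 0"
| "ins Cap = 2"
| "ins (Cross c) = 2"

fun outs :: "piece \<Rightarrow> nat" where
  "outs Cup = 2"
| "outs Cap = 0"
| "outs (Cross c) = 2"

text \<open>\<open>strands D h\<close> is the number of strands met by the horizontal line above the lowest \<open>h\<close> slices.\<close>

definition strands :: "diagram \<Rightarrow> nat \<Rightarrow> nat" where
  "strands D h = fold (\<lambda>(k, p) m. m - ins p + outs p) (take h D) 0"

text \<open>Links are non-empty.\<close>

definition link_diagram :: "diagram \<Rightarrow> bool" where
  "link_diagram D \<longleftrightarrow> D \<noteq> [] \<and>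
     (\<forall>h < length D. fst (D ! h) + ins (snd (D ! h)) \<le> strands D h) \<and>
     strands D (length D) = 0"


subsection \<open>Components\<close>

text \<open>
  The pair \<open>(h, i)\<close> stands for the \<open>i\<close>-th point, counted from the left and from $0$, in which the
  horizontal line above the lowest \<open>h\<close> slices meets the diagram. Two points are adjacent if they
  are joined by an arc inside one slice. Every component meets one of these lines, as it
  has a minimum.
\<close>

definition points :: "diagram \<Rightarrow> (nat \<times> nat) set" where
  "points D = {(h, i). h \<le> length D \<and> i < strands D h}"

inductive adjacent :: "diagram \<Rightarrow> nat \<times> nat \<Rightarrow> nat \<times> nat \<Rightarrow> bool" for D where
  left: "h < length D \<Longrightarrow> D ! h = (k, p) \<Longrightarrow> i < k \<Longrightarrow> adjacent D (h, i) (Suc h, i)"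
| right: "h < length D \<Longrightarrow> D ! h = (k, p) \<Longrightarrow> k + ins p + j < strands D h \<Longrightarrow>
    adjacent D (h, k + ins p + j) (Suc h, k + outs p + j)"
| cup: "h < length D \<Longrightarrow> D ! h = (k, Cup) \<Longrightarrow> adjacent D (Suc h, k) (Suc h, k + 1)"
| cap: "h < length D \<Longrightarrow> D ! h = (k, Cap) \<Longrightarrow> adjacent D (h, k) (h, k + 1)"
| cross_up_right: "h < length D \<Longrightarrow> D ! h = (k, Cross c) \<Longrightarrow> adjacent D (h, k) (Suc h, k + 1)"
| cross_up_left: "h < length D \<Longrightarrow> D ! h = (k, Cross c) \<Longrightarrow> adjacent D (h, k + 1) (Suc h, k)"

definition same_component :: "diagram \<Rightarrow> nat \<times> nat \<Rightarrow> nat \<times> nat \<Rightarrow> bool" where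
  "same_component D = equivclp (adjacent D)"

definition components :: "diagram \<Rightarrow> (nat \<times> nat) set set" where
  "components D = points D // {(x, y). x \<in> points D \<and> y \<in> points D \<and> same_component D x y}"

definition num_components :: "diagram \<Rightarrow> nat" where
  "num_components D = card (components D)"

definition knot_diagram :: "diagram \<Rightarrow> bool" where
  "knot_diagram D \<longleftrightarrow> link_diagram D \<and> num_components D = 1"


subsection \<open>Planar isotopy and Reidemeister moves\<close>

text \<open>
  Planar isotopy of diagrams in general position is generated by: exchanging the heights of two
  pieces lying side by side; cancelling a minimum against an adjacent maximum; sliding a
  crossing over an extremum from one leg to the other, whereby it turns by a right angle and
  its type flips. These are the codimension-one degenerations with respect to the height function: two
  pieces at equal height, a degenerate critical point, an extremum in a crossing.
\<close>

inductive planar_move :: "diagram \<Rightarrow> diagram \<Rightarrow> bool" where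
  exchange: "planar_move [(i, p), (i + outs p + d, q)] [(i + ins p + d, q), (i, p)]"
| cancel_right: "planar_move [(k + 1, Cup), (k, Cap)] []"
| cancel_left: "planar_move [(k, Cup), (k + 1, Cap)] []"
| slide_cap: "planar_move [(k + 1, Cross c), (k, Cap)] [(k, Cross (flip c)), (k + 1, Cap)]"
| slide_cup: "planar_move [(k, Cup), (k + 1, Cross c)] [(k + 1, Cup), (k, Cross (flip c))]"

inductive reidemeister2 :: "diagram \<Rightarrow> diagram \<Rightarrow> bool" where
  "reidemeister2 [(k, Cross c), (k, Cross (flip c))] []"

text \<open>
  In the triple of crossings below the type of each crossing tells which of two of the three
  strands is the upper one. The side condition says that this relation is not cyclic, so that
  the three strands lie in three layers.
\<close>

inductive reidemeister3 :: "diagram \<Rightarrow> diagram \<Rightarrow> bool" where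
  "c' = c \<or> c' = c'' \<Longrightarrow>
   reidemeister3 [(k, Cross c), (k + 1, Cross c'), (k, Cross c'')]
     [(k + 1, Cross c''), (k, Cross c'), (k + 1, Cross c)]"

text \<open>
  \<open>curl s k u\<close>: the slices \<open>u\<close> form a curl of sign \<open>s\<close>, lying to the right or to the left, in the
  strand at position \<open>k\<close>. Along either orientation both branches pass the crossing in the same vertical
  direction, so its sign is $+1$ precisely if its type is \<open>Neg\<close>. All other curls are
  planar isotopic to these.
\<close>

inductive curl :: "int \<Rightarrow> nat \<Rightarrow> diagram \<Rightarrow> bool" where
  right_pos: "curl 1 k [(k + 1, Cup), (k, Cross Neg), (k + 1, Cap)]"
| left_pos: "curl 1 k [(k, Cup), (k + 1, Cross Neg), (k, Cap)]"
| right_neg: "curl (-1) k [(k + 1, Cup), (k, Cross Pos), (k + 1, Cap)]"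
| left_neg: "curl (-1) k [(k, Cup), (k + 1, Cross Pos), (k, Cap)]"

inductive reidemeister1 :: "diagram \<Rightarrow> diagram \<Rightarrow> bool" where
  "curl s k u \<Longrightarrow> reidemeister1 u []"

definition local_change :: "(diagram \<Rightarrow> diagram \<Rightarrow> bool) \<Rightarrow> diagram \<Rightarrow> diagram \<Rightarrow> bool" where
  "local_change R D D' \<longleftrightarrow> link_diagram D \<and> link_diagram D' \<and>
     (\<exists>xs ys u v. R u v \<and> D = xs @ u @ ys \<and> D' = xs @ v @ ys)"

definition regular_isotopic :: "diagram \<Rightarrow> diagram \<Rightarrow> bool" where
  "regular_isotopic = equivclp (local_change
     (\<lambda>u v. planar_move u v \<or> reidemeister2 u v \<or> reidemeister3 u v))"

text \<open>Two diagrams are isotopic if they represent the same link.\<close>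

definition isotopic :: "diagram \<Rightarrow> diagram \<Rightarrow> bool" where
  "isotopic = equivclp (local_change
     (\<lambda>u v. planar_move u v \<or> reidemeister1 u v \<or> reidemeister2 u v \<or> reidemeister3 u v))"

definition regular_isotopy_invariant :: "(diagram \<Rightarrow> 'r) \<Rightarrow> bool" where
  "regular_isotopy_invariant f \<longleftrightarrow>
     (\<forall>D D'. link_diagram D \<longrightarrow> link_diagram D' \<longrightarrow> regular_isotopic D D' \<longrightarrow> f D = f D')"

text \<open>
  The diagram \<open>concat Ks\<close> consists of the diagrams \<open>Ks\<close> placed above each other, without any
  crossings between them.
\<close>

definition union_of_unlinked_knots :: "nat \<Rightarrow> diagram \<Rightarrow> bool" where
  "union_of_unlinked_knots r D \<longleftrightarrow> link_diagram D \<and> num_components D = r \<and>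
     (\<exists>Ks. length Ks = r \<and> (\<forall>K \<in> set Ks. knot_diagram K) \<and> isotopic D (concat Ks))"


section \<open>The invariants\<close>

text \<open>\<open>conway_quadruple h Lp Lm L0 Li\<close>: the specified crossing is the one in slice \<open>h\<close>.\<close>

definition conway_quadruple :: "nat \<Rightarrow> diagram \<Rightarrow> diagram \<Rightarrow> diagram \<Rightarrow> diagram \<Rightarrow> bool" where
  "conway_quadruple h Lp Lm L0 Li \<longleftrightarrow>
     link_diagram Lp \<and> link_diagram Lm \<and> link_diagram L0 \<and> link_diagram Li \<and>
     (\<exists>xs k ys. length xs = h \<and>
        Lp = xs @ [(k, Cross Pos)] @ ys \<and>
        Lm = xs @ [(k, Cross Neg)] @ ys \<and>
        L0 = xs @ [(k, Cap), (k, Cup)] @ ys \<and>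
        Li = xs @ ys)"

definition mixed_crossing :: "diagram \<Rightarrow> nat \<Rightarrow> bool" where
  "mixed_crossing D h \<longleftrightarrow> h < length D \<and>
     (\<exists>k c. D ! h = (k, Cross c) \<and> \<not> same_component D (h, k) (h, k + 1))"

definition kauffman_Q :: "(diagram \<Rightarrow> laurent) \<Rightarrow> bool" where
  "kauffman_Q Q \<longleftrightarrow>
     (\<forall>D. link_diagram D \<longrightarrow> indets (Q D) \<subseteq> {Iw, Ia}) \<and>
     regular_isotopy_invariant Q \<and>
     (\<forall>h Lp Lm L0 Li. conway_quadruple h Lp Lm L0 Li \<longrightarrow>
        Q Lp + Q Lm = var Iw * (Q L0 + Q Li)) \<and>
     (\<forall>s k xs u ys. curl s k u \<longrightarrow> link_diagram (xs @ u @ ys) \<longrightarrow> link_diagram (xs @ ys) \<longrightarrow>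
        Q (xs @ u @ ys) = unit_powi (var Ia) s * Q (xs @ ys)) \<and>
     Q [(0, Cup), (0, Cap)] = 1"

definition invariant_KQ :: "(diagram \<Rightarrow> laurent) \<Rightarrow> (diagram \<Rightarrow> laurent) \<Rightarrow> bool" where
  "invariant_KQ Q KQ \<longleftrightarrow>
     regular_isotopy_invariant KQ \<and>
     (\<forall>h Lp Lm L0 Li. conway_quadruple h Lp Lm L0 Li \<longrightarrow> mixed_crossing Lp h \<longrightarrow>
        KQ Lp + KQ Lm = var Iz * (KQ L0 + KQ Li)) \<and>
     (\<forall>r D. r \<ge> 1 \<longrightarrow> union_of_unlinked_knots r D \<longrightarrow>
        KQ D = unit_powi (var IE) (1 - int r) * Q D)"

text \<open>The case $w = z$; the result is a Laurent polynomial in $z, a, E$.\<close>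

definition KK_of :: "(diagram \<Rightarrow> laurent) \<Rightarrow> diagram \<Rightarrow> laurent" where
  "KK_of KQ D = substitute (var(Iw := var Iz)) (KQ D)"

definition topologically_equivalent :: "(diagram \<Rightarrow> 'r) \<Rightarrow> (diagram \<Rightarrow> 's) \<Rightarrow> bool" where
  "topologically_equivalent f g \<longleftrightarrow>
     (\<forall>D D'. link_diagram D \<longrightarrow> link_diagram D' \<longrightarrow> (f D \<noteq> f D' \<longleftrightarrow> g D \<noteq> g D'))"

end

theory Submission
  imports Defs
begin

text \<open>
  Both sides of the formula satisfy the skein relation for mixed crossings, since these merge two
  components when they are smoothed, and both agree on unions of unlinked knots. By changing mixed
  crossings every diagram becomes layered, a component with a larger number running over all those
  with a smaller one; at every height a braid then sorts the strands by their component, and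
  carrying this braid from the bottom of the diagram to its top absorbs all mixed crossings and
  pulls the components apart. Induction on the number of crossings gives the formula.

  The formula determines \<open>KQ L\<close> from \<open>KK_of KQ L\<close> and the number \<open>n\<close> of components, so it remains
  to read off \<open>n\<close> from \<open>KK_of KQ L\<close>. Modulo 2 and for $a = w = 1$ the relations of $Q$ are those of
  the constant invariant 1, hence $Q$ is odd there: the same sorting argument, with every arc of a
  partial diagram in a layer of its own, unknots a descending diagram. Then \<open>KK_of KQ L\<close> is congruent
  to $E^{1-n}$ modulo 2 at $z = a = 1$.
\<close>

section \<open>Isotopy of tangles\<close>

text \<open>Pulling layers apart is a motion in space, while the moves act on a list of slices in
  which the strands of different components interleave. The sorting braid mediates: its crossings
  obey the same layering rule as the mixed crossings, so that every slice either slides through it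
  or becomes a part of it. Layers of single arcs need more freedom than layers of components, since
  a cap can join two arcs only if these lie in adjacent layers; therefore the induction for
  descending diagrams ranges over all orders of the arcs. Components are handled through colourings:
  their number is the largest number of colours that a colouring can use, and both bounds for a
  smoothing come from recolouring. Parity is the right coarseness for reading off $n$. At z = w = a
  = 1 the value $E^{1-n}$ for all links would contradict the skein relation, which would read
  $2E^{1-n} = 2E^{2-n}$; modulo 2 both sides vanish.\<close>

definition across :: "nat \<Rightarrow> piece \<Rightarrow> nat" where
  "across m p = m - ins p + outs p"

lemma across_simps [simp]:
  "across m Cup = m + 2"
  "across m Cap = m - 2"
  "2 \<le> m \<Longrightarrow> across m (Cross c) = m"
  "across (ins p) p = outs p"
  by (auto simp: across_def)

lemma across_add [simp]:
  "ins p \<le> m \<Longrightarrow> across (m + j) p = across m p + j"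
  "ins p \<le> m \<Longrightarrow> across (j + m) p = j + across m p"
  "ins p \<le> m \<Longrightarrow> across (Suc m) p = Suc (across m p)"
  by (auto simp: across_def)

fun tangle :: "nat \<Rightarrow> diagram \<Rightarrow> bool" where
  "tangle m [] = True"
| "tangle m ((k, p) # D) = (k + ins p \<le> m \<and> tangle (across m p) D)"

fun upper :: "nat \<Rightarrow> diagram \<Rightarrow> nat" where
  "upper m [] = m"
| "upper m ((k, p) # D) = upper (across m p) D"

lemma upper_append [simp]: "upper m (a @ b) = upper (upper m a) b"
  by (induction m a rule: upper.induct) auto

lemma tangle_append [simp]: "tangle m (a @ b) \<longleftrightarrow> tangle m a \<and> tangle (upper m a) b"
  by (induction m a rule: upper.induct) auto

definition shift :: "nat \<Rightarrow> diagram \<Rightarrow> diagram" where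
  "shift j = map (\<lambda>(k, p). (k + j, p))"

lemma shift_simps [simp]:
  "shift j [] = []"
  "shift j ((k, p) # D) = (k + j, p) # shift j D"
  "shift j (a @ b) = shift j a @ shift j b"
  "shift 0 D = D"
  "shift i (shift j D) = shift (i + j) D"
  by (auto simp: shift_def)

lemma tangle_add: "tangle m D \<Longrightarrow> tangle (m + j) D \<and> upper (m + j) D = upper m D + j"
  by (induction m D rule: upper.induct) auto

lemma tangle_shift: "tangle m D \<Longrightarrow> tangle (m + j) (shift j D) \<and> upper (m + j) (shift j D) = upper m D + j"
  by (induction m D rule: upper.induct) auto

lemma tangle_mono: "tangle m D \<Longrightarrow> m \<le> n \<Longrightarrow> tangle n D \<and> upper n D = upper m D + (n - m)"
  using tangle_add[of m D "n - m"] by simp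

definition tangle_move :: "diagram \<Rightarrow> diagram \<Rightarrow> bool" where
  "tangle_move u v \<longleftrightarrow> planar_move u v \<or> reidemeister1 u v \<or> reidemeister2 u v \<or> reidemeister3 u v"

text \<open>Closure under stacking allows local moves on open pieces to be composed, whereas
  \<open>local_change\<close> compares only closed diagrams. Only the number of bottom ends is
  recorded; further strands are added on the right by \<open>tangle_isotopic_add\<close> and on the
  left by \<open>tangle_isotopic_shift\<close>.\<close>

inductive tangle_isotopic :: "nat \<Rightarrow> diagram \<Rightarrow> diagram \<Rightarrow> bool" where
  refl: "tangle m D \<Longrightarrow> tangle_isotopic m D D"
| sym: "tangle_isotopic m D D' \<Longrightarrow> tangle_isotopic m D' D"
| trans [trans]: "tangle_isotopic m D D' \<Longrightarrow> tangle_isotopic m D' D'' \<Longrightarrow> tangle_isotopic m D D''"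
| move: "tangle_move u v \<Longrightarrow> tangle m u \<Longrightarrow> tangle m v \<Longrightarrow> tangle_isotopic m u v"
| append: "tangle_isotopic m a a' \<Longrightarrow> tangle_isotopic (upper m a) b b' \<Longrightarrow>
    tangle_isotopic m (a @ b) (a' @ b')"

lemma tangle_move_upper: "tangle_move u v \<Longrightarrow> tangle m u \<Longrightarrow> upper m u = upper m v"
  unfolding tangle_move_def
  by (auto elim!: planar_move.cases reidemeister1.cases curl.cases reidemeister2.cases
      reidemeister3.cases simp: across_def)

lemma tangle_isotopic_wf:
  "tangle_isotopic m D D' \<Longrightarrow> tangle m D \<and> tangle m D' \<and> upper m D = upper m D'"
proof (induction rule: tangle_isotopic.induct)
  case (move u v m) then show ?case using tangle_move_upper by blast
qed auto

lemma tangle_move_shift: "tangle_move u v \<Longrightarrow> tangle_move (shift j u) (shift j v)"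
proof -
  have "planar_move (shift j u) (shift j v)" if "planar_move u v"
    using that
  proof cases
    case (exchange i p d q)
    then show ?thesis using planar_move.exchange[of "i + j" p d q] by (simp add: ac_simps)
  next
    case (cancel_right k)
    then show ?thesis using planar_move.cancel_right[of "k + j"] by simp
  next
    case (cancel_left k)
    then show ?thesis using planar_move.cancel_left[of "k + j"] by simp
  next
    case (slide_cap k c)
    then show ?thesis using planar_move.slide_cap[of "k + j" c] by simp
  next
    case (slide_cup k c)
    then show ?thesis using planar_move.slide_cup[of "k + j" c] by simp
  qed
  moreover have "reidemeister1 (shift j u) (shift j v)" if "reidemeister1 u v"
  proof -
    have "curl s (k + j) (shift j u)" if "curl s k u" for s k
      using that by cases (use curl.intros[of "k + j"] in auto)
    then show ?thesis using that by (metis reidemeister1.simps shift_simps(1))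
  qed
  moreover have "reidemeister2 (shift j u) (shift j v)" if "reidemeister2 u v"
    using that by (auto elim!: reidemeister2.cases intro: reidemeister2.intros)
  moreover have "reidemeister3 (shift j u) (shift j v)" if "reidemeister3 u v"
    using that reidemeister3.intros[where k = "_ + j"]
    by (auto elim!: reidemeister3.cases)
  ultimately show "tangle_move u v \<Longrightarrow> tangle_move (shift j u) (shift j v)"
    unfolding tangle_move_def by blast
qed

lemma tangle_isotopic_shift:
  "tangle_isotopic m D D' \<Longrightarrow> tangle_isotopic (m + j) (shift j D) (shift j D')"
proof (induction rule: tangle_isotopic.induct)
  case (append m a a' b b')
  then show ?case
    using tangle_shift[of m a j] tangle_isotopic_wf[OF append(1)] tangle_isotopic.append by simp
qed (auto intro: tangle_isotopic.intros tangle_move_shift simp: tangle_shift)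

lemma tangle_isotopic_add: "tangle_isotopic m D D' \<Longrightarrow> tangle_isotopic (m + j) D D'"
proof (induction rule: tangle_isotopic.induct)
  case (append m a a' b b')
  then show ?case
    using tangle_add[of m a j] tangle_isotopic_wf[OF append(1)] tangle_isotopic.append by simp
qed (auto intro: tangle_isotopic.intros simp: tangle_add)

lemma tangle_isotopic_mono: "tangle_isotopic m D D' \<Longrightarrow> m \<le> n \<Longrightarrow> tangle_isotopic n D D'"
  using tangle_isotopic_add[of m D D' "n - m"] by simp

lemma tangle_isotopic_context:
  assumes "tangle_isotopic (upper m xs) u v" "tangle m (xs @ u @ ys)"
  shows "tangle_isotopic m (xs @ u @ ys) (xs @ v @ ys)"
  using assms tangle_isotopic_wf[OF assms(1)]
  by (intro tangle_isotopic.append[OF tangle_isotopic.refl tangle_isotopic.append[OF _ tangle_isotopic.refl]]) auto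

lemma tangle_isotopic_move_context:
  assumes "tangle_move u v" "tangle m (xs @ u @ ys)" "tangle (upper m xs) v"
  shows "tangle_isotopic m (xs @ u @ ys) (xs @ v @ ys)"
  using assms by (intro tangle_isotopic_context tangle_isotopic.move) auto

lemma tangle_moves:
  "tangle_move [(i, p), (i + outs p + d, q)] [(i + ins p + d, q), (i, p)]"
  "tangle_move [(k + 1, Cup), (k, Cap)] []"
  "tangle_move [(k, Cup), (k + 1, Cap)] []"
  "tangle_move [(k + 1, Cross c), (k, Cap)] [(k, Cross (flip c)), (k + 1, Cap)]"
  "tangle_move [(k, Cup), (k + 1, Cross c)] [(k + 1, Cup), (k, Cross (flip c))]"
  "tangle_move [(k, Cross c), (k, Cross (flip c))] []"
  "c' = c \<or> c' = c'' \<Longrightarrow> tangle_move [(k, Cross c), (k + 1, Cross c'), (k, Cross c'')]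
     [(k + 1, Cross c''), (k, Cross c'), (k + 1, Cross c)]"
  "tangle_move [(k + 1, Cup), (k, Cross c), (k + 1, Cap)] []"
  "tangle_move [(k, Cup), (k + 1, Cross c), (k, Cap)] []"
  subgoal unfolding tangle_move_def by (blast intro: planar_move.intros)
  subgoal unfolding tangle_move_def by (blast intro: planar_move.intros)
  subgoal unfolding tangle_move_def by (blast intro: planar_move.intros)
  subgoal unfolding tangle_move_def by (blast intro: planar_move.intros)
  subgoal unfolding tangle_move_def by (blast intro: planar_move.intros)
  subgoal unfolding tangle_move_def by (blast intro: reidemeister2.intros)
  subgoal unfolding tangle_move_def by (blast intro: reidemeister3.intros)
  subgoal unfolding tangle_move_def by (cases c; blast intro: reidemeister1.intros curl.intros)
  subgoal unfolding tangle_move_def by (cases c; blast intro: reidemeister1.intros curl.intros)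
  done

lemma flip_flip [simp]: "flip (flip c) = c"
  by (cases c) auto

lemma link_diagram_iff_tangle: "link_diagram D \<longleftrightarrow> D \<noteq> [] \<and> tangle 0 D \<and> upper 0 D = 0"
proof -
  have upper: "upper m D = fold (\<lambda>(k, p) m. m - ins p + outs p) D m" for m D
    by (induction m D rule: upper.induct) (auto simp: across_def)
  have "tangle m D \<longleftrightarrow> (\<forall>h < length D. fst (D ! h) + ins (snd (D ! h)) \<le> upper m (take h D))" for m
    by (induction m D rule: upper.induct) (auto simp: All_less_Suc2 across_def)
  then show ?thesis
    by (simp add: link_diagram_def strands_def upper)
qed

lemma strands_eq_upper: "strands D h = upper 0 (take h D)"
proof -
  have upper: "upper m D = fold (\<lambda>(k, p) m. m - ins p + outs p) D m" for m D
    by (induction m D rule: upper.induct) (auto simp: across_def)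
  show ?thesis by (simp add: strands_def upper)
qed

text \<open>A move with an empty side (cancellation, curl, Reidemeister II) needs a strand to act on
  and is not well formed without bottom ends. This matters because the empty diagram does not count
  as a link.\<close>

lemma tangle_isotopic_Nil_iff: "tangle_isotopic m D D' \<Longrightarrow> m = 0 \<Longrightarrow> D = [] \<longleftrightarrow> D' = []"
proof (induction rule: tangle_isotopic.induct)
  case (move u v m)
  then show ?case unfolding tangle_move_def
    by (auto elim!: planar_move.cases reidemeister1.cases curl.cases reidemeister2.cases
        reidemeister3.cases)
qed auto

text \<open>An isotopy of links has to pass through link diagrams at every step, so the induction
  carries along that the surroundings close up the tangle and that the whole never becomes
  empty.\<close>

lemma isotopic_context:
  assumes "tangle_isotopic m u v" "tangle 0 xs" "upper 0 xs = m"
    "tangle (upper m u) ys" "upper (upper m u) ys = 0" "xs @ u @ ys \<noteq> []"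
  shows "isotopic (xs @ u @ ys) (xs @ v @ ys)"
  using assms
proof (induction arbitrary: xs ys rule: tangle_isotopic.induct)
  case (refl m D)
  then show ?case by (simp add: isotopic_def)
next
  case (sym m D D')
  have "m = 0 \<Longrightarrow> D = [] \<longleftrightarrow> D' = []" "upper m D = upper m D'"
    using tangle_isotopic_Nil_iff[OF sym.hyps] tangle_isotopic_wf[OF sym.hyps] by auto
  then have "isotopic (xs @ D @ ys) (xs @ D' @ ys)"
    using sym by (intro sym.IH) auto
  then show ?case by (simp add: isotopic_def equivclp_sym)
next
  case (trans m D D' D'')
  have *: "m = 0 \<Longrightarrow> D = [] \<longleftrightarrow> D' = []" "upper m D = upper m D'"
    using tangle_isotopic_Nil_iff[OF trans.hyps(1)] tangle_isotopic_wf[OF trans.hyps(1)] by auto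
  have "isotopic (xs @ D @ ys) (xs @ D' @ ys)" "isotopic (xs @ D' @ ys) (xs @ D'' @ ys)"
    using trans.prems * by (auto intro!: trans.IH)
  then show ?case unfolding isotopic_def by (rule equivclp_trans)
next
  case (move u v m)
  have "upper m u = upper m v" using move tangle_move_upper by blast
  moreover have "m = 0 \<Longrightarrow> u = [] \<longleftrightarrow> v = []"
    using tangle_isotopic_Nil_iff[OF tangle_isotopic.move[OF move.hyps]] by auto
  ultimately have "link_diagram (xs @ u @ ys)" "link_diagram (xs @ v @ ys)"
    using move by (auto simp: link_diagram_iff_tangle)
  with move(1) show ?case unfolding isotopic_def local_change_def tangle_move_def
    by (intro r_into_equivclp) blast
next
  case (append m a a' b b')
  note wf = tangle_isotopic_wf[OF append.hyps(1)] tangle_isotopic_wf[OF append.hyps(2)]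
  have *: "m = 0 \<Longrightarrow> a = [] \<longleftrightarrow> a' = []"
    using tangle_isotopic_Nil_iff[OF append.hyps(1)] by auto
  have "isotopic (xs @ a @ (b @ ys)) (xs @ a' @ (b @ ys))"
    using append.prems wf by (intro append.IH) auto
  moreover have "isotopic ((xs @ a') @ b @ ys) ((xs @ a') @ b' @ ys)"
    using append.prems wf * by (intro append.IH) auto
  ultimately show ?case unfolding isotopic_def by (auto intro: equivclp_trans)
qed

lemma tangle_isotopic_imp_isotopic:
  "tangle_isotopic 0 D D' \<Longrightarrow> link_diagram D \<Longrightarrow> isotopic D D' \<and> link_diagram D'"
  using isotopic_context[of 0 D D' "[]" "[]"] tangle_isotopic_wf[of 0 D D']
    tangle_isotopic_Nil_iff[of 0 D D'] by (auto simp: link_diagram_iff_tangle)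

section \<open>Layered braids\<close>

lemma tangle_replace_move:
  assumes "tangle_move u v" "tangle m (xs @ u @ ys)" "tangle (upper m xs) v" "a = xs @ u @ ys" "b = xs @ v @ ys"
  shows "tangle_isotopic m a b"
  using assms tangle_isotopic_move_context by blast

text \<open>The isotopy may be known for fewer strands than are present; the surplus strands run
  past on the right.\<close>

lemma tangle_replace:
  assumes "tangle_isotopic n u v" "n \<le> upper m xs" "tangle m xs" "tangle (upper m xs - n + upper n u) ys"
    "a = xs @ u @ ys" "b = xs @ v @ ys"
  shows "tangle_isotopic m a b"
proof -
  have *: "tangle_isotopic (upper m xs) u v"
    using tangle_isotopic_mono[OF assms(1,2)] .
  have "upper (upper m xs) u = upper m xs - n + upper n u"
    using tangle_mono[of n u "upper m xs"] tangle_isotopic_wf[OF assms(1)] assms(2) by simp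
  with assms * show ?thesis
    using tangle_isotopic_wf[OF *] by (auto intro!: tangle_isotopic_context)
qed

lemma tangle_replace_sym:
  assumes "tangle_isotopic n v u" "n \<le> upper m xs" "tangle m xs" "tangle (upper m xs - n + upper n v) ys"
    "a = xs @ u @ ys" "b = xs @ v @ ys"
  shows "tangle_isotopic m a b"
  using tangle_replace[OF assms(1-4) HOL.refl HOL.refl] assms(5,6) tangle_isotopic.sym by blast

section \<open>Commutation of tangles that lie side by side\<close>

text \<open>The offset of \<open>C\<close> is the number of strands to its left, which is
  \<open>across m p\<close> above the piece and \<open>m\<close> below it.\<close>

lemma interchange_single:
  assumes "i + ins p \<le> m" "tangle m' C"
  shows "tangle_isotopic (m + m') ((i, p) # shift (across m p) C) (shift m C @ [(i, p)])"
  using assms(2)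
proof (induction m' C rule: upper.induct)
  case (1 m')
  then show ?case using assms(1) by (auto intro: tangle_isotopic.refl)
next
  case (2 m' j q C)
  let ?n = "across m p"
  have "tangle_isotopic (m + m') ([(i, p), (j + ?n, q)] @ shift ?n C) ([(j + m, q)] @ ((i, p) # shift ?n C))"
  proof (rule tangle_replace_move[where xs = "[]" and ys = "shift ?n C"])
    \<comment> \<open>The offset in the exchange move is the number of strands between the two
      pieces.\<close>
    have eq: "j + ?n = i + outs p + (j + (m - ins p - i))" "j + m = i + ins p + (j + (m - ins p - i))"
      using assms(1) by (auto simp: across_def)
    show "tangle_move [(i, p), (j + ?n, q)] [(j + m, q), (i, p)]"
      unfolding eq by (rule tangle_moves)
    show "tangle (m + m') ([] @ [(i, p), (j + ?n, q)] @ shift ?n C)"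
      using assms(1) 2 tangle_shift[of "across m' q" C ?n] by (simp add: ac_simps)
    show "tangle (upper (m + m') []) [(j + m, q), (i, p)]"
      using assms(1) 2(2) by simp
  qed auto
  also have "tangle_isotopic (m + m') ([(j + m, q)] @ ((i, p) # shift ?n C)) ([(j + m, q)] @ shift m C @ [(i, p)])"
  proof (rule tangle_isotopic.append)
    show "tangle_isotopic (m + m') [(j + m, q)] [(j + m, q)]"
      using 2(2) by (auto intro: tangle_isotopic.refl)
    have eq: "upper (m + m') [(j + m, q)] = m + across m' q" using 2(2) by auto
    show "tangle_isotopic (upper (m + m') [(j + m, q)]) ((i, p) # shift ?n C) (shift m C @ [(i, p)])"
      unfolding eq using 2 by simp
  qed
  finally show ?case by simp
qed

lemma interchange:
  assumes "tangle m T" "tangle m' C"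
  shows "tangle_isotopic (m + m') (T @ shift (upper m T) C) (shift m C @ T)"
  using assms
proof (induction m T rule: upper.induct)
  case (1 m)
  then show ?case using tangle_shift[of m' C m] by (auto intro: tangle_isotopic.refl simp: ac_simps)
next
  case (2 m i p T)
  let ?n = "across m p"
  have eq: "across (m + m') p = ?n + m'" using 2(2) by auto
  have "tangle_isotopic (m + m') ([(i, p)] @ (T @ shift (upper ?n T) C)) ([(i, p)] @ (shift ?n C @ T))"
    by (rule tangle_replace[OF "2.IH", where xs = "[(i, p)]" and ys = "[]"]) (use 2 eq in auto)
  also have "tangle_isotopic (m + m') ([(i, p)] @ (shift ?n C @ T)) ((shift m C @ [(i, p)]) @ T)"
    by (rule tangle_replace[OF interchange_single[of i p m m' C], where xs = "[]" and ys = T])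
      (use 2 eq tangle_shift[of m' C ?n] tangle_add[of ?n T "upper m' C"] in \<open>auto simp: add.commute\<close>)
  finally show ?case by simp
qed

section \<open>One strand travelling over the others\<close>

text \<open>The strand at position \<open>j\<close> travels to the far left. At a crossing of type
  \<open>Pos\<close> the strand going left is the upper one, so it stays on top all the way.\<close>

fun pass_left :: "nat \<Rightarrow> diagram" where
  "pass_left 0 = []"
| "pass_left (Suc j) = (j, Cross Pos) # pass_left j"

lemma tangle_pass_left [simp]: "j < m \<Longrightarrow> tangle m (pass_left j)" "j < m \<Longrightarrow> upper m (pass_left j) = m"
  by (induction j) auto

lemma pass_left_add: "pass_left (a + b) = shift a (pass_left b) @ pass_left a"
  by (induction b) (auto simp: ac_simps)

lemma pass_left_Suc: "pass_left (Suc j) = shift 1 (pass_left j) @ [(0, Cross Pos)]"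
  using pass_left_add[of 1 j] by simp

text \<open>An extremum slides across a crossing, with a pair of crossings cancelled or created by
  Reidemeister II; a crossing needs Reidemeister III. There the travelling strand is above both
  others, which gives the side condition on the layers.\<close>

lemma pass_left_core:
  "tangle_isotopic (ins p + 1) ((0, p) # pass_left (outs p)) (pass_left (ins p) @ [(1, p)])"
proof (cases p)
  case Cup
  have "tangle_isotopic 1 [(0, Cup), (1, Cross Pos), (0, Cross Pos)] [(1, Cup), (0, Cross Neg), (0, Cross Pos)]"
    by (rule tangle_replace_move[where xs = "[]" and ys = "[(0, Cross Pos)]", OF tangle_moves(5)[of 0 Pos]]) auto
  also have "tangle_isotopic 1 [(1, Cup), (0, Cross Neg), (0, Cross Pos)] [(1, Cup)]"
    by (rule tangle_replace_move[where xs = "[(1, Cup)]" and ys = "[]", OF tangle_moves(6)[of 0 Neg]]) auto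
  finally show ?thesis using Cup by (simp add: numeral_eq_Suc)
next
  case Cap
  have "tangle_isotopic 3 [(0, Cap)] [(1, Cross Pos), (1, Cross Neg), (0, Cap)]"
    by (rule tangle_isotopic.sym, rule tangle_replace_move[where xs = "[]" and ys = "[(0, Cap)]", OF tangle_moves(6)[of 1 Pos]]) auto
  also have "tangle_isotopic 3 [(1, Cross Pos), (1, Cross Neg), (0, Cap)] [(1, Cross Pos), (0, Cross Pos), (1, Cap)]"
    by (rule tangle_replace_move[where xs = "[(1, Cross Pos)]" and ys = "[]", OF tangle_moves(4)[of 0 Neg]]) auto
  finally show ?thesis using Cap by (simp add: numeral_eq_Suc)
next
  case (Cross c)
  have "tangle_isotopic 3 [(0, Cross c), (1, Cross Pos), (0, Cross Pos)] [(1, Cross Pos), (0, Cross Pos), (1, Cross c)]"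
    by (rule tangle_replace_move[where xs = "[]" and ys = "[]", OF tangle_moves(7)[of Pos c Pos 0]]) auto
  then show ?thesis using Cross by (simp add: numeral_eq_Suc)
qed

text \<open>The travelling strand meets three groups in turn: the strands to the right of the piece,
  the piece, and the strands to its left. Only the middle group needs \<open>pass_left_core\<close>;
  the crossings with the outer groups lie beside the piece and commute with it.\<close>

lemma pass_left_single:
  assumes "i + ins p \<le> m"
  shows "tangle_isotopic (m + 1) ((i, p) # pass_left (across m p)) (pass_left m @ [(i + 1, p)])"
proof -
  define d where "d = m - ins p - i"
  have m: "m = i + ins p + d" using assms by (auto simp: d_def)
  let ?I = "i + ins p" and ?O = "i + outs p"
  have n: "across m p = i + outs p + d" using m by (auto simp: across_def)
  have e1: "pass_left m = shift ?I (pass_left d) @ shift i (pass_left (ins p)) @ pass_left i"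
    unfolding m by (simp add: pass_left_add)
  have e2: "pass_left (across m p) = shift ?O (pass_left d) @ shift i (pass_left (outs p)) @ pass_left i"
    unfolding n by (simp add: pass_left_add)
  have t: "tangle (Suc m) (shift ?I (pass_left d))" "upper (Suc m) (shift ?I (pass_left d)) = Suc m"
    "tangle (Suc (?O + d)) (shift ?O (pass_left d))" "upper (Suc (?O + d)) (shift ?O (pass_left d)) = Suc (?O + d)"
    "tangle (Suc (?O + d)) (shift i (pass_left (outs p)))" "upper (Suc (?O + d)) (shift i (pass_left (outs p))) = Suc (?O + d)"
    "tangle (Suc m) (shift i (pass_left (ins p)))" "upper (Suc m) (shift i (pass_left (ins p))) = Suc m"
    using tangle_shift[of "Suc d" "pass_left d" ?I] tangle_shift[of "Suc d" "pass_left d" ?O] tangle_shift[of "Suc (outs p + d)" "pass_left (outs p)" i]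
      tangle_shift[of "Suc (ins p + d)" "pass_left (ins p)" i]
    by (auto simp: m ac_simps)
  have "tangle_isotopic (m + 1) (((i, p) # shift ?O (pass_left d)) @ shift i (pass_left (outs p)) @ pass_left i)
      ((shift ?I (pass_left d) @ [(i, p)]) @ shift i (pass_left (outs p)) @ pass_left i)"
    by (rule tangle_replace[OF interchange_single[of i p ?I "d + 1" "pass_left d"],
        where xs = "[]" and ys = "shift i (pass_left (outs p)) @ pass_left i"]) (use t m in auto)
  also have "tangle_isotopic (m + 1) ((shift ?I (pass_left d) @ [(i, p)]) @ shift i (pass_left (outs p)) @ pass_left i)
     (shift ?I (pass_left d) @ (shift i (pass_left (ins p)) @ [(i + 1, p)]) @ pass_left i)"
    by (rule tangle_replace[OF tangle_isotopic_shift[OF pass_left_core[of p], of i],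
        where xs = "shift ?I (pass_left d)" and ys = "pass_left i"])
      (use t m tangle_shift[of "ins p + 1" "(0,p) # pass_left (outs p)" i] in auto)
  also have "tangle_isotopic (m + 1) (shift ?I (pass_left d) @ (shift i (pass_left (ins p)) @ [(i + 1, p)]) @ pass_left i)
     ((shift ?I (pass_left d) @ shift i (pass_left (ins p))) @ pass_left i @ [(i + 1, p)])"
    by (rule tangle_replace_sym[OF interchange[of "i + 1" "pass_left i" "ins p" "[(0, p)]"],
        where xs = "shift ?I (pass_left d) @ shift i (pass_left (ins p))" and ys = "[]"])
      (use t m in auto)
  finally show ?thesis unfolding e1 e2 by simp
qed

lemma pass_left_natural:
  assumes "tangle m T"
  shows "tangle_isotopic (m + 1) (T @ pass_left (upper m T)) (pass_left m @ shift 1 T)"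
  using assms
proof (induction m T rule: upper.induct)
  case (1 m)
  then show ?case by (auto intro: tangle_isotopic.refl)
next
  case (2 m i p T)
  let ?n = "across m p"
  have n: "across (m + 1) p = ?n + 1" using 2(2) by auto
  have "tangle_isotopic (m + 1) ([(i, p)] @ (T @ pass_left (upper ?n T)))
     ([(i, p)] @ (pass_left ?n @ shift 1 T))"
    by (rule tangle_replace[OF "2.IH", where xs = "[(i, p)]" and ys = "[]"]) (use 2(2) n in auto)
  also have "tangle_isotopic (m + 1) ([(i, p)] @ (pass_left ?n @ shift 1 T)) ((pass_left m @ [(i + 1, p)]) @ shift 1 T)"
    by (rule tangle_replace[OF pass_left_single[of i p m], where xs = "[]" and ys = "shift 1 T"])
      (use 2(2) n tangle_shift[of ?n T 1] in auto)
  finally show ?case by simp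
qed

section \<open>A bundle of parallel strands travelling over the others\<close>

fun pass_block :: "nat \<Rightarrow> nat \<Rightarrow> diagram" where
  "pass_block 0 j = []"
| "pass_block (Suc r) j = pass_left j @ shift 1 (pass_block r j)"

lemma tangle_mono_shift:
  assumes "\<And>m. n \<le> m \<Longrightarrow> tangle m D \<and> upper m D = m"
  shows "n + s \<le> m \<Longrightarrow> tangle m (shift s D) \<and> upper m (shift s D) = m"
  using assms[of "m - s"] tangle_shift[of "m - s" D s] by simp

lemma tangle_shift_pass_left [simp]:
  "j + s < m \<Longrightarrow> tangle m (shift s (pass_left j))"
  "j + s < m \<Longrightarrow> upper m (shift s (pass_left j)) = m"
  using tangle_mono_shift[of "Suc j" "pass_left j" s m] by auto

lemma tangle_pass_block:
  "r + j \<le> m \<Longrightarrow> tangle m (pass_block r j) \<and> upper m (pass_block r j) = m"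
proof (induction r arbitrary: m)
  case (Suc r)
  then show ?case using tangle_mono_shift[of "r + j" "pass_block r j" 1] by auto
qed auto

lemma tangle_pass_block_simps [simp]:
  "r + j \<le> m \<Longrightarrow> tangle m (pass_block r j)"
  "r + j \<le> m \<Longrightarrow> upper m (pass_block r j) = m"
  "r + j + s \<le> m \<Longrightarrow> tangle m (shift s (pass_block r j))"
  "r + j + s \<le> m \<Longrightarrow> upper m (shift s (pass_block r j)) = m"
  using tangle_pass_block tangle_mono_shift[OF tangle_pass_block] by auto

text \<open>Crossings of type \<open>Pos\<close> again, but followed along the lower strand, which
  travels to the right under \<open>r\<close> strands.\<close>

definition pass_one :: "nat \<Rightarrow> nat \<Rightarrow> diagram" where
  "pass_one r j = map (\<lambda>i. (j + i, Cross Pos)) [0..<r]"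

lemma tangle_pass_one: "r + Suc j \<le> m \<Longrightarrow> tangle m (pass_one r j) \<and> upper m (pass_one r j) = m"
proof -
  have "tangle m (map (\<lambda>i. (j + i, Cross Pos)) [0..<s]) \<and> upper m (map (\<lambda>i. (j + i, Cross Pos)) [0..<s]) = m"
    if "s + Suc j \<le> m" for s m
    using that by (induction s) auto
  then show "r + Suc j \<le> m \<Longrightarrow> ?thesis" by (simp add: pass_one_def)
qed

lemma tangle_pass_one_simps [simp]:
  "r + Suc j \<le> m \<Longrightarrow> tangle m (pass_one r j)"
  "r + Suc j \<le> m \<Longrightarrow> upper m (pass_one r j) = m"
  "r + Suc j + s \<le> m \<Longrightarrow> tangle m (shift s (pass_one r j))"
  "r + Suc j + s \<le> m \<Longrightarrow> upper m (shift s (pass_one r j)) = m"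
  using tangle_pass_one tangle_mono_shift[OF tangle_pass_one] by auto

lemma pass_one_Suc: "pass_one (Suc r) j = (j, Cross Pos) # shift 1 (pass_one r j)"
  unfolding pass_one_def shift_def by (auto simp: upt_conv_Cons map_Suc_upt[symmetric] simp del: upt_Suc)

text \<open>The crossings of two bundles can be performed strand by strand of the upper bundle, as
  in the definition, or strand by strand of the lower one. The second order allows an induction on
  \<open>j\<close> in which a piece passes over a single lower strand at a time.\<close>

lemma pass_block_Suc: "tangle_isotopic (r + Suc j) (pass_block r (Suc j)) (pass_one r j @ pass_block r j)"
proof (induction r)
  case 0
  then show ?case by (auto simp: pass_one_def intro: tangle_isotopic.refl)
next
  case (Suc r)
  have "tangle_isotopic (Suc r + Suc j) (pass_left (Suc j) @ shift 1 (pass_block r (Suc j)))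
     (pass_left (Suc j) @ shift 1 (pass_one r j @ pass_block r j))"
    by (rule tangle_replace[OF tangle_isotopic_shift[OF Suc, of 1], where xs = "pass_left (Suc j)" and ys = "[]"])
      auto
  also have "tangle_isotopic (Suc r + Suc j) (pass_left (Suc j) @ shift 1 (pass_one r j @ pass_block r j))
     ([(j, Cross Pos)] @ (shift 1 (pass_one r j) @ pass_left j) @ shift 1 (pass_block r j))"
  proof -
    have "shift (Suc j) (pass_one r 0) = shift 1 (pass_one r j)"
      by (auto simp: pass_one_def shift_def)
    moreover have "tangle (r + 1) (pass_one r 0)"
      using tangle_pass_one[of r 0] by simp
    ultimately have "tangle_isotopic (Suc j + (r + 1)) (pass_left j @ shift 1 (pass_one r j)) (shift 1 (pass_one r j) @ pass_left j)"
      using interchange[of "Suc j" "pass_left j" "r + 1" "pass_one r 0"] by simp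
    then show ?thesis
      by (rule tangle_replace[where xs = "[(j, Cross Pos)]" and ys = "shift 1 (pass_block r j)"])
        auto
  qed
  finally show ?case by (simp add: pass_one_Suc)
qed

text \<open>The same moves as for \<open>pass_left_core\<close>, but now the single strand lies
  below everything it meets; in the case of Reidemeister III this gives the other alternative of the
  side condition.\<close>

lemma pass_one_core:
  "tangle_isotopic (Suc j + ins p) ((Suc j, p) # pass_one (outs p) j) (pass_one (ins p) j @ [(j, p)])"
proof -
  have *: "tangle_isotopic (1 + ins p) ((1, p) # pass_one (outs p) 0) (pass_one (ins p) 0 @ [(0, p)])"
  proof (cases p)
    case Cup
    have "tangle_isotopic 1 [(1, Cup), (0, Cross Pos), (1, Cross Pos)] [(0, Cup), (1, Cross Neg), (1, Cross Pos)]"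
      by (rule tangle_isotopic.sym, rule tangle_replace_move[where xs = "[]" and ys = "[(1, Cross Pos)]", OF tangle_moves(5)[of 0 Neg]]) auto
    also have "tangle_isotopic 1 [(0, Cup), (1, Cross Neg), (1, Cross Pos)] [(0, Cup)]"
      by (rule tangle_replace_move[where xs = "[(0, Cup)]" and ys = "[]", OF tangle_moves(6)[of 1 Neg]]) auto
    finally show ?thesis using Cup by (simp add: numeral_eq_Suc pass_one_def)
  next
    case Cap
    have "tangle_isotopic 3 [(1, Cap)] [(0, Cross Pos), (0, Cross Neg), (1, Cap)]"
      by (rule tangle_isotopic.sym, rule tangle_replace_move[where xs = "[]" and ys = "[(1, Cap)]", OF tangle_moves(6)[of 0 Pos]]) auto
    also have "tangle_isotopic 3 [(0, Cross Pos), (0, Cross Neg), (1, Cap)] [(0, Cross Pos), (1, Cross Pos), (0, Cap)]"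
      by (rule tangle_isotopic.sym, rule tangle_replace_move[where xs = "[(0, Cross Pos)]" and ys = "[]", OF tangle_moves(4)[of 0 Pos]]) auto
    finally show ?thesis using Cap by (simp add: numeral_eq_Suc pass_one_def)
  next
    case (Cross c)
    have "tangle_isotopic 3 [(1, Cross c), (0, Cross Pos), (1, Cross Pos)] [(0, Cross Pos), (1, Cross Pos), (0, Cross c)]"
      by (rule tangle_isotopic.sym, rule tangle_replace_move[where xs = "[]" and ys = "[]", OF tangle_moves(7)[of Pos Pos c 0]]) auto
    then show ?thesis using Cross by (simp add: numeral_eq_Suc pass_one_def)
  qed
  have "shift j (pass_one r 0) = pass_one r j" for r
    by (auto simp: pass_one_def shift_def)
  then show ?thesis using tangle_isotopic_shift[OF *, of j] by (simp add: ac_simps)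
qed

lemma pass_block_natural:
  "tangle_isotopic (j + ins p) ((j, p) # pass_block (outs p) j) (pass_block (ins p) j @ [(0, p)])"
proof (induction j)
  case 0
  have "pass_block r 0 = []" for r by (induction r) auto
  then show ?case by (auto intro: tangle_isotopic.refl)
next
  case (Suc j)
  have "tangle_isotopic (Suc j + ins p) ([(Suc j, p)] @ pass_block (outs p) (Suc j))
     ([(Suc j, p)] @ (pass_one (outs p) j @ pass_block (outs p) j))"
    by (rule tangle_replace[OF pass_block_Suc[of "outs p" j], where xs = "[(Suc j, p)]" and ys = "[]"]) auto
  also have "tangle_isotopic (Suc j + ins p) ([(Suc j, p)] @ (pass_one (outs p) j @ pass_block (outs p) j))
     (pass_one (ins p) j @ ((j, p) # pass_block (outs p) j))"
    by (rule tangle_replace[OF pass_one_core[of j p], where xs = "[]" and ys = "pass_block (outs p) j"]) auto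
  also have "tangle_isotopic (Suc j + ins p) (pass_one (ins p) j @ ((j, p) # pass_block (outs p) j))
     ((pass_one (ins p) j @ pass_block (ins p) j) @ [(0, p)])"
    by (rule tangle_replace[OF Suc, where xs = "pass_one (ins p) j" and ys = "[]"]) auto
  also have "tangle_isotopic (Suc j + ins p) ((pass_one (ins p) j @ pass_block (ins p) j) @ [(0, p)])
     (pass_block (ins p) (Suc j) @ [(0, p)])"
    by (rule tangle_replace_sym[OF pass_block_Suc[of "ins p" j], where xs = "[]" and ys = "[(0, p)]"]) auto
  finally show ?case by simp
qed

section \<open>The sorting braid\<close>

text \<open>This is the position at which the label \<open>x\<close> begins in the sorted
  word.\<close>

definition smaller :: "nat \<Rightarrow> nat list \<Rightarrow> nat" where
  "smaller x w = length (filter (\<lambda>y. y < x) w)"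

lemma smaller_simps [simp]:
  "smaller x [] = 0"
  "smaller x (y # w) = (if y < x then Suc (smaller x w) else smaller x w)"
  "smaller x (u @ v) = smaller x u + smaller x v"
  "smaller x (replicate n y) = (if y < x then n else 0)"
  by (auto simp: smaller_def)

lemma smaller_le: "smaller x w \<le> length w"
  by (simp add: smaller_def)

lemma smaller_count_le: "smaller x w + count_list w x \<le> length w"
  by (induction w) auto

lemma smaller_mono: "x \<le> y \<Longrightarrow> smaller x w \<le> smaller y w"
  by (induction w) auto

lemma smaller_count_mono: "x < y \<Longrightarrow> smaller x w + count_list w x \<le> smaller y w"
  by (induction w) auto

text \<open>The bottom ends of \<open>unsort w\<close> are sorted by their labels, the top ends spell \<open>w\<close>, and a
  strand runs over all strands with a smaller label.\<close>

fun unsort :: "nat list \<Rightarrow> diagram" where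
  "unsort [] = []"
| "unsort (x # w) = pass_left (smaller x w) @ shift 1 (unsort w)"

lemma tangle_unsort [simp]: "tangle (length w) (unsort w)" "upper (length w) (unsort w) = length w"
proof -
  have "tangle (length w) (unsort w) \<and> upper (length w) (unsort w) = length w"
  proof (induction w)
    case (Cons x w)
    then show ?case using tangle_shift[of "length w" "unsort w" 1] smaller_le[of x w] by auto
  qed auto
  then show "tangle (length w) (unsort w)" "upper (length w) (unsort w) = length w" by auto
qed

lemma tangle_unsort' [simp]: "length w \<le> m \<Longrightarrow> tangle m (unsort w)" "length w \<le> m \<Longrightarrow> upper m (unsort w) = m"
  using tangle_mono[of "length w" "unsort w" m] by auto

lemma tangle_shift_unsort [simp]:
  "length w + j \<le> m \<Longrightarrow> tangle m (shift j (unsort w))"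
  "length w + j \<le> m \<Longrightarrow> upper m (shift j (unsort w)) = m"
  using tangle_shift[of "length w" "unsort w" j] tangle_mono[of "length w + j" "shift j (unsort w)" m] by auto

lemma unsort_replicate_append:
  "unsort (replicate r x @ v) = pass_block r (smaller x v) @ shift r (unsort v)"
  by (induction r) auto

text \<open>The sorting is stable, so the equally labelled ends at the piece are neighbours at the
  bottom of the braid too, right behind the ends with the same label further left. A strand to the
  left of the piece runs over the piece if its label is larger; otherwise it only meets strands to
  the left of the piece, and its crossings commute with it.\<close>

lemma unsort_natural:
  "tangle_isotopic (length (u @ replicate (ins p) x @ v))
     (unsort (u @ replicate (ins p) x @ v) @ [(length u, p)])
     ((smaller x (u @ v) + count_list u x, p) # unsort (u @ replicate (outs p) x @ v))"
proof (induction u)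
  case Nil
  let ?j = "smaller x v"
  have j: "?j \<le> length v" by (rule smaller_le)
  have "tangle_isotopic (ins p + length v)
      (pass_block (ins p) ?j @ (shift (ins p) (unsort v) @ [(0, p)]))
      ((pass_block (ins p) ?j @ [(0, p)]) @ shift (outs p) (unsort v))"
    by (rule tangle_replace_sym[OF interchange[of "ins p" "[(0, p)]" "length v" "unsort v"],
          where xs = "pass_block (ins p) ?j" and ys = "[]"]) (use j in auto)
  also have "tangle_isotopic (ins p + length v)
      ((pass_block (ins p) ?j @ [(0, p)]) @ shift (outs p) (unsort v))
      ((?j, p) # pass_block (outs p) ?j @ shift (outs p) (unsort v))"
    by (rule tangle_replace_sym[OF pass_block_natural[of ?j p], where xs = "[]" and ys = "shift (outs p) (unsort v)"])
      (use j in auto)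
  finally show ?case by (simp add: unsort_replicate_append)
next
  case (Cons z u)
  let ?W = "u @ replicate (ins p) x @ v" and ?W' = "u @ replicate (outs p) x @ v"
  let ?pos = "smaller x (u @ v) + count_list u x"
  have pos: "?pos \<le> length u + length v"
    using smaller_count_le[of x u] smaller_le[of x v] by simp
  have "tangle_isotopic (Suc (length ?W))
      (pass_left (smaller z ?W) @ shift 1 (unsort ?W @ [(length u, p)]))
      (pass_left (smaller z ?W) @ shift 1 ((?pos, p) # unsort ?W'))"
    by (rule tangle_replace[OF tangle_isotopic_shift[OF Cons, of 1], where xs = "pass_left (smaller z ?W)" and ys = "[]"])
      (use smaller_le[of z ?W] in auto)
  also have "tangle_isotopic (Suc (length ?W)) \<dots>
      ((smaller x ((z # u) @ v) + count_list (z # u) x, p) # pass_left (smaller z ?W') @ shift 1 (unsort ?W'))"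
  proof (cases "x < z")
    case True
    have le: "?pos \<le> smaller z (u @ v)"
      using smaller_count_mono[OF True, of u] smaller_mono[of x z v] True by simp
    have upper: "across (smaller z (u @ v) + ins p) p = smaller z ?W'"
      using True by (simp add: across_def)
    have W: "smaller z ?W = smaller z (u @ v) + ins p" using True by simp
    have "tangle_isotopic (smaller z ?W + 1) ((?pos, p) # pass_left (smaller z ?W'))
        (pass_left (smaller z ?W) @ [(?pos + 1, p)])"
      using pass_left_single[of ?pos p "smaller z ?W"] le unfolding W upper by simp
    then show ?thesis
      by (rule tangle_replace_sym[where xs = "[]" and ys = "shift 1 (unsort ?W')"])
        (use le True smaller_le[of z ?W] smaller_le[of z ?W'] smaller_le[of z v] smaller_le[of z u] pos in auto)
  next
    case False
    then have j: "smaller z ?W = smaller z (u @ v)" "smaller z ?W' = smaller z (u @ v)" by auto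
    have le: "smaller z (u @ v) \<le> ?pos"
      using smaller_mono[of z x "u @ v"] False by simp
    have e: "smaller x ((z # u) @ v) + count_list (z # u) x = ?pos + 1"
      using False by auto
    have "tangle_isotopic (Suc (smaller z (u @ v)) + (length u + length v + ins p - smaller z (u @ v)))
        (pass_left (smaller z (u @ v)) @ [(?pos + 1, p)]) ([(?pos + 1, p)] @ pass_left (smaller z (u @ v)))"
      using interchange[of "Suc (smaller z (u @ v))" "pass_left (smaller z (u @ v))" 
          "length u + length v + ins p - smaller z (u @ v)" "[(?pos - smaller z (u @ v), p)]"] le pos
      by simp
    then show ?thesis unfolding e j
      by (rule tangle_replace[where xs = "[]" and ys = "shift 1 (unsort ?W')"])
        (use le pos False smaller_le[of z "u @ v"] in auto)
  qed
  finally show ?case by simp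
qed

text \<open>The new crossing extends the journey of the strand \<open>y\<close> by one strand. As
  this strand lies above \<open>x\<close>, it may also make its journey before \<open>x\<close>
  does, and this is the order in the braid on the right.\<close>

lemma unsort_swap:
  assumes "x < y"
  shows "tangle_isotopic (length (u @ [x, y] @ v))
     (unsort (u @ [x, y] @ v) @ [(length u, Cross Pos)]) (unsort (u @ [y, x] @ v))"
proof (induction u)
  case Nil
  let ?i = "smaller x v" and ?j = "smaller y v"
  have le: "?i \<le> ?j" "?j \<le> length v"
    using smaller_mono[of x y v] smaller_le[of y v] assms by auto
  have "tangle_isotopic (length v + 2)
      ((pass_left ?i @ shift 1 (pass_left ?j)) @ (shift 2 (unsort v) @ [(0, Cross Pos)]))
      ((pass_left ?i @ shift 1 (pass_left ?j)) @ ([(0, Cross Pos)] @ shift 2 (unsort v)))"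
    by (rule tangle_replace_sym[OF interchange[of 2 "[(0, Cross Pos)]" "length v" "unsort v"],
          where xs = "pass_left ?i @ shift 1 (pass_left ?j)" and ys = "[]"])
      (use le in auto)
  also have "\<dots> = (pass_left ?i @ pass_left (Suc ?j)) @ shift 2 (unsort v)"
    by (simp only: pass_left_Suc append_assoc)
  also have "tangle_isotopic (length v + 2) \<dots> ((pass_left (Suc ?j) @ shift 1 (pass_left ?i)) @ shift 2 (unsort v))"
    by (rule tangle_replace[OF pass_left_natural[of "Suc ?j" "pass_left ?i"], where xs = "[]" and ys = "shift 2 (unsort v)"])
      (use le in auto)
  finally show ?case using assms by (simp add: numeral_eq_Suc)
next
  case (Cons z u)
  have e: "smaller z (u @ [y, x] @ v) = smaller z (u @ [x, y] @ v)" by simp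
  have "tangle_isotopic (Suc (length (u @ [x, y] @ v)))
      (pass_left (smaller z (u @ [x, y] @ v)) @ shift 1 (unsort (u @ [x, y] @ v) @ [(length u, Cross Pos)]))
      (pass_left (smaller z (u @ [x, y] @ v)) @ shift 1 (unsort (u @ [y, x] @ v)))"
    by (rule tangle_replace[OF tangle_isotopic_shift[OF Cons, of 1], where ys = "[]" and
          xs = "pass_left (smaller z (u @ [x, y] @ v))"])
      (use smaller_le[of z "u @ [x, y] @ v"] in auto)
  then show ?case
    by (simp only: e append_Cons[of z u] unsort.simps list.size shift_simps append_assoc Suc_eq_plus1 add_0)
qed

lemma unsort_cross:
  assumes "x \<noteq> y"
  shows "tangle_isotopic (length (u @ [x, y] @ v))
     (unsort (u @ [x, y] @ v) @ [(length u, Cross (if x < y then Pos else Neg))]) (unsort (u @ [y, x] @ v))"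
proof (cases "x < y")
  case True
  then show ?thesis using unsort_swap by auto
next
  case False
  then have "y < x" using assms by simp
  have "tangle_isotopic (length (u @ [x, y] @ v)) (unsort (u @ [x, y] @ v) @ [(length u, Cross Neg)])
    (unsort (u @ [y, x] @ v) @ [(length u, Cross Pos), (length u, Cross Neg)])"
    by (rule tangle_replace_sym[OF unsort_swap[OF \<open>y < x\<close>, of u v], where xs = "[]" and ys = "[(length u, Cross Neg)]"]) auto
  also have "tangle_isotopic (length (u @ [x, y] @ v)) \<dots> (unsort (u @ [y, x] @ v))"
    by (rule tangle_replace_move[OF tangle_moves(6)[of "length u" Pos], where xs = "unsort (u @ [y, x] @ v)" and ys = "[]"]) auto
  finally show ?thesis using False by simp
qed

text \<open>The curl is put on the right leg of the extremum and turned to its other side.\<close>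

lemma cup_cross: "tangle_isotopic 0 [(0, Cup)] [(0, Cup), (0, Cross c)]"
proof -
  have "tangle_isotopic 0 [(0, Cup)] [(0, Cup), (2, Cup), (1, Cross (flip c)), (2, Cap)]"
    by (rule tangle_isotopic.sym, rule tangle_replace_move[OF tangle_moves(8)[of 1 "flip c"], where xs = "[(0, Cup)]" and ys = "[]"]) auto
  also have "tangle_isotopic 0 \<dots> [(0, Cup), (2, Cup), (2, Cross c), (1, Cap)]"
    by (rule tangle_isotopic.sym, rule tangle_replace_move[OF tangle_moves(4)[of 1 c], where xs = "[(0, Cup), (2, Cup)]" and ys = "[]"]) auto
  also have "tangle_isotopic 0 \<dots> [(0, Cup), (0, Cup), (2, Cross c), (1, Cap)]"
    by (rule tangle_replace_move[OF tangle_moves(1)[of 0 Cup 0 Cup], where xs = "[]" and ys = "[(2, Cross c), (1, Cap)]"]) auto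
  also have "tangle_isotopic 0 \<dots> [(0, Cup), (0, Cross c), (0, Cup), (1, Cap)]"
    by (rule tangle_replace_move[OF tangle_moves(1)[of 0 Cup 0 "Cross c"], where xs = "[(0, Cup)]" and ys = "[(1, Cap)]"]) auto
  also have "tangle_isotopic 0 \<dots> [(0, Cup), (0, Cross c)]"
    by (rule tangle_replace_move[OF tangle_moves(3)[of 0], where xs = "[(0, Cup), (0, Cross c)]" and ys = "[]"]) auto
  finally show ?thesis .
qed

text \<open>\<open>cup_cross\<close> upside down. Together they let an extremum absorb a crossing
  when its two ends come in the wrong order.\<close>

lemma cross_cap: "tangle_isotopic 2 [(0, Cap)] [(0, Cross c), (0, Cap)]"
proof -
  have "tangle_isotopic 2 [(0, Cap)] [(2, Cup), (1, Cross (flip c)), (2, Cap), (0, Cap)]"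
    by (rule tangle_isotopic.sym, rule tangle_replace_move[OF tangle_moves(8)[of 1 "flip c"], where xs = "[]" and ys = "[(0, Cap)]"]) auto
  also have "tangle_isotopic 2 \<dots> [(1, Cup), (2, Cross c), (2, Cap), (0, Cap)]"
    by (rule tangle_isotopic.sym, rule tangle_replace_move[OF tangle_moves(5)[of 1 c], where xs = "[]" and ys = "[(2, Cap), (0, Cap)]"]) auto
  also have "tangle_isotopic 2 \<dots> [(1, Cup), (2, Cross c), (0, Cap), (0, Cap)]"
    by (rule tangle_isotopic.sym, rule tangle_replace_move[OF tangle_moves(1)[of 0 Cap 0 Cap], where xs = "[(1, Cup), (2, Cross c)]" and ys = "[]"]) auto
  also have "tangle_isotopic 2 \<dots> [(1, Cup), (0, Cap), (0, Cross c), (0, Cap)]"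
    by (rule tangle_isotopic.sym, rule tangle_replace_move[OF tangle_moves(1)[of 0 Cap 0 "Cross c"], where xs = "[(1, Cup)]" and ys = "[(0, Cap)]"]) auto
  also have "tangle_isotopic 2 \<dots> [(0, Cross c), (0, Cap)]"
    by (rule tangle_replace_move[OF tangle_moves(2)[of 0], where xs = "[]" and ys = "[(0, Cross c), (0, Cap)]"]) auto
  finally show ?thesis .
qed

section \<open>Colourings and components\<close>

text \<open>Crossings of two colours are kept apart from slices in one colour because the splitting
  treats them differently: the former are absorbed by the sorting braid, the latter stay with their
  component.\<close>

inductive colour_step :: "nat \<times> piece \<Rightarrow> 'a list \<Rightarrow> 'a list \<Rightarrow> bool" where
  same: "colour_step (length u, p) (u @ replicate (ins p) x @ v) (u @ replicate (outs p) x @ v)"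
| cross: "x \<noteq> y \<Longrightarrow> colour_step (length u, Cross c) (u @ [x, y] @ v) (u @ [y, x] @ v)"

text \<open>\<open>colouring w D w' U\<close>: the arcs of the tangle \<open>D\<close> are coloured with colours from \<open>U\<close>, all of which
  are used, so that the bottom and top ends spell \<open>w\<close> and \<open>w'\<close>.\<close>

inductive colouring :: "'a list \<Rightarrow> diagram \<Rightarrow> 'a list \<Rightarrow> 'a set \<Rightarrow> bool" where
  Nil: "colouring w [] w (set w)"
| Cons: "colour_step s w w' \<Longrightarrow> colouring w' D w'' U \<Longrightarrow> colouring w (s # D) w'' (set w \<union> U)"

lemma colour_step_cross: "colour_step (length u, Cross c) (u @ [x, y] @ v) (u @ [y, x] @ v)"
proof (cases "x = y")
  case True
  then show ?thesis using colour_step.same[of u "Cross c" x v] by (simp add: numeral_eq_Suc)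
next
  case False
  then show ?thesis by (rule colour_step.cross)
qed

lemma colour_step_cup: "colour_step (length u, Cup) (u @ v) (u @ [x, x] @ v)"
  using colour_step.same[of u Cup x v] by (simp add: numeral_eq_Suc)

lemma colour_step_cap: "colour_step (length u, Cap) (u @ [x, x] @ v) (u @ v)"
  using colour_step.same[of u Cap x v] by (simp add: numeral_eq_Suc)

text \<open>A common form of both rules: at a crossing the top ends are the reversed bottom ends,
  whether or not the two colours agree.\<close>

lemma colour_step_split:
  assumes "colour_step (k, p) w w'"
  obtains u a b v where "w = u @ a @ v" "w' = u @ b @ v" "length u = k" "length a = ins p"
    "length b = outs p" "(\<exists>c. p = Cross c) \<or> (\<exists>x. a = replicate (ins p) x \<and> b = replicate (outs p) x)"
    "\<And>c. p = Cross c \<Longrightarrow> b = rev a"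
  using assms
proof cases
  case (same u x v)
  then show ?thesis by (intro that[of u "replicate (ins p) x" v "replicate (outs p) x"]) auto
next
  case (cross x y u c v)
  then show ?thesis by (intro that[of u "[x, y]" v "[y, x]"]) auto
qed

lemma colour_step_length:
  assumes "colour_step (k, p) w w'"
  shows "k + ins p \<le> length w" "length w' = across (length w) p"
  using assms by (auto elim!: colour_step_split simp: across_def)

lemma colouring_tangle:
  "colouring w D w' U \<Longrightarrow> tangle (length w) D \<and> upper (length w) D = length w'"
proof (induction rule: colouring.induct)
  case (Cons s w w' D w'' U)
  moreover obtain k p where "s = (k, p)" by fastforce
  ultimately show ?case using colour_step_length[of k p w w'] by simp
qed auto

lemma colouring_finite: "colouring w D w' U \<Longrightarrow> finite U \<and> set w \<subseteq> U \<and> set w' \<subseteq> U"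
  by (induction rule: colouring.induct) auto

lemma colouring_append:
  "colouring w a w' U \<Longrightarrow> colouring w' b w'' V \<Longrightarrow> colouring w (a @ b) w'' (U \<union> V)"
proof (induction rule: colouring.induct)
  case (Nil w)
  then have "set w \<union> V = V" using colouring_finite by blast
  then show ?case using Nil by simp
next
  case (Cons s w w1 D w2 U)
  then show ?case using colouring.Cons[OF Cons(1) Cons(3)[OF Cons(4)]] by (simp add: Un_assoc)
qed

lemma colouring_appendE:
  assumes "colouring w (a @ b) w'' U"
  obtains w' U1 U2 where "colouring w a w' U1" "colouring w' b w'' U2" "U = U1 \<union> U2"
  using assms
proof (induction a arbitrary: w U thesis)
  case Nil
  then show ?case
    using Nil(1)[of w "set w" U] colouring_finite[of w b w'' U] by (auto intro: colouring.Nil)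
next
  case (Cons s a)
  from Cons(3) obtain w1 U0 where 1: "colour_step s w w1" "colouring w1 (a @ b) w'' U0" "U = set w \<union> U0"
    by (auto elim: colouring.cases)
  from Cons(1)[OF _ 1(2)] obtain w' U1 U2 where
    "colouring w1 a w' U1" "colouring w' b w'' U2" "U0 = U1 \<union> U2" by metis
  with 1 show ?case
    by (intro Cons(2)[of w' "set w \<union> U1" U2]) (auto intro: colouring.Cons)
qed

lemma colouring_ConsE:
  assumes "colouring w (s # D) w'' U"
  obtains w' V where "colour_step s w w'" "colouring w' D w'' V" "U = set w \<union> V"
  using assms by (auto elim: colouring.cases)

lemma colour_step_map: "colour_step s w w' \<Longrightarrow> colour_step s (map f w) (map f w')"
proof (induction rule: colour_step.induct)
  case (same u p x v)
  then show ?case using colour_step.same[of "map f u" p "f x" "map f v"] by simp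
next
  case (cross x y u c v)
  then show ?case using colour_step_cross[of "map f u" c "f x" "f y" "map f v"] by simp
qed

lemma colouring_map: "colouring w D w' U \<Longrightarrow> colouring (map f w) D (map f w') (f ` U)"
proof (induction rule: colouring.induct)
  case (Nil w)
  then show ?case using colouring.Nil[of "map f w"] by simp
next
  case (Cons s w w' D w'' U)
  then show ?case using colouring.Cons[OF colour_step_map[of s w w' f], of D "map f w''" "f ` U"]
    by (simp add: image_Un)
qed

lemma colour_step_zip:
  assumes "colour_step s w w'" "colour_step s v v'" "length v = length w"
  shows "colour_step s (zip w v) (zip w' v')"
proof (cases s)
  case (Pair k p)
  from assms(1)[unfolded Pair] obtain u a b r where 1: "w = u @ a @ r" "w' = u @ b @ r"
    "length u = k" "length a = ins p" "length b = outs p"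
    "(\<exists>c. p = Cross c) \<or> (\<exists>x. a = replicate (ins p) x \<and> b = replicate (outs p) x)"
    "\<And>c. p = Cross c \<Longrightarrow> b = rev a" by (rule colour_step_split) blast
  from assms(2)[unfolded Pair] obtain u' a' b' r' where 2: "v = u' @ a' @ r'" "v' = u' @ b' @ r'"
    "length u' = k" "length a' = ins p" "length b' = outs p"
    "(\<exists>c. p = Cross c) \<or> (\<exists>x. a' = replicate (ins p) x \<and> b' = replicate (outs p) x)"
    "\<And>c. p = Cross c \<Longrightarrow> b' = rev a'" by (rule colour_step_split) blast
  have l: "length u = length u'" "length a = length a'" "length r = length r'" "length b = length b'"
    using 1 2 assms(3) by auto
  show ?thesis
  proof (cases "\<exists>c. p = Cross c")
    case True
    then obtain c where c: "p = Cross c" by blast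
    obtain x y x' y' where "a = [x, y]" "a' = [x', y']"
      using 1(4) 2(4) c by (auto simp: numeral_eq_Suc length_Suc_conv)
    then show ?thesis
      using colour_step_cross[of "zip u u'" c "(x, x')" "(y, y')" "zip r r'"] 1 2 c l Pair by simp
  next
    case False
    then obtain x x' where "a = replicate (ins p) x" "b = replicate (outs p) x"
      "a' = replicate (ins p) x'" "b' = replicate (outs p) x'"
      using 1(6) 2(6) by blast
    then show ?thesis
      using colour_step.same[of "zip u u'" p "(x, x')" "zip r r'"] 1 2 l Pair by simp
  qed
qed

text \<open>Pairs of colours may be more numerous than the colours of either factor; this is the
  source of the finer colouring in \<open>refine_colouring\<close>.\<close>

lemma colouring_zip:
  assumes "colouring w D w' U" "colouring v D v' V" "length v = length w"
  obtains Z where "colouring (zip w v) D (zip w' v') Z" "fst ` Z = U" "snd ` Z = V"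
  using assms
proof (induction arbitrary: v V thesis rule: colouring.induct)
  case (Nil w)
  then have "v' = v" "V = set v" by (auto elim: colouring.cases)
  moreover have "fst ` set (zip w v) = set w" "snd ` set (zip w v) = set v"
    using Nil(3) by (auto simp flip: set_map)
  ultimately show ?case using Nil(1) colouring.Nil[of "zip w v"] by blast
next
  case (Cons s w w1 D w' U)
  from Cons(5) obtain v1 V1 where v: "colour_step s v v1" "colouring v1 D v' V1" "V = set v \<union> V1"
    by (rule colouring_ConsE)
  have "length v1 = length w1"
    using colour_step_length(2)[of "fst s" "snd s" v v1] colour_step_length(2)[of "fst s" "snd s" w w1]
      v(1) Cons(1,6) by simp
  from Cons(3)[OF _ v(2) this] obtain Z where
    "colouring (zip w1 v1) D (zip w' v') Z" "fst ` Z = U" "snd ` Z = V1" by metis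
  moreover have "fst ` set (zip w v) = set w" "snd ` set (zip w v) = set v"
    using Cons(6) by (auto simp flip: set_map)
  ultimately show ?case using Cons(1,6) v
    by (intro Cons(4)[of "set (zip w v) \<union> Z"]) (auto intro!: colouring.Cons colour_step_zip simp: image_Un)
qed

text \<open>An extremum adds or removes two ends of one colour, and a crossing permutes the
  ends.\<close>

lemma colour_step_parity: "colour_step s w w' \<Longrightarrow> even (count_list w x) = even (count_list w' x)"
proof (induction rule: colour_step.induct)
  case (same u p y v)
  have "replicate 2 y = [y, y]" by (simp add: numeral_eq_Suc)
  then show ?case by (cases p) auto
qed auto

lemma colouring_parity: "colouring w D w' U \<Longrightarrow> even (count_list w x) = even (count_list w' x)"
  by (induction rule: colouring.induct) (auto simp: colour_step_parity)

section \<open>Colourings by height and the number of components\<close>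

text \<open>Indexing by height makes colours comparable with \<open>points\<close> and
  \<open>same_component\<close>.\<close>

definition level_colouring :: "diagram \<Rightarrow> (nat \<Rightarrow> 'a list) \<Rightarrow> bool" where
  "level_colouring D W \<longleftrightarrow> (\<forall>h < length D. colour_step (D ! h) (W h) (W (Suc h)))"

lemma level_colouring_imp_colouring:
  "level_colouring D W \<Longrightarrow> colouring (W 0) D (W (length D)) (\<Union>h \<in> {..length D}. set (W h))"
proof (induction D arbitrary: W)
  case Nil
  then show ?case using colouring.Nil[of "W 0"] by simp
next
  case (Cons s D)
  have "level_colouring D (W \<circ> Suc)" using Cons(2) by (auto simp: level_colouring_def)
  from Cons(1)[OF this]
  have "colouring (W (Suc 0)) D (W (length (s # D))) (\<Union>h \<in> {..length D}. set (W (Suc h)))" by simp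
  moreover have "colour_step s (W 0) (W (Suc 0))" using Cons(2) by (auto simp: level_colouring_def)
  moreover have "(\<Union>h \<in> {..length (s # D)}. set (W h)) = set (W 0) \<union> (\<Union>h \<in> {..length D}. set (W (Suc h)))"
    by (simp add: atMost_Suc_eq_insert_0)
  ultimately show ?case by (auto intro: colouring.Cons)
qed

lemma colouring_imp_level_colouring:
  assumes "colouring w D w' U"
  obtains W where "level_colouring D W" "W 0 = w" "W (length D) = w'" "U = (\<Union>h \<in> {..length D}. set (W h))"
  using assms
proof (induction arbitrary: thesis rule: colouring.induct)
  case (Nil w)
  then show ?case by (intro Nil[of "\<lambda>_. w"]) (auto simp: level_colouring_def)
next
  case (Cons s w w1 D w' U)
  from Cons(3) obtain W where W: "level_colouring D W" "W 0 = w1" "W (length D) = w'"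
    "U = (\<Union>h \<in> {..length D}. set (W h))" by metis
  let ?W = "\<lambda>h. case h of 0 \<Rightarrow> w | Suc h \<Rightarrow> W h"
  show ?case
  proof (rule Cons(4)[of ?W])
    show "level_colouring (s # D) ?W"
      using W(1,2) Cons(1) by (auto simp: level_colouring_def nth_Cons split: nat.split)
    show "set w \<union> U = (\<Union>h \<in> {..length (s # D)}. set (?W h))"
      unfolding W(4) by (simp add: atMost_Suc_eq_insert_0)
  qed (use W in auto)
qed

lemma strands_Suc: "h < length D \<Longrightarrow> D ! h = (k, p) \<Longrightarrow> strands D (Suc h) = across (strands D h) p"
  by (simp add: strands_eq_upper take_Suc_conv_app_nth)

lemma level_colouring_length:
  assumes "level_colouring D W" "W 0 = []" "h \<le> length D"
  shows "length (W h) = strands D h"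
  using assms(3)
proof (induction h)
  case 0
  then show ?case using assms(2) by (simp add: strands_def)
next
  case (Suc h)
  obtain k p where s: "D ! h = (k, p)" by fastforce
  have "colour_step (k, p) (W h) (W (Suc h))"
    using assms(1) Suc(2) s unfolding level_colouring_def by (metis Suc_le_lessD)
  from colour_step_length(2)[OF this] show ?case
    using Suc s strands_Suc[of h D k p] by simp
qed

lemma adjacent_colour:
  assumes "level_colouring D W" "W 0 = []" "adjacent D a b"
  shows "a \<in> points D \<and> b \<in> points D \<and> W (fst a) ! snd a = W (fst b) ! snd b"
  using assms(3)
proof cases
  case (left h k p i)
  then have s: "colour_step (k, p) (W h) (W (Suc h))" using assms(1) by (auto simp: level_colouring_def)
  from s show ?thesis
    by (rule colour_step_split)
      (use left level_colouring_length[OF assms(1,2), of h] level_colouring_length[OF assms(1,2), of "Suc h"]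
       in \<open>auto simp: points_def nth_append\<close>)
next
  case (right h k p j)
  then have s: "colour_step (k, p) (W h) (W (Suc h))" using assms(1) by (auto simp: level_colouring_def)
  from s show ?thesis
    by (rule colour_step_split)
      (use right level_colouring_length[OF assms(1,2), of h] level_colouring_length[OF assms(1,2), of "Suc h"]
       in \<open>auto simp: points_def nth_append\<close>)
next
  case (cup h k)
  then have s: "colour_step (k, Cup) (W h) (W (Suc h))" using assms(1) by (auto simp: level_colouring_def)
  from s show ?thesis
    by (rule colour_step_split)
      (use cup level_colouring_length[OF assms(1,2), of "Suc h"] in \<open>auto simp: points_def nth_append nth_Cons'\<close>)
next
  case (cap h k)
  then have s: "colour_step (k, Cap) (W h) (W (Suc h))" using assms(1) by (auto simp: level_colouring_def)
  from s show ?thesis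
    by (rule colour_step_split)
      (use cap level_colouring_length[OF assms(1,2), of h] in \<open>auto simp: points_def nth_append nth_Cons'\<close>)
next
  case (cross_up_right h k c)
  then have s: "colour_step (k, Cross c) (W h) (W (Suc h))" using assms(1) by (auto simp: level_colouring_def)
  from s show ?thesis
    by (rule colour_step_split)
      (use cross_up_right level_colouring_length[OF assms(1,2), of h] level_colouring_length[OF assms(1,2), of "Suc h"]
       in \<open>auto simp: points_def nth_append rev_nth\<close>)
next
  case (cross_up_left h k c)
  then have s: "colour_step (k, Cross c) (W h) (W (Suc h))" using assms(1) by (auto simp: level_colouring_def)
  from s show ?thesis
    by (rule colour_step_split)
      (use cross_up_left level_colouring_length[OF assms(1,2), of h] level_colouring_length[OF assms(1,2), of "Suc h"]
       in \<open>auto simp: points_def nth_append rev_nth\<close>)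
qed

lemma finite_points: "finite (points D)"
proof -
  have "points D = Sigma {..length D} (\<lambda>h. {..<strands D h})" by (auto simp: points_def)
  then show ?thesis by simp
qed

definition component_rel :: "diagram \<Rightarrow> ((nat \<times> nat) \<times> (nat \<times> nat)) set" where
  "component_rel D = {(x, y). x \<in> points D \<and> y \<in> points D \<and> same_component D x y}"

lemma component_rel: "components D = points D // component_rel D" "equiv (points D) (component_rel D)"
proof -
  have "refl_on (points D) (component_rel D)"
    by (rule refl_onI) (auto simp: component_rel_def same_component_def)
  moreover have "sym (component_rel D)"
    by (rule symI) (auto simp: component_rel_def same_component_def elim: equivclp_sym)
  moreover have "trans (component_rel D)"
    by (rule transI) (auto simp: component_rel_def same_component_def elim: equivclp_trans)
  moreover have "component_rel D \<subseteq> points D \<times> points D" by (auto simp: component_rel_def)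
  ultimately show "equiv (points D) (component_rel D)" by (simp add: equiv_def)
qed (simp add: components_def component_rel_def)

lemma finite_components: "finite (components D)"
  unfolding component_rel(1) using component_rel(2) finite_points
  by (intro finite_quotient) (auto simp: component_rel_def)

lemma same_component_colour:
  assumes "level_colouring D W" "W 0 = []" "same_component D a b"
  shows "W (fst a) ! snd a = W (fst b) ! snd b"
  using assms(3) unfolding same_component_def
  by (induction rule: equivclp_induct) (use adjacent_colour[OF assms(1,2)] in force)+

text \<open>A colouring is constant on components, so reading the colour at a representative maps
  the components onto the colours.\<close>

lemma card_colouring_le:
  assumes "colouring [] D [] U"
  shows "card U \<le> num_components D"
proof -
  obtain W where W: "level_colouring D W" "W 0 = []" "U = (\<Union>h \<in> {..length D}. set (W h))"
    by (rule colouring_imp_level_colouring[OF assms]) blast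
  let ?g = "\<lambda>a. W (fst a) ! snd a"
  have "U \<subseteq> (\<lambda>C. ?g (SOME a. a \<in> C)) ` components D"
  proof
    fix x assume "x \<in> U"
    then obtain h i where hi: "h \<le> length D" "i < length (W h)" "x = W h ! i"
      unfolding W(3) by (auto simp: in_set_conv_nth)
    then have p: "(h, i) \<in> points D"
      using level_colouring_length[OF W(1,2)] by (auto simp: points_def)
    let ?C = "component_rel D `` {(h, i)}"
    have "(h, i) \<in> ?C" using equiv_class_self[OF component_rel(2) p] .
    then have "(SOME a. a \<in> ?C) \<in> ?C" by (rule someI)
    moreover have "a \<in> ?C \<Longrightarrow> same_component D (h, i) a" for a by (simp add: component_rel_def)
    ultimately have "same_component D (h, i) (SOME a. a \<in> ?C)" by blast
    then have "?g (h, i) = ?g (SOME a. a \<in> ?C)" by (rule same_component_colour[OF W(1,2)])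
    then have "x = ?g (SOME a. a \<in> ?C)" using hi by simp
    moreover have "?C \<in> components D" unfolding component_rel(1) using p by (rule quotientI)
    ultimately show "x \<in> (\<lambda>C. ?g (SOME a. a \<in> C)) ` components D" by blast
  qed
  then show ?thesis unfolding num_components_def
    using finite_components surj_card_le by blast
qed

text \<open>Colouring by components attains the bound of \<open>card_colouring_le\<close>. The
  colours are numbers so that they can serve as layers, and they detect whether a crossing is
  mixed.\<close>

lemma component_colouring:
  assumes "link_diagram D"
  obtains W :: "nat \<Rightarrow> nat list" where "level_colouring D W" "W 0 = []" "W (length D) = []"
    "(\<Union>h \<in> {..length D}. set (W h)) = {..<num_components D}"
    "\<And>h i j. (h, i) \<in> points D \<Longrightarrow> (h, j) \<in> points D \<Longrightarrow>
      W h ! i = W h ! j \<longleftrightarrow> same_component D (h, i) (h, j)"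
proof -
  obtain f where f: "bij_betw f (components D) {..<num_components D}"
    using ex_bij_betw_finite_nat[OF finite_components[of D]]
    unfolding num_components_def by (auto simp: atLeast0LessThan)
  let ?g = "\<lambda>a. f (component_rel D `` {a})"
  define W where "W h = map (\<lambda>i. ?g (h, i)) [0..<strands D h]" for h
  have eq: "?g a = ?g b \<longleftrightarrow> same_component D a b" if "a \<in> points D" "b \<in> points D" for a b
  proof -
    have "component_rel D `` {a} \<in> components D" "component_rel D `` {b} \<in> components D"
      unfolding component_rel(1) using that by (auto intro: quotientI)
    then have "?g a = ?g b \<longleftrightarrow> component_rel D `` {a} = component_rel D `` {b}"
      using f by (auto simp: bij_betw_def inj_on_def)
    also have "\<dots> \<longleftrightarrow> (a, b) \<in> component_rel D"
      using eq_equiv_class_iff[OF component_rel(2) that] .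
    finally show ?thesis using that by (simp add: component_rel_def)
  qed
  have adj: "?g a = ?g b" if "adjacent D a b" "a \<in> points D" "b \<in> points D" for a b
    unfolding eq[OF that(2,3)] same_component_def using that(1) by (rule r_into_equivclp)
  have split: "map F [0..<k + c + d] = map F [0..<k] @ map (\<lambda>i. F (k + i)) [0..<c] @ map (\<lambda>i. F (k + c + i)) [0..<d]"
    for F :: "nat \<Rightarrow> nat" and k c d
    by (rule nth_equalityI) (auto simp: nth_append)
  have "colour_step (D ! h) (W h) (W (Suc h))" if h: "h < length D" for h
  proof -
    obtain k p where s: "D ! h = (k, p)" by fastforce
    have "k + ins p \<le> strands D h" using assms h s by (auto simp: link_diagram_def)
    then obtain d where m: "strands D h = k + ins p + d" using le_Suc_ex by blast
    then have m': "strands D (Suc h) = k + outs p + d"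
      using strands_Suc[OF h s] by (simp add: across_def)
    have pts: "(h, i) \<in> points D \<longleftrightarrow> i < k + ins p + d"
      "(Suc h, i) \<in> points D \<longleftrightarrow> i < k + outs p + d" for i
      using h m m' by (auto simp: points_def)
    let ?u = "map (\<lambda>i. ?g (h, i)) [0..<k]" and ?v = "map (\<lambda>i. ?g (h, k + ins p + i)) [0..<d]"
    have W1: "W h = ?u @ map (\<lambda>i. ?g (h, k + i)) [0..<ins p] @ ?v"
      unfolding W_def m split by (rule HOL.refl)
    have e1: "map (\<lambda>i. ?g (Suc h, i)) [0..<k] = ?u"
      by (intro map_cong HOL.refl adj[symmetric, OF adjacent.left[OF h s]]) (auto simp: pts)
    have e2: "map (\<lambda>i. ?g (Suc h, k + outs p + i)) [0..<d] = ?v"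
      by (intro map_cong HOL.refl adj[symmetric, OF adjacent.right[OF h s]]) (auto simp: pts m)
    have W2: "W (Suc h) = ?u @ map (\<lambda>i. ?g (Suc h, k + i)) [0..<outs p] @ ?v"
      unfolding W_def m' split e1 e2 by (rule HOL.refl)
    show ?thesis
    proof (cases p)
      case Cup
      have "?g (Suc h, k) = ?g (Suc h, k + 1)"
        by (intro adj adjacent.cup[OF h]) (use Cup s pts in auto)
      then have "W h = ?u @ ?v" "W (Suc h) = ?u @ [?g (Suc h, k), ?g (Suc h, k)] @ ?v"
        unfolding W1 W2 Cup by (simp_all add: numeral_eq_Suc)
      then show ?thesis
        using colour_step_cup[of ?u ?v "?g (Suc h, k)"] unfolding s Cup by simp
    next
      case Cap
      have "?g (h, k) = ?g (h, k + 1)"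
        by (intro adj adjacent.cap[OF h]) (use Cap s pts in auto)
      then have "W (Suc h) = ?u @ ?v" "W h = ?u @ [?g (h, k), ?g (h, k)] @ ?v"
        unfolding W1 W2 Cap by (simp_all add: numeral_eq_Suc)
      then show ?thesis
        using colour_step_cap[of ?u "?g (h, k)" ?v] unfolding s Cap by simp
    next
      case (Cross c)
      have "?g (h, k) = ?g (Suc h, k + 1)"
        by (intro adj adjacent.cross_up_right[OF h, of k c]) (use Cross s pts in auto)
      moreover have "?g (h, k + 1) = ?g (Suc h, k)"
        by (intro adj adjacent.cross_up_left[OF h, of k c]) (use Cross s pts in auto)
      ultimately have "W h = ?u @ [?g (h, k), ?g (h, k + 1)] @ ?v"
        "W (Suc h) = ?u @ [?g (h, k + 1), ?g (h, k)] @ ?v"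
        unfolding W1 W2 Cross by (simp_all add: numeral_eq_Suc)
      then show ?thesis
        using colour_step_cross[of ?u c "?g (h, k)" "?g (h, k + 1)" ?v] unfolding s Cross by simp
    qed
  qed
  then have "level_colouring D W" by (simp add: level_colouring_def)
  moreover have "W 0 = []" "W (length D) = []"
    using assms by (auto simp: W_def strands_def link_diagram_def)
  moreover have "(\<Union>h \<in> {..length D}. set (W h)) = {..<num_components D}"
  proof -
    have "(\<Union>h \<in> {..length D}. set (W h)) = ?g ` points D"
      by (force simp: W_def points_def)
    also have "\<dots> = f ` components D"
      unfolding component_rel(1) quotient_def by auto
    finally show ?thesis using f by (simp add: bij_betw_def)
  qed
  moreover have "W h ! i = W h ! j \<longleftrightarrow> same_component D (h, i) (h, j)"
    if "(h, i) \<in> points D" "(h, j) \<in> points D" for h i j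
    using eq[OF that] that by (simp add: W_def points_def)
  ultimately show thesis by (rule that)
qed

lemma link_diagram_num_components:
  assumes "link_diagram D"
  shows "num_components D \<ge> 1"
proof -
  obtain W :: "nat \<Rightarrow> nat list" where W: "level_colouring D W" "W 0 = []"
    "(\<Union>h \<in> {..length D}. set (W h)) = {..<num_components D}"
    by (rule component_colouring[OF assms]) blast
  obtain k p D' where D: "D = (k, p) # D'" using assms by (cases D) (auto simp: link_diagram_def)
  then have p: "p = Cup" using assms by (cases p) (auto simp: link_diagram_iff_tangle)
  have "colour_step (k, p) (W 0) (W 1)" using W(1) D by (auto simp: level_colouring_def)
  then have "length (W 1) = 2" using colour_step_length(2)[of k p "W 0" "W 1"] W(2) p by simp
  then have "set (W 1) \<noteq> {}" by auto
  moreover have "set (W 1) \<subseteq> {..<num_components D}" using W(3) D by auto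
  ultimately show ?thesis by (cases "num_components D = 0") auto
qed

section \<open>Diagrams up to crossing changes\<close>

text \<open>The type \<open>Pos\<close> is an arbitrary representative: diagrams with equal shadows
  differ just by crossing changes, which do not affect the components.\<close>

fun shadow_piece :: "piece \<Rightarrow> piece" where
  "shadow_piece (Cross c) = Cross Pos"
| "shadow_piece p = p"

definition shadow :: "diagram \<Rightarrow> diagram" where
  "shadow = map (\<lambda>(k, p). (k, shadow_piece p))"

lemma shadow_simps [simp]:
  "shadow [] = []"
  "shadow ((k, p) # D) = (k, shadow_piece p) # shadow D"
  "shadow (a @ b) = shadow a @ shadow b"
  by (auto simp: shadow_def)

lemma ins_shadow [simp]: "ins (shadow_piece p) = ins p" "outs (shadow_piece p) = outs p"
  by (cases p; simp)+

lemma shadow_eq_ins: "shadow_piece p = shadow_piece p' \<Longrightarrow> ins p = ins p' \<and> outs p = outs p'"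
  by (metis ins_shadow)

lemma tangle_shadow [simp]: "tangle m (shadow D) = tangle m D" "upper m (shadow D) = upper m D"
  by (induction m D rule: upper.induct) (auto simp: across_def)

lemma shadow_tangle: "shadow D = shadow D' \<Longrightarrow> tangle m D = tangle m D' \<and> upper m D = upper m D'"
  by (metis tangle_shadow)

lemma shadow_Nil [simp]: "shadow D = [] \<longleftrightarrow> D = []" "length (shadow D) = length D"
  by (auto simp: shadow_def)

lemma shadow_length: "shadow D = shadow D' \<Longrightarrow> length D = length D'"
  by (metis shadow_Nil(2))

lemma shadow_link_diagram: "shadow D = shadow D' \<Longrightarrow> link_diagram D = link_diagram D'"
  using shadow_tangle[of D D' 0] shadow_length[of D D'] by (auto simp: link_diagram_iff_tangle)

lemma shadow_take: "shadow (take h D) = take h (shadow D)"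
  by (simp add: shadow_def take_map)

lemma shadow_strands: "shadow D = shadow D' \<Longrightarrow> strands D = strands D'"
  by (rule ext) (metis shadow_take shadow_tangle strands_eq_upper)

lemma shadow_nth:
  assumes "shadow D = shadow D'" "h < length D" "D ! h = (k, p)"
  obtains p' where "D' ! h = (k, p')" "shadow_piece p' = shadow_piece p"
proof -
  obtain k' p' where s: "D' ! h = (k', p')" by fastforce
  have "shadow D ! h = (k, shadow_piece p)" "shadow D' ! h = (k', shadow_piece p')"
    using assms(2,3) s shadow_length[OF assms(1)] by (simp_all add: shadow_def)
  then show thesis using that s assms(1) by simp
qed

lemma shadow_piece_eq [simp]:
  "shadow_piece p = Cup \<longleftrightarrow> p = Cup" "shadow_piece p = Cap \<longleftrightarrow> p = Cap"
  "shadow_piece p = Cross Pos \<longleftrightarrow> (\<exists>c. p = Cross c)"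
  by (cases p; simp)+

lemma shadow_adjacent: 
  assumes "shadow D = shadow D'"
  shows "adjacent D = adjacent D'"
proof -
  have "adjacent D' a b" if "shadow D = shadow D'" "adjacent D a b" for a b D D'
    using that(2)
  proof cases
    case (left h k p i)
    from shadow_nth[OF that(1) left(3,4)] show ?thesis
      using left shadow_length[OF that(1)] by (metis adjacent.left)
  next
    case (right h k p j)
    from shadow_nth[OF that(1) right(3,4)] obtain p' where
      "D' ! h = (k, p')" "shadow_piece p' = shadow_piece p" .
    then show ?thesis
      using right shadow_length[OF that(1)] shadow_eq_ins[of p' p] shadow_strands[OF that(1)]
        adjacent.right[of h D' k p' j] by simp
  next
    case (cup h k)
    from shadow_nth[OF that(1) cup(3,4)] show ?thesis
      using cup shadow_length[OF that(1)] adjacent.cup[of h D' k] by auto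
  next
    case (cap h k)
    from shadow_nth[OF that(1) cap(3,4)] show ?thesis
      using cap shadow_length[OF that(1)] adjacent.cap[of h D' k] by auto
  next
    case (cross_up_right h k c)
    from shadow_nth[OF that(1) cross_up_right(3,4)] show ?thesis
      using cross_up_right shadow_length[OF that(1)] adjacent.cross_up_right[of h D' k] by auto
  next
    case (cross_up_left h k c)
    from shadow_nth[OF that(1) cross_up_left(3,4)] show ?thesis
      using cross_up_left shadow_length[OF that(1)] adjacent.cross_up_left[of h D' k] by auto
  qed
  from this[OF assms] this[OF assms[symmetric]] show ?thesis by blast
qed

lemma shadow_components:
  assumes "shadow D = shadow D'"
  shows "same_component D = same_component D'" "num_components D = num_components D'"
proof -
  show s: "same_component D = same_component D'"
    unfolding same_component_def shadow_adjacent[OF assms] ..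
  have "points D = points D'"
    unfolding points_def shadow_strands[OF assms] shadow_length[OF assms] ..
  then show "num_components D = num_components D'"
    unfolding num_components_def components_def s by simp
qed

lemma shadow_mixed_crossing:
  assumes "shadow D = shadow D'" "mixed_crossing D h"
  shows "mixed_crossing D' h"
proof -
  obtain k c where h: "h < length D" "D ! h = (k, Cross c)" "\<not> same_component D (h, k) (h, k + 1)"
    using assms(2) by (auto simp: mixed_crossing_def)
  obtain p' where "D' ! h = (k, p')" "shadow_piece p' = shadow_piece (Cross c)"
    by (rule shadow_nth[OF assms(1) h(1,2)])
  then show ?thesis
    using h shadow_length[OF assms(1)] shadow_components(1)[OF assms(1)]
    by (auto simp: mixed_crossing_def)
qed

lemma colour_step_shadow:
  assumes "colour_step (k, p) w w'" "shadow_piece p = shadow_piece p'"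
  shows "colour_step (k, p') w w'"
  using assms(1)
proof cases
  case (same u x v)
  then show ?thesis using colour_step.same[of u p' x v] shadow_eq_ins[OF assms(2)] by simp
next
  case (cross x y u c v)
  then obtain c' where "p' = Cross c'" using assms(2) by (cases p') auto
  then show ?thesis using colour_step_cross[of u c' x y v] cross by simp
qed

lemma shadow_level_colouring:
  assumes "shadow D = shadow D'" "level_colouring D W"
  shows "level_colouring D' W"
  unfolding level_colouring_def
proof (intro allI impI)
  fix h assume h: "h < length D'"
  obtain k p where s: "D ! h = (k, p)" by fastforce
  obtain p' where "D' ! h = (k, p')" "shadow_piece p' = shadow_piece p"
    using shadow_nth[OF assms(1) _ s] h shadow_length[OF assms(1)] by metis
  moreover have "colour_step (k, p) (W h) (W (Suc h))"
    using assms(2)[unfolded level_colouring_def, rule_format, of h] h shadow_length[OF assms(1)] s by simp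
  ultimately show "colour_step (D' ! h) (W h) (W (Suc h))"
    using colour_step_shadow[of k p "W h" "W (Suc h)" p'] by simp
qed

text \<open>Both colourings are combined into pairs. As every colour occurs an even number of times
  at every level, the four ends at the crossing must have the same second colour.\<close>

lemma refine_colouring:
  fixes u :: "'a list" and u' :: "'b list"
  assumes "colouring [] xs (u @ [a, b] @ v) U1" "colouring (u @ [b, a] @ v) ys [] U2" "a \<noteq> b"
    "colouring [] xs (u' @ [p, q] @ v') V1" "colouring (u' @ [s, t] @ v') ys [] V2"
    "length u' = length u" "p = s \<and> q = t \<or> p = q \<and> s = t"
  obtains Z :: "('a \<times> 'b) set"
    where "colouring [] (xs @ [(length u, Cross Pos)] @ ys) [] Z" "card (V1 \<union> V2) < card Z"
proof -
  have len: "length v' = length v"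
    using colouring_tangle[OF assms(1)] colouring_tangle[OF assms(4)] assms(6) by simp
  obtain Z1 where Z1: "colouring (zip [] []) xs (zip (u @ [a, b] @ v) (u' @ [p, q] @ v')) Z1"
    "snd ` Z1 = V1"
    by (rule colouring_zip[OF assms(1,4)]) auto
  obtain Z2 where Z2: "colouring (zip (u @ [b, a] @ v) (u' @ [s, t] @ v')) ys (zip [] []) Z2"
    "snd ` Z2 = V2"
    by (rule colouring_zip[OF assms(2,5)]) (use len assms(6) in auto)
  have e1: "zip (u @ [a, b] @ v) (u' @ [p, q] @ v') = zip u u' @ [(a, p), (b, q)] @ zip v v'"
    and e2: "zip (u @ [b, a] @ v) (u' @ [s, t] @ v') = zip u u' @ [(b, s), (a, t)] @ zip v v'"
    using assms(6) by auto
  have "even (count_list (zip u u' @ [(a, p), (b, q)] @ zip v v') (a, p))"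
    "even (count_list (zip u u' @ [(b, s), (a, t)] @ zip v v') (a, p))"
    using colouring_parity[OF Z1(1), of "(a, p)"] colouring_parity[OF Z2(1), of "(a, p)"]
    unfolding e1 e2 by simp_all
  \<comment> \<open>As \<open>a\<close> differs from \<open>b\<close>, the pair
    \<open>(a, p)\<close> occurs exactly once among the two ends below the crossing, hence an odd
    number of times among the remaining ends. Above the crossing only \<open>(a, t)\<close> can
    restore the parity, so \<open>t = p\<close>, and either alternative of the hypothesis gives the
    rest.\<close>
  then have eq: "q = p \<and> s = p \<and> t = p"
    using assms(3,7) by (auto split: if_splits)
  let ?w = "zip u u' @ [(a, p), (b, p)] @ zip v v'"
  have w: "colouring ?w ([(length u, Cross Pos)] @ ys) [] (set ?w \<union> Z2)"
    using colouring.Cons[OF colour_step_cross[of "zip u u'" Pos "(a, p)" "(b, p)" "zip v v'"]] Z2(1)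
    unfolding e2 using eq assms(6) by simp
  have "colouring [] xs ?w Z1" using Z1(1) unfolding e1 using eq by simp
  from colouring_append[OF this w]
  have Z: "colouring [] (xs @ [(length u, Cross Pos)] @ ys) [] (Z1 \<union> (set ?w \<union> Z2))" .
  let ?Z = "Z1 \<union> (set ?w \<union> Z2)"
  have fin: "finite ?Z" using colouring_finite[OF Z] by blast
  have "V1 \<union> V2 \<subseteq> snd ` (?Z - {(b, p)})"
  proof
    fix x assume "x \<in> V1 \<union> V2"
    then obtain y where "y \<in> ?Z" "snd y = x" using Z1(2) Z2(2) by blast
    moreover have "(a, p) \<in> ?Z - {(b, p)}" using assms(3) by simp
    ultimately show "x \<in> snd ` (?Z - {(b, p)})"
      by (cases "y = (b, p)") (metis image_eqI snd_conv, blast)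
  qed
  then have "card (V1 \<union> V2) \<le> card (?Z - {(b, p)})"
    using fin by (meson surj_card_le finite_Diff)
  also have "\<dots> < card ?Z"
    by (rule psubset_card_mono[OF fin]) auto
  finally show thesis using that[OF Z] by blast
qed

lemma level_colouring_append:
  assumes "level_colouring (a @ b) W"
  shows "level_colouring a W" "level_colouring b (\<lambda>l. W (length a + l))"
proof -
  show "level_colouring a W"
    unfolding level_colouring_def
  proof (intro allI impI)
    fix h assume "h < length a"
    then show "colour_step (a ! h) (W h) (W (Suc h))"
      using assms[unfolded level_colouring_def, rule_format, of h] by (simp add: nth_append)
  qed
  show "level_colouring b (\<lambda>l. W (length a + l))"
    unfolding level_colouring_def
  proof (intro allI impI)
    fix h assume "h < length b"
    then show "colour_step (b ! h) (W (length a + h)) (W (length a + Suc h))"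
      using assms[unfolded level_colouring_def, rule_format, of "length a + h"] by simp
  qed
qed

text \<open>Recolouring \<open>b\<close> as \<open>a\<close> turns the colouring of
  \<open>Lp\<close> by components into a colouring of either smoothing with one colour less, a lower
  bound for its number of components. Conversely the component colouring of a smoothing is refined
  to a colouring of \<open>Lp\<close> with more colours, so the smoothing has fewer components than
  \<open>Lp\<close>.\<close>

lemma conway_quadruple_components:
  assumes "conway_quadruple h Lp Lm L0 Li" "mixed_crossing Lp h"
  shows "num_components Lm = num_components Lp"
    "Suc (num_components L0) = num_components Lp" "Suc (num_components Li) = num_components Lp"
proof -
  obtain xs k ys where link: "link_diagram Lp" "link_diagram Lm" "link_diagram L0" "link_diagram Li"
    and xs: "length xs = h" and L: "Lp = xs @ [(k, Cross Pos)] @ ys" "Lm = xs @ [(k, Cross Neg)] @ ys"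
    "L0 = xs @ [(k, Cap), (k, Cup)] @ ys" "Li = xs @ ys"
    using assms(1) by (auto simp: conway_quadruple_def)
  have "shadow Lm = shadow Lp" by (simp add: L)
  then show "num_components Lm = num_components Lp" by (rule shadow_components)
  let ?n = "num_components Lp"
  obtain W :: "nat \<Rightarrow> nat list" where W: "level_colouring Lp W" "W 0 = []" "W (length Lp) = []"
    "(\<Union>h \<in> {..length Lp}. set (W h)) = {..<?n}"
    and sep: "\<And>h i j. (h, i) \<in> points Lp \<Longrightarrow> (h, j) \<in> points Lp \<Longrightarrow>
      W h ! i = W h ! j \<longleftrightarrow> same_component Lp (h, i) (h, j)"
    by (rule component_colouring[OF link(1)]) blast
  define U1 where "U1 = (\<Union>l \<in> {..length xs}. set (W l))"
  define U2 where "U2 = (\<Union>l \<in> {..length ys}. set (W (length xs + Suc l)))"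
  have 1: "colouring [] xs (W h) U1"
    using level_colouring_imp_colouring[OF level_colouring_append(1)[OF W(1)[unfolded L]]] W(2) xs
    by (simp add: U1_def)
  have "level_colouring ([(k, Cross Pos)] @ ys) (\<lambda>l. W (length xs + l))"
    using level_colouring_append(2)[OF W(1)[unfolded L]] .
  from level_colouring_append(2)[OF this]
  have 2: "colouring (W (Suc h)) ys [] U2"
    using level_colouring_imp_colouring[of ys "\<lambda>l. W (length xs + Suc l)"] W(3) xs
    by (simp add: U2_def L)
  have U: "U1 \<union> U2 = {..<?n}"
  proof -
    have "{..length Lp} = {..length xs} \<union> (\<lambda>l. length xs + Suc l) ` {..length ys}"
    proof (intro equalityI subsetI)
      fix l assume "l \<in> {..length Lp}"
      then show "l \<in> {..length xs} \<union> (\<lambda>l. length xs + Suc l) ` {..length ys}"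
        using image_eqI[of l "\<lambda>l. length xs + Suc l" "l - Suc (length xs)" "{..length ys}"]
        by (cases "l \<le> length xs") (auto simp: L)
    qed (auto simp: L)
    then show ?thesis unfolding W(4)[symmetric] U1_def U2_def by (simp only: UN_Un image_UN) simp
  qed
  have step: "colour_step (k, Cross Pos) (W h) (W (Suc h))"
    using W(1)[unfolded level_colouring_def, rule_format, of h] xs by (auto simp: L nth_append)
  from step obtain u a b v where w: "W h = u @ [a, b] @ v" "W (Suc h) = u @ [b, a] @ v" "length u = k"
  proof (rule colour_step_split)
    fix u a b v assume "W h = u @ a @ v" "W (Suc h) = u @ b @ v" "length u = k"
      "length a = ins (Cross Pos)" "\<And>c. Cross Pos = Cross c \<Longrightarrow> b = rev a"
    then show thesis by (intro that[of u "a ! 0" "a ! 1" v]) (auto simp: numeral_eq_Suc length_Suc_conv)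
  qed
  have pts: "(h, k) \<in> points Lp" "(h, k + 1) \<in> points Lp"
    using level_colouring_length[OF W(1,2), of h] w xs by (auto simp: points_def L)
  have ab: "a \<noteq> b"
    using assms(2) sep[OF pts] w xs by (auto simp: mixed_crossing_def nth_append L)
  let ?f = "id(b := a)"
  have "?f ` {..<?n} = {..<?n} - {b}" "b < ?n"
    using ab U colouring_finite[OF 1] w(1) by auto
  then have card: "card (?f ` {..<?n}) = ?n - 1" by simp
  have f: "map ?f (u @ [a, b] @ v) = map ?f u @ [a, a] @ map ?f v"
    "map ?f (u @ [b, a] @ v) = map ?f u @ [a, a] @ map ?f v"
    by auto
  note m = colouring_map[OF 1[unfolded w], of ?f, unfolded f] colouring_map[OF 2[unfolded w], of ?f, unfolded f]
  have n: "?n \<ge> 1" using link(1) by (rule link_diagram_num_components)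
  have Li_ge: "?n - 1 \<le> num_components Li"
    using card_colouring_le[OF colouring_append[OF m(1)[unfolded list.map(1)] m(2)[unfolded list.map(1)]]] card
    unfolding image_Un[symmetric] U L(4) by linarith
  have L0_ge: "?n - 1 \<le> num_components L0"
  proof -
    let ?u = "map ?f u" and ?v = "map ?f v"
    have k: "length ?u = k" using w(3) by simp
    have "colouring (?u @ ?v) ((k, Cup) # ys) [] (set (?u @ ?v) \<union> ?f ` U2)"
      by (rule colouring.Cons[OF colour_step_cup[of ?u ?v a, unfolded k]])
        (use m(2) in \<open>simp only: list.map\<close>)
    then have "colouring (?u @ [a, a] @ ?v) ((k, Cap) # (k, Cup) # ys) []
      (set (?u @ [a, a] @ ?v) \<union> (set (?u @ ?v) \<union> ?f ` U2))"
      by (rule colouring.Cons[OF colour_step_cap[of ?u a ?v, unfolded k]])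
    from colouring_append[OF m(1)[unfolded list.map(1)] this]
    have *: "colouring [] L0 [] (?f ` U1 \<union> (set (?u @ [a, a] @ ?v) \<union> (set (?u @ ?v) \<union> ?f ` U2)))"
      (is "colouring _ _ _ ?U") unfolding L(3) append_Cons append_Nil .
    have "card (?f ` {..<?n}) \<le> card ?U"
      using colouring_finite[OF *] by (intro card_mono) (auto simp flip: U)
    then show ?thesis using card_colouring_le[OF *] card by simp
  qed
  \<comment> \<open>In \<open>Li\<close> the strands run straight through, so the same word
    \<open>x\<close> is read below and above: the first alternative in
    \<open>refine_colouring\<close>.\<close>
  have Li_le: "num_components Li < ?n"
  proof -
    obtain V :: "nat \<Rightarrow> nat list" where V: "level_colouring Li V" "V 0 = []" "V (length Li) = []"
      "(\<Union>h \<in> {..length Li}. set (V h)) = {..<num_components Li}"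
      by (rule component_colouring[OF link(4)]) blast
    have "colouring [] (xs @ ys) [] {..<num_components Li}"
      using level_colouring_imp_colouring[OF V(1)] V(2-4) L(4) by simp
    then obtain x V1 V2 where V: "colouring [] xs x V1" "colouring x ys [] V2"
      "{..<num_components Li} = V1 \<union> V2"
      by (rule colouring_appendE)
    have "length x = length (u @ [a, b] @ v)"
      using colouring_tangle[OF V(1)] colouring_tangle[OF 1[unfolded w]] by simp
    then have x: "x = take k x @ [x ! k, x ! (k + 1)] @ drop (k + 2) x"
      using w(3) by (simp add: Cons_nth_drop_Suc)
    obtain Z :: "(nat \<times> nat) set"
      where "colouring [] (xs @ [(length u, Cross Pos)] @ ys) [] Z" "card (V1 \<union> V2) < card Z"
      by (rule refine_colouring[OF 1[unfolded w] 2[unfolded w] ab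
          V(1)[unfolded arg_cong[OF x, of "\<lambda>x. colouring [] xs x V1"]]
          V(2)[unfolded arg_cong[OF x, of "\<lambda>x. colouring x ys [] V2"]]])
        (use \<open>length x = _\<close> w(3) in auto)
    then show ?thesis using card_colouring_le[of Lp Z] V(3) w(3) L(1) by (metis card_lessThan order_less_le_trans)
  qed
  \<comment> \<open>In \<open>L0\<close> the two lower ends share a colour through the cap, the two
    upper ones through the cup: the second alternative in \<open>refine_colouring\<close>.\<close>
  have L0_le: "num_components L0 < ?n"
  proof -
    obtain V :: "nat \<Rightarrow> nat list" where V: "level_colouring L0 V" "V 0 = []" "V (length L0) = []"
      "(\<Union>h \<in> {..length L0}. set (V h)) = {..<num_components L0}"
      by (rule component_colouring[OF link(3)]) blast
    have "colouring [] (xs @ [(k, Cap), (k, Cup)] @ ys) [] {..<num_components L0}"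
      using level_colouring_imp_colouring[OF V(1)] V(2-4) L(3) by simp
    then obtain x V1 V2' where V: "colouring [] xs x V1" "colouring x ([(k, Cap), (k, Cup)] @ ys) [] V2'"
      "{..<num_components L0} = V1 \<union> V2'"
      by (rule colouring_appendE)
    from V(2) obtain y V3 where y: "colour_step (k, Cap) x y" "colouring y ([(k, Cup)] @ ys) [] V3" "V2' = set x \<union> V3"
      by (auto elim: colouring_ConsE)
    from y(2) obtain z V2 where z: "colour_step (k, Cup) y z" "colouring z ys [] V2" "V3 = set y \<union> V2"
      by (auto elim: colouring_ConsE)
    from y(1) obtain u' p v' where x: "x = u' @ [p, p] @ v'" "y = u' @ v'" "length u' = k"
      by cases (auto simp: numeral_eq_Suc)
    from z(1) obtain s where z': "z = u' @ [s, s] @ v'"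
      using x by cases (auto simp: numeral_eq_Suc)
    obtain Z :: "(nat \<times> nat) set" where Z: "colouring [] (xs @ [(length u, Cross Pos)] @ ys) [] Z" "card (V1 \<union> V2) < card Z"
    proof (rule refine_colouring[OF 1[unfolded w] 2[unfolded w] ab V(1)[unfolded x] z(2)[unfolded z']])
      show "length u' = length u" "p = s \<and> p = s \<or> p = p \<and> s = s" using x w by auto
    qed
    have "V1 \<union> V2' = V1 \<union> V2"
      using y(3) z(3) x colouring_finite[OF V(1)] by auto
    then show ?thesis using Z card_colouring_le[of Lp Z] V(3) w(3) L(1) by (metis card_lessThan order_less_le_trans)
  qed
  show "Suc (num_components L0) = ?n" "Suc (num_components Li) = ?n"
    using n Li_ge Li_le L0_ge L0_le by auto
qed

section \<open>Splitting a layered diagram\<close>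

text \<open>The shift makes room for the open top ends of the earlier tangles.\<close>

fun juxtapose :: "(nat \<Rightarrow> diagram) \<Rightarrow> nat \<Rightarrow> diagram" where
  "juxtapose f 0 = []"
| "juxtapose f (Suc n) = juxtapose f n @ shift (upper 0 (juxtapose f n)) (f n)"

lemma tangle_juxtapose:
  assumes "\<And>c. tangle 0 (f c)"
  shows "tangle 0 (juxtapose f n) \<and> upper 0 (juxtapose f n) = (\<Sum>c<n. upper 0 (f c))"
proof (induction n)
  case (Suc n)
  then show ?case using tangle_shift[OF assms[of n], of "upper 0 (juxtapose f n)"] by simp
qed simp

lemma juxtapose_cong: "(\<And>c. c < n \<Longrightarrow> f c = g c) \<Longrightarrow> juxtapose f n = juxtapose g n"
  by (induction n) auto

lemma juxtapose_closed:
  assumes "\<And>c. tangle 0 (f c)" "\<And>c. upper 0 (f c) = 0"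
  shows "juxtapose f n = concat (map f [0..<n])"
proof (induction n)
  case (Suc n)
  have "upper 0 (juxtapose f n) = 0" using tangle_juxtapose[of f n] assms by simp
  with Suc show ?case by simp
qed simp

text \<open>The slice sits on the ends of the tangle number \<open>x\<close>. It has to be moved
  below all tangles further to the right, whose offset changes with the number of those
  ends.\<close>

lemma juxtapose_snoc:
  assumes "\<And>c. tangle 0 (f c)" "x < n" "i + ins p \<le> upper 0 (f x)"
  shows "tangle_isotopic 0 (juxtapose f n @ [((\<Sum>c<x. upper 0 (f c)) + i, p)])
    (juxtapose (f(x := f x @ [(i, p)])) n)"
  using assms(2)
proof (induction n)
  case (Suc n)
  let ?f = "f(x := f x @ [(i, p)])" and ?t = "upper 0 (juxtapose f n)" and ?pos = "(\<Sum>c<x. upper 0 (f c)) + i"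
  have t: "tangle 0 (juxtapose f n)" "?t = (\<Sum>c<n. upper 0 (f c))"
    using tangle_juxtapose[OF assms(1)] by auto
  show ?case
  proof (cases "x = n")
    case True
    have "juxtapose ?f n = juxtapose f n" using True by (intro juxtapose_cong) auto
    then have e: "juxtapose ?f (Suc n) = juxtapose f (Suc n) @ [(?pos, p)]"
      using True t(2) by (simp add: add.commute)
    have "tangle 0 (juxtapose f (Suc n) @ [(?pos, p)])"
      using tangle_juxtapose[of f "Suc n", OF assms(1)] assms(3) True by simp
    then show ?thesis unfolding e by (rule tangle_isotopic.refl)
  next
    case False
    with Suc(2) have x: "x < n" by simp
    then have IH: "tangle_isotopic 0 (juxtapose f n @ [(?pos, p)]) (juxtapose ?f n)" by (rule Suc.IH)
    have "(\<Sum>c<n. upper 0 (f c)) = (\<Sum>c\<in>{..<n} - {..<Suc x}. upper 0 (f c)) + (\<Sum>c<Suc x. upper 0 (f c))"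
      using x by (intro sum.subset_diff) auto
    then have le: "?pos + ins p \<le> ?t" using t(2) assms(3) by simp
    have upper: "upper 0 (juxtapose ?f n) = across ?t p"
      using tangle_isotopic_wf[OF IH] by simp
    have tf: "tangle (?t + j) (shift ?t (f n))" "tangle (across ?t p) (shift (across ?t p) (f n))" for j
      using tangle_shift[OF assms(1)[of n], of ?t] tangle_shift[OF assms(1)[of n], of "across ?t p"]
        tangle_add[of ?t "shift ?t (f n)" j] by auto
    have "tangle_isotopic 0 (juxtapose f n @ (shift ?t (f n) @ [(?pos, p)]))
        (juxtapose f n @ ((?pos, p) # shift (across ?t p) (f n)))"
      by (rule tangle_replace_sym[OF interchange_single[OF le assms(1)[of n]], where xs = "juxtapose f n" and ys = "[]"])
        (use t(1) in auto)
    also have "tangle_isotopic 0 \<dots> (juxtapose ?f n @ shift (across ?t p) (f n))"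
      by (rule tangle_replace[OF IH, where xs = "[]" and ys = "shift (across ?t p) (f n)"])
        (use tf in auto)
    finally have "tangle_isotopic 0 (juxtapose f n @ (shift ?t (f n) @ [(?pos, p)]))
        (juxtapose ?f n @ shift (across ?t p) (f n))" .
    moreover have "?f n = f n" using False by simp
    ultimately show ?thesis unfolding juxtapose.simps upper append_assoc by (simp only:)
  qed
qed simp

section \<open>The part of a diagram in one colour\<close>

text \<open>Both words are tested because a cup has no ends below and a cap none above, so that one
  test is vacuous there. A crossing of two colours fails the test for every \<open>c\<close> and
  leaves no trace in the parts.\<close>

fun colour_part_slice :: "nat \<Rightarrow> nat \<times> piece \<Rightarrow> nat list \<Rightarrow> nat list \<Rightarrow> diagram" where
  "colour_part_slice c (k, p) w w' =
    (if take (ins p) (drop k w) = replicate (ins p) c \<and> take (outs p) (drop k w') = replicate (outs p) c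
     then [(count_list (take k w) c, p)] else [])"

primrec colour_part :: "diagram \<Rightarrow> (nat \<Rightarrow> nat list) \<Rightarrow> nat \<Rightarrow> nat \<Rightarrow> diagram" where
  "colour_part D W c 0 = []"
| "colour_part D W c (Suc h) = colour_part D W c h @ colour_part_slice c (D ! h) (W h) (W (Suc h))"

lemma colour_part_slice_same:
  "colour_part_slice c (length u, p) (u @ replicate (ins p) x @ v) (u @ replicate (outs p) x @ v) =
    (if x = c then [(count_list u c, p)] else [])"
  by (cases p) (auto simp: numeral_eq_Suc)

lemma colour_part_slice_cross:
  "x \<noteq> y \<Longrightarrow> colour_part_slice c (length u, Cross d) (u @ [x, y] @ v) (u @ [y, x] @ v) = []"
  by (auto simp: numeral_eq_Suc)

lemma count_list_replicate [simp]: "count_list (replicate n x) y = (if x = y then n else 0)"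
  by (induction n) auto

lemma colour_part_tangle:
  assumes "level_colouring D W" "W 0 = []" "h \<le> length D"
  shows "tangle 0 (colour_part D W c h) \<and> upper 0 (colour_part D W c h) = count_list (W h) c"
  using assms(3)
proof (induction h)
  case 0
  then show ?case using assms(2) by simp
next
  case (Suc h)
  have "colour_step (D ! h) (W h) (W (Suc h))"
    using assms(1) Suc(2) unfolding level_colouring_def by (metis Suc_le_lessD)
  then show ?case
  proof cases
    case (same u p x v)
    then show ?thesis
      using Suc colour_part_slice_same[of c u p x v] by (auto simp: across_def simp del: colour_part_slice.simps)
  next
    case (cross x y u d v)
    then show ?thesis
      using Suc colour_part_slice_cross[of x y c u d v] by (auto simp del: colour_part_slice.simps)
  qed
qed

text \<open>Two descriptions of where the ends of colour \<open>x\<close> start: in the row of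
  colour parts, and at the bottom of the sorting braid.\<close>

lemma sum_count_list_less: "(\<Sum>c<x. count_list w c) = smaller x w"
proof (induction w)
  case (Cons y w)
  have "(\<Sum>c<x. count_list (y # w) c) = (\<Sum>c<x. (if y = c then 1 else 0) + count_list w c)"
    by (intro sum.cong) auto
  then show ?case using Cons by (simp add: sum.distrib)
qed simp

text \<open>At \<open>Pos\<close> the strand from the bottom right is the upper one, so the larger
  colour runs over the smaller.\<close>

definition layered :: "diagram \<Rightarrow> (nat \<Rightarrow> nat list) \<Rightarrow> bool" where
  "layered D W \<longleftrightarrow> (\<forall>h u x y v c. h < length D \<longrightarrow> D ! h = (length u, Cross c) \<longrightarrow> W h = u @ [x, y] @ v \<longrightarrow>
    x \<noteq> y \<longrightarrow> c = (if x < y then Pos else Neg))"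

text \<open>A slice in one colour slides down through the braid by \<open>unsort_natural\<close> and
  joins its part by \<open>juxtapose_snoc\<close>; a crossing of two colours agrees with the layers
  and is swallowed by the braid, by \<open>unsort_cross\<close>. At the top of a link no ends are
  left and the braid is trivial.\<close>

lemma layered_isotopic_juxtapose:
  assumes "level_colouring D W" "W 0 = []" "layered D W" "tangle 0 D"
    "\<And>h. h \<le> length D \<Longrightarrow> set (W h) \<subseteq> {..<n}" "h \<le> length D"
  shows "tangle_isotopic 0 (take h D) (juxtapose (\<lambda>c. colour_part D W c h) n @ unsort (W h))"
  using assms(6)
proof (induction h)
  case 0
  have "juxtapose (\<lambda>c. []) n = []" by (induction n) auto
  then show ?case using assms(2) by (simp add: tangle_isotopic.refl)
next
  case (Suc h)
  let ?f = "\<lambda>c. colour_part D W c h" and ?f' = "\<lambda>c. colour_part D W c (Suc h)"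
  have h: "h < length D" using Suc by simp
  have rt: "tangle 0 (?f c)" "upper 0 (?f c) = count_list (W h) c" for c
    using colour_part_tangle[OF assms(1,2), of h c] h by auto
  have jt: "tangle 0 (juxtapose ?f n)" "upper 0 (juxtapose ?f n) = (\<Sum>c<n. count_list (W h) c)"
    using tangle_juxtapose[of ?f n] rt by auto
  have "(\<Sum>c<n. count_list (W h) c) = length (W h)"
    unfolding sum_count_list_less smaller_def using assms(5)[of h] h by (subst filter_True) auto
  with jt have jt: "tangle 0 (juxtapose ?f n)" "upper 0 (juxtapose ?f n) = length (W h)" by auto
  have D: "take (Suc h) D = take h D @ [D ! h]" using h by (simp add: take_Suc_conv_app_nth)
  have tD: "tangle (upper 0 (take h D)) [D ! h]" using assms(4) id_take_nth_drop[OF h] 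
    by (metis D append_take_drop_id tangle_append)
  have "tangle_isotopic 0 (take (Suc h) D) (juxtapose ?f n @ (unsort (W h) @ [D ! h]))"
    unfolding D by (rule tangle_replace[OF Suc.IH, where xs = "[]" and ys = "[D ! h]"]) (use h tD in auto)
  also have "tangle_isotopic 0 \<dots> (juxtapose ?f' n @ unsort (W (Suc h)))"
  proof -
    have "colour_step (D ! h) (W h) (W (Suc h))"
      using assms(1) h by (auto simp: level_colouring_def)
    then show ?thesis
    proof cases
      case (same u p x v)
      let ?i = "count_list u x" and ?pos = "smaller x (u @ v) + count_list u x"
      \<comment> \<open>A cup shows its colour only above, a cap only below.\<close>
      have "x \<in> set (W h) \<union> set (W (Suc h))"
        using same by (cases p) auto
      then have x: "x < n" using assms(5)[of h] assms(5)[of "Suc h"] h by auto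
      have pos: "(\<Sum>c<x. upper 0 (?f c)) = smaller x (u @ v)"
        unfolding rt sum_count_list_less using same by simp
      have "?i + ins p \<le> count_list (W h) x" using same by simp
      then have *: "tangle_isotopic 0 (juxtapose ?f n @ [(?pos, p)]) (juxtapose (?f(x := ?f x @ [(?i, p)])) n)"
        using juxtapose_snoc[of ?f x n ?i p] x rt unfolding pos by simp
      have f': "?f(x := ?f x @ [(?i, p)]) = ?f'"
        using same colour_part_slice_same[of _ u p x v] by (auto simp del: colour_part_slice.simps)
      have "tangle_isotopic 0 (juxtapose ?f n @ (unsort (W h) @ [D ! h]))
          (juxtapose ?f n @ ((?pos, p) # unsort (W (Suc h))))"
        unfolding same by (rule tangle_replace[OF unsort_natural, where xs = "juxtapose ?f n" and ys = "[]"])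
          (use jt same in auto)
      also have "tangle_isotopic 0 \<dots> (juxtapose ?f' n @ unsort (W (Suc h)))"
        using * unfolding f'
      proof (rule tangle_replace[where xs = "[]" and ys = "unsort (W (Suc h))"])
        show "tangle (upper 0 [] - 0 + upper 0 (juxtapose ?f n @ [(?pos, p)])) (unsort (W (Suc h)))"
          using jt same by (simp add: across_def)
      qed auto
      finally show ?thesis .
    next
      case (cross x y u c v)
      have c: "c = (if x < y then Pos else Neg)"
        using assms(3)[unfolded layered_def, rule_format, of h u c x y v] cross h by simp
      have f': "?f = ?f'"
        using cross colour_part_slice_cross[of x y _ u c v] by (auto simp del: colour_part_slice.simps)
      show ?thesis unfolding f'[symmetric] cross(1-3) c
        by (rule tangle_replace[OF unsort_cross[OF cross(4)], where xs = "juxtapose ?f n" and ys = "[]"])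
          (use jt cross in auto)
    qed
  qed
  finally show ?case .
qed

section \<open>The part in one component is a knot\<close>

text \<open>Refines the colour \<open>c\<close> by a colouring of the part in that colour, whose
  ends are met in the order from left to right. The entry 0 at all other colours is a dummy.\<close>

fun merge :: "nat \<Rightarrow> nat list \<Rightarrow> nat list \<Rightarrow> (nat \<times> nat) list" where
  "merge c [] v = []"
| "merge c (x # w) v = (if x = c then (c, hd v) # merge c w (tl v) else (x, 0) # merge c w v)"

lemma merge_append:
  "length v = count_list w c \<Longrightarrow> merge c (w @ w') (v @ v') = merge c w v @ merge c w' v'"
proof (induction c w v rule: merge.induct)
  case (2 c x w v)
  then show ?case by (cases v) (auto split: if_splits)
qed auto

lemma length_merge [simp]: "length (merge c w v) = length w"
  by (induction c w v rule: merge.induct) auto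

lemma set_merge:
  "length v = count_list w c \<Longrightarrow> set (merge c w v) = (\<lambda>x. (x, 0)) ` (set w - {c}) \<union> Pair c ` set v"
proof (induction c w v rule: merge.induct)
  case (2 c x w v)
  then show ?case by (cases v) (auto split: if_splits)
qed auto

lemma merge_replicate:
  "merge c (replicate (length e) c) e = map (Pair c) e"
  "x \<noteq> c \<Longrightarrow> merge c (replicate n x) v = replicate n (x, 0)"
  subgoal by (induction e) auto
  subgoal by (induction n) auto
  done

lemma colour_part_mono: "h \<le> h' \<Longrightarrow> \<exists>ys. colour_part D W c h' = colour_part D W c h @ ys"
proof (induction h')
  case (Suc h')
  show ?case
  proof (cases "h = Suc h'")
    case True
    then show ?thesis by (intro exI[of _ "[]"]) simp
  next
    case False
    then obtain ys where "colour_part D W c h' = colour_part D W c h @ ys" using Suc by (metis le_SucE)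
    then show ?thesis unfolding colour_part.simps(2)[of D W c h'] by (metis append_assoc)
  qed
qed simp

text \<open>If the part of colour \<open>c\<close> had two components, the merged colouring would thus have more colours
  than there are components.\<close>

lemma merge_level_colouring:
  assumes "level_colouring D W" "W 0 = []" "level_colouring (colour_part D W c (length D)) V" "V 0 = []"
  defines "t \<equiv> \<lambda>h. length (colour_part D W c h)"
  shows "level_colouring D (\<lambda>h. merge c (W h) (V (t h)))"
    "\<And>h. h \<le> length D \<Longrightarrow> length (V (t h)) = count_list (W h) c"
proof -
  let ?R = "colour_part D W c (length D)"
  have pre: "take (t h) ?R = colour_part D W c h" if "h \<le> length D" for h
    using colour_part_mono[OF that, of D W c] by (auto simp: t_def)
  have tle: "t h \<le> length ?R" if "h \<le> length D" for h
    using colour_part_mono[OF that, of D W c] by (auto simp: t_def)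
  show len: "length (V (t h)) = count_list (W h) c" if "h \<le> length D" for h
    using level_colouring_length[OF assms(3,4) tle[OF that]] colour_part_tangle[OF assms(1,2) that, of c]
    by (simp add: strands_eq_upper pre[OF that])
  show "level_colouring D (\<lambda>h. merge c (W h) (V (t h)))"
    unfolding level_colouring_def
  proof (intro allI impI)
    fix h assume h: "h < length D"
    have lenh: "length (V (t h)) = count_list (W h) c" using len h by simp
    have "colour_step (D ! h) (W h) (W (Suc h))"
      using assms(1) h by (auto simp: level_colouring_def)
    then show "colour_step (D ! h) (merge c (W h) (V (t h))) (merge c (W (Suc h)) (V (t (Suc h))))"
    proof cases
      case (same u p x v)
      let ?cu = "count_list u c"
      have lu: "length (take ?cu (V (t h))) = ?cu" using lenh same by simp
      show ?thesis
      proof (cases "x = c")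
        case False
        then have t: "t (Suc h) = t h"
          using same colour_part_slice_same[of c u p x v] by (simp add: t_def del: colour_part_slice.simps)
        have "merge c (u @ replicate n x @ v) (V (t h)) =
          merge c u (take ?cu (V (t h))) @ replicate n (x, 0) @ merge c v (drop ?cu (V (t h)))" for n
          using merge_append[OF lu, of "replicate n x @ v" "drop ?cu (V (t h))"]
            merge_append[of "[]" "replicate n x" c v "drop ?cu (V (t h))"] merge_replicate(2)[of x c n "[]"] False by simp
        then have "colour_step (length u, p) (merge c (u @ replicate (ins p) x @ v) (V (t h)))
            (merge c (u @ replicate (outs p) x @ v) (V (t h)))"
          using colour_step.same[of "merge c u (take ?cu (V (t h)))" p "(x, 0)"] by (simp only: length_merge)
        then show ?thesis unfolding same(1-3) t .
      next
        case True
        have R: "colour_part D W c (Suc h) = colour_part D W c h @ [(?cu, p)]"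
          using same True colour_part_slice_same[of c u p x v] by (simp del: colour_part_slice.simps)
        then have t: "t (Suc h) = Suc (t h)" by (simp add: t_def)
        obtain ys where "?R = colour_part D W c (Suc h) @ ys"
          using colour_part_mono[of "Suc h" "length D" D W c] h by auto
        then have "?R = colour_part D W c h @ [(?cu, p)] @ ys" unfolding R by simp
        \<comment> \<open>The slice at height \<open>h\<close> of the diagram is the slice number
          \<open>t h\<close> of the part.\<close>
        then have "?R ! t h = (?cu, p)" "t h < length ?R" by (simp_all add: t_def)
        then have "colour_step (?cu, p) (V (t h)) (V (Suc (t h)))"
          using assms(3)[unfolded level_colouring_def, rule_format, of "t h"] by simp
        then obtain v1 a b v2 where V: "V (t h) = v1 @ a @ v2" "V (Suc (t h)) = v1 @ b @ v2"
          "length v1 = ?cu" "length a = ins p" "length b = outs p"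
          "(\<exists>c. p = Cross c) \<or> (\<exists>x. a = replicate (ins p) x \<and> b = replicate (outs p) x)"
          "\<And>c. p = Cross c \<Longrightarrow> b = rev a"
          by (rule colour_step_split) blast
        have m: "merge c (u @ replicate (length e) c @ v) (v1 @ e @ v2) = merge c u v1 @ map (Pair c) e @ merge c v v2" for e
          using merge_append[of v1 u c "replicate (length e) c @ v" "e @ v2"] V(3)
            merge_append[of e "replicate (length e) c" c v v2] merge_replicate(1)[of c e] by simp
        show ?thesis
        proof (cases "\<exists>d. p = Cross d")
          case True
          then obtain d where d: "p = Cross d" by blast
          then obtain y z where "a = [y, z]" "b = [z, y]"
            using V(4,7) by (auto simp: numeral_eq_Suc length_Suc_conv)
          then have "colour_step (length u, p) (merge c u v1 @ map (Pair c) a @ merge c v v2)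
              (merge c u v1 @ map (Pair c) b @ merge c v v2)"
            unfolding d using colour_step_cross[of "merge c u v1" d "(c, y)" "(c, z)" "merge c v v2"]
            by (simp only: length_merge list.map)
          then show ?thesis unfolding same(1-3) t V(1,2) m[symmetric] V(4,5) \<open>x = c\<close> .
        next
          case False
          then obtain y where "a = replicate (ins p) y" "b = replicate (outs p) y" using V(6) by blast
          then have "colour_step (length u, p) (merge c u v1 @ map (Pair c) a @ merge c v v2)
              (merge c u v1 @ map (Pair c) b @ merge c v v2)"
            using colour_step.same[of "merge c u v1" p "(c, y)" "merge c v v2"]
            by (simp only: length_merge map_replicate)
          then show ?thesis unfolding same(1-3) t V(1,2) m[symmetric] V(4,5) \<open>x = c\<close> .
        qed
      qed
    next
      case (cross x y u d v)
      let ?cu = "count_list u c"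
      have t: "t (Suc h) = t h"
        using cross colour_part_slice_cross[of x y c u d v] by (simp add: t_def del: colour_part_slice.simps)
      have lu: "length (take ?cu (V (t h))) = ?cu" using lenh cross by simp
      have m: "merge c (u @ [x, y] @ v) (V (t h)) = merge c u (take ?cu (V (t h))) @ merge c ([x, y] @ v) (drop ?cu (V (t h)))"
        for x y
        using merge_append[OF lu, of "[x, y] @ v" "drop ?cu (V (t h))"] by simp
      obtain a b r where "merge c ([x, y] @ v) (drop ?cu (V (t h))) = [a, b] @ r"
        "merge c ([y, x] @ v) (drop ?cu (V (t h))) = [b, a] @ r"
      proof (cases "x = c")
        case True
        then show ?thesis
          using cross(4) that[of "(c, hd (drop ?cu (V (t h))))" "(y, 0)" "merge c v (tl (drop ?cu (V (t h))))"] by simp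
      next
        case False
        then show ?thesis
          using cross(4) that[of "(x, 0)" "(c, hd (drop ?cu (V (t h))))" "merge c v (tl (drop ?cu (V (t h))))"]
            that[of "(x, 0)" "(y, 0)" "merge c v (drop ?cu (V (t h)))"] by (cases "y = c") simp_all
      qed
      then show ?thesis
        unfolding cross(1-3) t m using colour_step_cross[of "merge c u (take ?cu (V (t h)))" d a b r]
        by (simp only: length_merge)
    qed
  qed
qed

text \<open>Discrete intermediate values. Each slice of the diagram contributes at most one slice to
  a colour part, so every level of the part is seen at some height of the diagram.\<close>

lemma surj_unit_steps:
  fixes t :: "nat \<Rightarrow> nat"
  assumes "t 0 = 0" "\<And>h. t (Suc h) \<le> Suc (t h)" "j \<le> t H"
  shows "\<exists>h \<le> H. t h = j"
  using assms(3)
proof (induction H)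
  case (Suc H)
  then show ?case using assms(2)[of H] by (cases "j \<le> t H") (auto intro: le_SucI exI[of _ "Suc H"])
qed (use assms(1) in auto)

lemma length_restrict_slice: "length (colour_part_slice c s w w') \<le> 1"
  by (cases s) simp

lemma colour_part_knot:
  assumes "level_colouring D W" "W 0 = []" "W (length D) = []"
    "(\<Union>h \<in> {..length D}. set (W h)) = {..<num_components D}" "c < num_components D"
  shows "knot_diagram (colour_part D W c (length D))"
proof -
  let ?R = "colour_part D W c (length D)"
  \<comment> \<open>An empty part would leave no ends of colour \<open>c\<close> at any height,
    although \<open>c\<close> is used.\<close>
  have "?R \<noteq> []"
  proof
    assume R: "?R = []"
    obtain h where h: "h \<le> length D" "c \<in> set (W h)" using assms(4,5) by blast
    then have "colour_part D W c h = []" using colour_part_mono[OF h(1), of D W c] R by auto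
    then have "count_list (W h) c = 0" using colour_part_tangle[OF assms(1,2) h(1), of c] by simp
    then show False using h(2) by (simp add: count_list_0_iff)
  qed
  then have link: "link_diagram ?R"
    using colour_part_tangle[OF assms(1,2) order_refl, of c] assms(3) by (simp add: link_diagram_iff_tangle)
  obtain V :: "nat \<Rightarrow> nat list" where V: "level_colouring ?R V" "V 0 = []" "V (length ?R) = []"
    "(\<Union>h \<in> {..length ?R}. set (V h)) = {..<num_components ?R}"
    by (rule component_colouring[OF link]) blast
  define t where "t h = length (colour_part D W c h)" for h
  note M = merge_level_colouring[OF assms(1,2) V(1,2), folded t_def]
  let ?M = "\<lambda>h. merge c (W h) (V (t h))"
  have t0: "t 0 = 0" by (simp add: t_def)
  have tSuc: "t (Suc h) \<le> Suc (t h)" for h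
    using length_restrict_slice[of c "D ! h" "W h" "W (Suc h)"] by (simp add: t_def)
  have tR: "t (length D) = length ?R" by (simp add: t_def)
  have "(\<lambda>x. (x, 0)) ` ({..<num_components D} - {c}) \<union> Pair c ` {..<num_components ?R} \<subseteq>
     (\<Union>h \<in> {..length D}. set (?M h))" (is "?U \<subseteq> _")
  proof
    fix a assume "a \<in> ?U"
    then consider x where "a = (x, 0)" "x < num_components D" "x \<noteq> c" | y where "a = (c, y)" "y < num_components ?R"
      by blast
    then show "a \<in> (\<Union>h \<in> {..length D}. set (?M h))"
    proof cases
      case 1
      then obtain h where h: "h \<le> length D" "x \<in> set (W h)" using assms(4) by blast
      then have "a \<in> set (?M h)" using 1 set_merge[OF M(2)[OF h(1)]] by auto
      then show ?thesis using h(1) by blast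
    next
      case 2
      then obtain j where j: "j \<le> length ?R" "y \<in> set (V j)" using V(4) by blast
      then obtain h where h: "h \<le> length D" "t h = j" using surj_unit_steps[of t, OF t0 tSuc, of j "length D"] tR by auto
      then have "a \<in> set (?M h)" using 2 j set_merge[OF M(2)[OF h(1)]] by auto
      then show ?thesis using h(1) by blast
    qed
  qed
  moreover have col: "colouring [] D [] (\<Union>h \<in> {..length D}. set (?M h))"
    using level_colouring_imp_colouring[OF M(1)] assms(2,3) by simp
  ultimately have "card ?U \<le> num_components D"
    using card_colouring_le[OF col] card_mono[of _ ?U] colouring_finite[OF col] by (meson order_trans)
  moreover have "card ?U = card ((\<lambda>x. (x, 0::nat)) ` ({..<num_components D} - {c})) + card (Pair c ` {..<num_components ?R})"
    by (rule card_Un_disjoint) auto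
  moreover have "\<dots> = (num_components D - 1) + num_components ?R"
    using assms(5) by (simp add: card_image inj_on_def)
  ultimately have "num_components ?R \<le> 1" using assms(5) by simp
  then show ?thesis using link link_diagram_num_components[OF link] by (simp add: knot_diagram_def)
qed

lemma layered_union_of_unlinked_knots:
  assumes "link_diagram D" "level_colouring D W" "W 0 = []" "W (length D) = []" "layered D W"
    "(\<Union>h \<in> {..length D}. set (W h)) = {..<num_components D}"
  shows "union_of_unlinked_knots (num_components D) D"
proof -
  let ?n = "num_components D" and ?R = "\<lambda>c. colour_part D W c (length D)"
  have R: "tangle 0 (?R c)" "upper 0 (?R c) = 0" for c
    using colour_part_tangle[OF assms(2,3) order_refl, of c] assms(4) by auto
  have "tangle 0 D" using assms(1) by (simp add: link_diagram_iff_tangle)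
  moreover have "set (W h) \<subseteq> {..<?n}" if "h \<le> length D" for h using assms(6) that by blast
  ultimately have "tangle_isotopic 0 (take (length D) D) (juxtapose ?R ?n @ unsort (W (length D)))"
    using assms by (intro layered_isotopic_juxtapose) auto
  then have "tangle_isotopic 0 D (concat (map ?R [0..<?n]))"
    using juxtapose_closed[of ?R ?n, OF R] assms(4) by simp
  then have "isotopic D (concat (map ?R [0..<?n]))"
    using tangle_isotopic_imp_isotopic assms(1) by blast
  moreover have "\<forall>K \<in> set (map ?R [0..<?n]). knot_diagram K"
    using colour_part_knot[OF assms(2,3,4,6)] by auto
  ultimately show ?thesis
    unfolding union_of_unlinked_knots_def using assms(1) by (metis length_map length_upt diff_zero)
qed

text \<open>Putting the components above each other in layers only needs changes of mixed crossings.\<close>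

lemma unlinking:
  assumes "link_diagram D"
  obtains D' where "shadow D' = shadow D" "union_of_unlinked_knots (num_components D') D'"
    "\<And>h. h < length D \<Longrightarrow> D' ! h \<noteq> D ! h \<Longrightarrow> mixed_crossing D h"
proof -
  obtain W :: "nat \<Rightarrow> nat list" where W: "level_colouring D W" "W 0 = []" "W (length D) = []"
    "(\<Union>h \<in> {..length D}. set (W h)) = {..<num_components D}"
    and sep: "\<And>h i j. (h, i) \<in> points D \<Longrightarrow> (h, j) \<in> points D \<Longrightarrow>
      W h ! i = W h ! j \<longleftrightarrow> same_component D (h, i) (h, j)"
    by (rule component_colouring[OF assms]) blast
  define g where "g h = (case D ! h of (k, Cross c) \<Rightarrow>
     (k, Cross (if W h ! k = W h ! (k + 1) then c else if W h ! k < W h ! (k + 1) then Pos else Neg)) | s \<Rightarrow> s)" for h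
  define D' where "D' = map g [0..<length D]"
  have len: "length D' = length D" by (simp add: D'_def)
  have sh: "shadow D' = shadow D"
    by (rule nth_equalityI) (auto simp: D'_def g_def shadow_def split: piece.splits prod.splits)
  have "layered D' W"
    unfolding layered_def
  proof (intro allI impI)
    fix h u x y v c
    assume "h < length D'" "D' ! h = (length u, Cross c)" "W h = u @ [x, y] @ v" "x \<noteq> y"
    then show "c = (if x < y then Pos else Neg)"
      by (auto simp: D'_def g_def nth_append split: piece.splits prod.splits)
  qed
  then have "union_of_unlinked_knots (num_components D') D'"
    using W shadow_level_colouring[OF sh[symmetric] W(1)] len shadow_components(2)[OF sh]
      shadow_link_diagram[OF sh] assms
    by (intro layered_union_of_unlinked_knots[of D' W]) auto
  moreover have "mixed_crossing D h" if h: "h < length D" "D' ! h \<noteq> D ! h" for h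
  proof -
    obtain k c where s: "D ! h = (k, Cross c)" "W h ! k \<noteq> W h ! (k + 1)"
      using h by (auto simp: D'_def g_def split: piece.splits prod.splits if_splits)
    have "k + 1 < strands D h" using assms h(1) s(1) by (auto simp: link_diagram_def)
    then show ?thesis
      using s h(1) sep[of h k "k + 1"] by (auto simp: points_def mixed_crossing_def)
  qed
  ultimately show thesis using sh that by blast
qed

section \<open>Descending diagrams\<close>

text \<open>The braid depends only on comparisons of labels, and a stable sort keeps two neighbours
  in order just as it keeps two equal labels. So the results about ends of one colour become
  available for the two ends of an arc.\<close>

lemma unsort_merge:
  assumes "x < y" "\<forall>z \<in> set (u @ v). z < x \<or> y < z"
  shows "unsort (u @ [x, y] @ v) = unsort (u @ [x, x] @ v)"
  using assms(2)
proof (induction u)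
  case Nil
  then have "filter (\<lambda>z. z < y) v = filter (\<lambda>z. z < x) v"
    using assms(1) by (intro filter_cong) auto
  then have "smaller y v = smaller x v" by (simp add: smaller_def)
  then show ?case using assms(1) by simp
next
  case (Cons z u)
  then show ?case using assms(1) by auto
qed

text \<open>Used to undo the renumbering of labels at cups and caps.\<close>

lemma unsort_map:
  assumes "\<And>x y. x \<in> set w \<Longrightarrow> y \<in> set w \<Longrightarrow> g x < g y \<longleftrightarrow> x < y"
  shows "unsort (map g w) = unsort w"
  using assms
proof (induction w)
  case (Cons z w)
  have "filter (\<lambda>x. g x < g z) w = filter (\<lambda>x. x < z) w"
    using Cons(2) by (intro filter_cong) auto
  then have "smaller (g z) (map g w) = smaller z w" by (simp add: smaller_def filter_map comp_def)
  then show ?case using Cons by simp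
qed simp

text \<open>If the two ends come in order, they count as equal by \<open>unsort_merge\<close>, and
  the cap slides through the braid. Otherwise a crossing of these two strands can be split off at
  the top of the braid, and the cap absorbs it by \<open>cross_cap\<close>.\<close>

lemma unsort_cap:
  assumes "x \<noteq> y" "\<forall>z \<in> set (u @ v). z < min x y \<or> max x y < z"
  shows "tangle_isotopic (length (u @ [x, y] @ v)) (unsort (u @ [x, y] @ v) @ [(length u, Cap)])
    ((smaller (min x y) (u @ v), Cap) # unsort (u @ v))"
proof -
  have *: "tangle_isotopic (length (u @ [x, y] @ v)) (unsort (u @ [x, y] @ v) @ [(length u, Cap)])
    ((smaller x (u @ v), Cap) # unsort (u @ v))"
    if "x < y" "\<forall>z \<in> set (u @ v). z < x \<or> y < z" for x y
  proof -
    have "x \<notin> set u" using that by auto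
    then show ?thesis
      using unsort_natural[of u Cap x v] unfolding unsort_merge[OF that]
      by (simp add: numeral_eq_Suc count_notin)
  qed
  show ?thesis
  proof (cases "x < y")
    case True
    then show ?thesis using *[of x y] assms(2) by simp
  next
    case False
    then have yx: "y < x" using assms(1) by simp
    let ?n = "length (u @ [x, y] @ v)"
    have "tangle_isotopic ?n (unsort (u @ [x, y] @ v) @ [(length u, Cap)])
        (unsort (u @ [y, x] @ v) @ [(length u, Cross Pos), (length u, Cap)])"
      by (rule tangle_replace_sym[OF unsort_swap[OF yx, of u v], where xs = "[]" and ys = "[(length u, Cap)]"]) auto
    also have "tangle_isotopic ?n \<dots> (unsort (u @ [y, x] @ v) @ [(length u, Cap)])"
      by (rule tangle_replace_sym[OF tangle_isotopic_shift[OF cross_cap[of Pos], of "length u"],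
            where xs = "unsort (u @ [y, x] @ v)" and ys = "[]"]) auto
    also have "tangle_isotopic ?n \<dots> ((smaller y (u @ v), Cap) # unsort (u @ v))"
      using *[of y x] yx assms(2) by simp
    finally show ?thesis using yx by (simp add: min_def)
  qed
qed

lemma unsort_cup:
  assumes "x \<noteq> y" "\<forall>z \<in> set (u @ v). z < min x y \<or> max x y < z"
  shows "tangle_isotopic (length (u @ v)) (unsort (u @ v) @ [(length u, Cup)])
    ((smaller (min x y) (u @ v), Cup) # unsort (u @ [x, y] @ v))"
proof -
  have *: "tangle_isotopic (length (u @ v)) (unsort (u @ v) @ [(length u, Cup)])
    ((smaller x (u @ v), Cup) # unsort (u @ [x, y] @ v))"
    if "x < y" "\<forall>z \<in> set (u @ v). z < x \<or> y < z" for x y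
  proof -
    have "x \<notin> set u" using that by auto
    then show ?thesis
      using unsort_natural[of u Cup x v] unfolding unsort_merge[OF that]
      by (simp add: numeral_eq_Suc count_notin)
  qed
  show ?thesis
  proof (cases "x < y")
    case True
    then show ?thesis using *[of x y] assms(2) by simp
  next
    case False
    then have yx: "y < x" using assms(1) by simp
    let ?n = "length (u @ v)"
    have "tangle_isotopic ?n (unsort (u @ v) @ [(length u, Cup)])
        (unsort (u @ v) @ [(length u, Cup), (length u, Cross Pos)])"
      by (rule tangle_replace[OF tangle_isotopic_shift[OF cup_cross[of Pos], of "length u"],
            where xs = "unsort (u @ v)" and ys = "[]"]) auto
    also have "tangle_isotopic ?n \<dots> ((smaller y (u @ v), Cup) # unsort (u @ [y, x] @ v) @ [(length u, Cross Pos)])"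
    proof (rule tangle_replace[OF *[of y x], where xs = "[]" and ys = "[(length u, Cross Pos)]"])
      show "\<forall>z\<in>set (u @ v). z < y \<or> x < z" using yx assms(2) by simp
    qed (use yx in auto)
    also have "tangle_isotopic ?n \<dots> ((smaller y (u @ v), Cup) # unsort (u @ [x, y] @ v))"
      by (rule tangle_replace[OF unsort_swap[OF yx, of u v], where xs = "[(smaller y (u @ v), Cup)]" and ys = "[]"])
        (use smaller_le[of y "u @ v"] in auto)
    finally show ?thesis using yx by (simp add: min_def)
  qed
qed

section \<open>Normal forms made of arcs and circles\<close>

text \<open>In \<open>cups k @ unsort w\<close> with distinct labels below \<open>2 * k\<close>, the
  ends labelled \<open>2 * i\<close> and \<open>2 * i + 1\<close> belong to the arc number
  \<open>i\<close>; this is why layers are halves of labels.\<close>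

definition cups :: "nat \<Rightarrow> diagram" where
  "cups k = map (\<lambda>i. (2 * i, Cup)) [0..<k]"

lemma cups_Suc: "cups (Suc k) = cups k @ [(2 * k, Cup)]"
  by (simp add: cups_def)

lemma tangle_cups [simp]: "tangle 0 (cups k)" "upper 0 (cups k) = 2 * k"
proof -
  have "tangle 0 (cups k) \<and> upper 0 (cups k) = 2 * k"
  proof (induction k)
    case 0
    then show ?case by (simp add: cups_def)
  qed (simp add: cups_Suc)
  then show "tangle 0 (cups k)" "upper 0 (cups k) = 2 * k" by auto
qed

text \<open>An even position lies between two arcs, so the new minimum only has to trade heights
  with those to its right.\<close>

lemma cups_cup: "i \<le> k \<Longrightarrow> tangle_isotopic 0 (cups k @ [(2 * i, Cup)]) (cups (Suc k))"
proof (induction k)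
  case 0
  then show ?case by (auto simp: cups_def intro: tangle_isotopic.refl)
next
  case (Suc k)
  show ?case
  proof (cases "i = Suc k")
    case True
    then show ?thesis by (auto simp: cups_Suc intro: tangle_isotopic.refl)
  next
    case False
    then have i: "i \<le> k" using Suc by simp
    then obtain d where d: "k = i + d" using le_Suc_ex by blast
    have "tangle_isotopic 0 (cups k @ [(2 * k, Cup), (2 * i, Cup)]) (cups k @ [(2 * i, Cup), (2 * Suc k, Cup)])"
      by (rule tangle_isotopic.sym, rule tangle_replace_move[OF tangle_moves(1)[of "2 * i" Cup "2 * d" Cup], where xs = "cups k" and ys = "[]"])
        (use d in auto)
    also have "tangle_isotopic 0 \<dots> (cups (Suc k) @ [(2 * Suc k, Cup)])"
      by (rule tangle_replace[OF Suc.IH[OF i], where xs = "[]" and ys = "[(2 * Suc k, Cup)]"]) auto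
    finally show ?thesis by (simp add: cups_Suc)
  qed
qed

text \<open>An odd position lies between the right end of the arc \<open>i\<close> and the left end
  of the next one. A cap there creates a zigzag, which cancels.\<close>

lemma cups_cap: "i < k \<Longrightarrow> tangle_isotopic 0 (cups (Suc k) @ [(2 * i + 1, Cap)]) (cups k)"
proof (induction k)
  case (Suc k)
  show ?case
  proof (cases "i = k")
    case True
    have "tangle_isotopic 0 ((cups k @ [(2 * k, Cup)]) @ [(2 * k + 2, Cup), (2 * k + 1, Cap)]) (cups k @ [(2 * k, Cup)])"
      by (rule tangle_replace_move[OF tangle_moves(2)[of "2 * k + 1"], where xs = "cups k @ [(2 * k, Cup)]" and ys = "[]"]) auto
    then show ?thesis using True by (simp add: cups_Suc)
  next
    case False
    then have i: "i < k" using Suc by simp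
    then obtain d where d: "k = Suc (i + d)" using less_imp_Suc_add by blast
    have "tangle_isotopic 0 (cups (Suc k) @ [(2 * Suc k, Cup), (2 * i + 1, Cap)]) (cups (Suc k) @ [(2 * i + 1, Cap), (2 * k, Cup)])"
      by (rule tangle_isotopic.sym, rule tangle_replace_move[OF tangle_moves(1)[of "2 * i + 1" Cap "2 * d + 1" Cup], where xs = "cups (Suc k)" and ys = "[]"])
        (use d in auto)
    also have "tangle_isotopic 0 \<dots> (cups k @ [(2 * k, Cup)])"
      by (rule tangle_replace[OF Suc.IH[OF i], where xs = "[]" and ys = "[(2 * k, Cup)]"]) auto
    finally show ?thesis by (simp add: cups_Suc)
  qed
qed simp

definition circles :: "nat \<Rightarrow> diagram" where
  "circles n = concat (replicate n [(0, Cup), (0, Cap)])"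

lemma tangle_circles [simp]: "tangle 0 (circles n)" "upper 0 (circles n) = 0"
proof -
  have "tangle 0 (circles n) \<and> upper 0 (circles n) = 0"
    by (induction n) (auto simp: circles_def)
  then show "tangle 0 (circles n)" "upper 0 (circles n) = 0" by auto
qed

text \<open>It is enough to close the last arc, since \<open>compatible_cap_same\<close> places a
  closing arc in the highest layer.\<close>

lemma cups_circle:
  "tangle_isotopic 0 (circles n @ cups k @ [(2 * k, Cup), (2 * k, Cap)]) (circles (Suc n) @ cups k)"
proof -
  have e: "circles (Suc n) = circles n @ [(0, Cup), (0, Cap)]"
    unfolding circles_def replicate_append_same[symmetric] replicate.simps by simp
  show ?thesis
    by (rule tangle_replace[OF interchange[of 0 "cups k" 0 "[(0, Cup), (0, Cap)]"], where xs = "circles n" and ys = "[]"])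
      (auto simp: e)
qed

section \<open>Labels compatible with the arcs\<close>

lemma smaller_distinct:
  assumes "distinct w" "{..<x} \<subseteq> set w"
  shows "smaller x w = x"
proof -
  have "smaller x w = card (set (filter (\<lambda>y. y < x) w))"
    unfolding smaller_def using assms(1) by (metis distinct_card distinct_filter)
  also have "set (filter (\<lambda>y. y < x) w) = {..<x}" using assms(2) by auto
  finally show ?thesis by simp
qed

text \<open>\<open>M\<close> names the arc to which each end belongs; the arcs lie in layers, and \<open>x div 2\<close> is the
  layer of the end with label \<open>x\<close>.\<close>

definition compatible :: "nat list \<Rightarrow> nat list \<Rightarrow> bool" where
  "compatible M w \<longleftrightarrow> length w = length M \<and> distinct w \<and> set w = {..<length M} \<and>
    (\<forall>r \<in> set (zip M w). \<forall>s \<in> set (zip M w). fst r = fst s \<longleftrightarrow> snd r div 2 = snd s div 2)"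

lemma compatibleD:
  assumes "compatible M w"
  shows "length w = length M" "distinct w" "set w = {..<length M}"
    "\<forall>r \<in> set (zip M w). \<forall>s \<in> set (zip M w). fst r = fst s \<longleftrightarrow> snd r div 2 = snd s div 2"
  using assms unfolding compatible_def by blast+

lemma div2_partner: "x div 2 = y div 2 \<Longrightarrow> x \<noteq> y \<Longrightarrow> min x y = 2 * (x div 2) \<and> max x y = 2 * (x div 2) + 1"
  for x y :: nat
  by (auto simp: min_def max_def)

lemma image_apsndE:
  assumes "r \<in> (\<lambda>(d, l). (d, g l)) ` Z"
  obtains d l where "(d, l) \<in> Z" "r = (d, g l)"
  using assms by auto

text \<open>Below a cup its arc does not exist yet: its layer \<open>i\<close> is deleted and all
  higher labels go down by two, which preserves the pairing by halves. The other conclusions are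
  what \<open>layable_cup\<close> asks for.\<close>

lemma compatible_cup:
  assumes "compatible (U @ [f, f] @ V) (u @ [x, y] @ v)" "length u = length U" "f \<notin> set (U @ V)"
  defines "i \<equiv> x div 2"
  defines "g \<equiv> \<lambda>l. if l < 2 * i then l else l - 2"
  shows "x \<noteq> y" "min x y = 2 * i" "max x y = 2 * i + 1" "\<forall>z \<in> set (u @ v). z < min x y \<or> max x y < z"
    "compatible (U @ V) (map g (u @ v))" "smaller (2 * i) (u @ v) = 2 * i" "2 * i \<le> length (u @ v)"
proof -
  let ?Z = "set (zip (U @ V) (u @ v))"
  have "length (u @ [x, y] @ v) = length (U @ [f, f] @ V)"
    by (rule compatibleD(1)[OF assms(1)])
  then have len: "length v = length V" using assms(2) by simp
  have Z: "zip (U @ [f, f] @ V) (u @ [x, y] @ v) = zip U u @ [(f, x), (f, y)] @ zip V v"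
    "zip (U @ V) (u @ v) = zip U u @ zip V v"
    using assms(2) by auto
  have c12: "distinct (u @ [x, y] @ v)" "set (u @ [x, y] @ v) = {..<length (U @ V) + 2}"
    using compatibleD(2,3)[OF assms(1)] by auto
  have "set (zip (U @ [f, f] @ V) (u @ [x, y] @ v)) = ?Z \<union> {(f, x), (f, y)}" unfolding Z by auto
  then have all: "\<forall>r \<in> ?Z \<union> {(f, x), (f, y)}. \<forall>s \<in> ?Z \<union> {(f, x), (f, y)}. fst r = fst s \<longleftrightarrow> snd r div 2 = snd s div 2"
    using compatibleD(4)[OF assms(1)] by (simp only:)
  have c3: "a = b \<longleftrightarrow> l div 2 = l' div 2"
    if "(a, l) \<in> ?Z \<union> {(f, x), (f, y)}" "(b, l') \<in> ?Z \<union> {(f, x), (f, y)}" for a l b l'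
    using bspec[OF bspec[OF all that(1)] that(2)] by simp
  note c = c12 c3
  show xy: "x \<noteq> y" using c(1) by auto
  have "x div 2 = y div 2" using c(3)[of f x f y] by simp
  from div2_partner[OF this xy] show m: "min x y = 2 * i" "max x y = 2 * i + 1"
    unfolding i_def by blast+
  have in_Z: "\<exists>a. (a, z) \<in> ?Z" if "z \<in> set (u @ v)" for z
    using that assms(2) len by (metis in_set_impl_in_set_zip2 length_append)
  have ne: "z div 2 \<noteq> i" if z: "z \<in> set (u @ v)" for z
  proof -
    obtain a where a: "(a, z) \<in> ?Z" using in_Z[OF z] by blast
    then have "a \<noteq> f" using assms(3) by (meson set_zip_leftD)
    moreover have "a = f \<longleftrightarrow> z div 2 = x div 2" by (rule c3) (use a in blast)+
    ultimately show ?thesis unfolding i_def by blast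
  qed
  have ne2: "z < 2 * i \<or> 2 * i + 2 \<le> z" if "z \<in> set (u @ v)" for z
    using ne[OF that] by presburger
  show "\<forall>z \<in> set (u @ v). z < min x y \<or> max x y < z"
    unfolding m
  proof
    fix z assume "z \<in> set (u @ v)"
    from ne2[OF this] show "z < 2 * i \<or> 2 * i + 1 < z" by linarith
  qed
  have xyset: "{x, y} = {2 * i, 2 * i + 1}"
    using m by (cases "x \<le> y") (simp_all add: min_def max_def insert_commute)
  have setuv: "set (u @ v) = {..<length (U @ V) + 2} - {2 * i, 2 * i + 1}"
  proof -
    have "set (u @ [x, y] @ v) = set (u @ v) \<union> {x, y}" by auto
    moreover have "set (u @ v) \<inter> {x, y} = {}" using c(1) by auto
    ultimately show ?thesis using c(2) xyset by blast
  qed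
  have "max x y \<in> set (u @ [x, y] @ v)" by (simp add: max_def)
  then have ile: "2 * i + 1 < length (U @ V) + 2"
    unfolding c12(2) m(2) lessThan_iff .
  then show "2 * i \<le> length (u @ v)" using assms(2) len by simp
  have "{..<2 * i} \<subseteq> set (u @ v)" unfolding setuv using ile by auto
  moreover have "distinct (u @ v)" using c12(1) by auto
  ultimately show "smaller (2 * i) (u @ v) = 2 * i" by (rule smaller_distinct[rotated])
  have g_cases: "l < 2 * i \<and> g l = l \<or> 2 * i + 2 \<le> l \<and> l = g l + 2" if "l \<in> set (u @ v)" for l
    using ne2[OF that] unfolding g_def by (cases "l < 2 * i") simp_all
  have inj: "inj_on g (set (u @ v))"
  proof (rule inj_onI)
    fix l l' assume "l \<in> set (u @ v)" "l' \<in> set (u @ v)" "g l = g l'"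
    then show "l = l'" using g_cases[of l] g_cases[of l'] by linarith
  qed
  have img: "g ` set (u @ v) = {..<length (U @ V)}"
  proof (intro equalityI subsetI)
    fix l' assume "l' \<in> g ` set (u @ v)"
    then obtain l where l: "l \<in> set (u @ v)" "l' = g l" by blast
    then have "l < length (U @ V) + 2" unfolding setuv by simp
    then show "l' \<in> {..<length (U @ V)}" using g_cases[OF l(1)] l(2) ile unfolding lessThan_iff by linarith
  next
    fix l assume l: "l \<in> {..<length (U @ V)}"
    show "l \<in> g ` set (u @ v)"
    proof (cases "l < 2 * i")
      case True
      then show ?thesis using l unfolding setuv by (intro image_eqI[of _ _ l]) (simp_all add: g_def)
    next
      case False
      then show ?thesis using l unfolding setuv by (intro image_eqI[of _ _ "l + 2"]) (simp_all add: g_def)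
    qed
  qed
  have gdiv: "g l div 2 = g l' div 2 \<longleftrightarrow> l div 2 = l' div 2" if "l \<in> set (u @ v)" "l' \<in> set (u @ v)" for l l'
  proof -
    have "(l div 2 < i \<and> g l div 2 = l div 2) \<or> (i < l div 2 \<and> l div 2 = Suc (g l div 2))"
      if "l \<in> set (u @ v)" for l
      using g_cases[OF that]
    proof
      assume "2 * i + 2 \<le> l \<and> l = g l + 2"
      then have "2 * i + 2 \<le> l" "l div 2 = (g l + 2) div 2" by simp_all
      then show ?thesis by auto
    qed auto
    from this[OF that(1)] this[OF that(2)] show ?thesis by (intro iffI; elim disjE; linarith)
  qed
  show "compatible (U @ V) (map g (u @ v))"
    unfolding compatible_def
  proof (intro conjI)
    show "length (map g (u @ v)) = length (U @ V)" using assms(2) len by simp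
    show "distinct (map g (u @ v))" using inj c(1) unfolding distinct_map by auto
    show "set (map g (u @ v)) = {..<length (U @ V)}" using img by (simp only: set_map)
    show "\<forall>r\<in>set (zip (U @ V) (map g (u @ v))). \<forall>s\<in>set (zip (U @ V) (map g (u @ v))).
      (fst r = fst s) = (snd r div 2 = snd s div 2)"
    proof (intro ballI)
      fix r s assume "r \<in> set (zip (U @ V) (map g (u @ v)))" "s \<in> set (zip (U @ V) (map g (u @ v)))"
      then obtain a l b m where lm: "(a, l) \<in> ?Z" "r = (a, g l)" "(b, m) \<in> ?Z" "s = (b, g m)"
        unfolding zip_map2 set_map by (elim image_apsndE)
      then have "l \<in> set (u @ v)" "m \<in> set (u @ v)" by (meson set_zip_rightD)+
      then show "(fst r = fst s) = (snd r div 2 = snd s div 2)"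
        using lm c3[of a l b m] gdiv[of l m] by simp
    qed
  qed
qed

lemma set_zip_distinct:
  assumes "distinct w" "(a, l) \<in> set (zip M w)" "(b, l) \<in> set (zip M w)"
  shows "a = b"
  using assms by (auto simp: in_set_zip nth_eq_iff_index_eq)

lemma compatible_cross:
  assumes "compatible (U @ [b, a] @ V) (u @ [y, x] @ v)" "length u = length U"
  shows "compatible (U @ [a, b] @ V) (u @ [x, y] @ v)"
proof -
  note c = compatibleD[OF assms(1)]
  have "set (zip (U @ [a, b] @ V) (u @ [x, y] @ v)) = set (zip (U @ [b, a] @ V) (u @ [y, x] @ v))"
    using assms(2) by auto
  moreover have "set (u @ [x, y] @ v) = set (u @ [y, x] @ v)" by auto
  moreover have "length (u @ [x, y] @ v) = length (U @ [a, b] @ V)" "distinct (u @ [x, y] @ v)"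
    using c(1,2) by auto
  moreover have "length (U @ [a, b] @ V) = length (U @ [b, a] @ V)" by simp
  ultimately show ?thesis unfolding compatible_def using c(3,4) by (simp only: simp_thms)
qed

text \<open>Below a cap that closes an arc, this arc still has two ends. Nothing above the cap
  prescribes its layer; the highest one makes it the last of the \<open>cups\<close>.\<close>

lemma compatible_cap_same:
  assumes "compatible (U @ V) (u @ v)" "length u = length U" "a \<notin> set (U @ V)" "length (U @ V) = 2 * k"
  shows "compatible (U @ [a, a] @ V) (u @ [2 * k, 2 * k + 1] @ v)"
proof -
  note c = compatibleD[OF assms(1)]
  let ?Z = "set (zip (U @ V) (u @ v))"
  have Z: "set (zip (U @ [a, a] @ V) (u @ [2 * k, 2 * k + 1] @ v)) = ?Z \<union> {(a, 2 * k), (a, 2 * k + 1)}"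
    using assms(2) by auto
  have lt: "fst r \<noteq> a \<and> snd r div 2 < k" if "r \<in> ?Z" for r
  proof -
    obtain b l where r: "r = (b, l)" by fastforce
    have "b \<in> set (U @ V)" "l \<in> set (u @ v)"
      using set_zip_leftD[OF that[unfolded r]] set_zip_rightD[OF that[unfolded r]] .
    then have "b \<noteq> a" "l < 2 * k" using assms(3) unfolding c(3) assms(4) by blast+
    then show ?thesis unfolding r by simp
  qed
  show ?thesis
    unfolding compatible_def
  proof (intro conjI)
    show "length (u @ [2 * k, 2 * k + 1] @ v) = length (U @ [a, a] @ V)" using c(1) by simp
    have "set (u @ v) \<inter> {2 * k, 2 * k + 1} = {}" unfolding c(3) assms(4) by simp
    then show "distinct (u @ [2 * k, 2 * k + 1] @ v)" using c(2) by auto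
    have "set (u @ [2 * k, 2 * k + 1] @ v) = set (u @ v) \<union> {2 * k, 2 * k + 1}" by auto
    also have "\<dots> = {..<length (U @ V) + 2}" unfolding c(3) assms(4) by auto
    also have "\<dots> = {..<length (U @ [a, a] @ V)}" by simp
    finally show "set (u @ [2 * k, 2 * k + 1] @ v) = {..<length (U @ [a, a] @ V)}" .
    show "\<forall>r\<in>set (zip (U @ [a, a] @ V) (u @ [2 * k, 2 * k + 1] @ v)).
      \<forall>s\<in>set (zip (U @ [a, a] @ V) (u @ [2 * k, 2 * k + 1] @ v)). (fst r = fst s) = (snd r div 2 = snd s div 2)"
      unfolding Z
    proof (intro ballI)
      fix r s assume rs: "r \<in> ?Z \<union> {(a, 2 * k), (a, 2 * k + 1)}" "s \<in> ?Z \<union> {(a, 2 * k), (a, 2 * k + 1)}"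
      have L: "q \<in> ?Z \<or> fst q = a \<and> snd q div 2 = k" if "q \<in> ?Z \<union> {(a, 2 * k), (a, 2 * k + 1)}" for q
        using that by (elim UnE insertE) simp_all
      from L[OF rs(1)] L[OF rs(2)]
      consider "r \<in> ?Z" "s \<in> ?Z" | "r \<in> ?Z" "fst s = a" "snd s div 2 = k"
        | "fst r = a" "snd r div 2 = k" "s \<in> ?Z" | "fst r = a" "snd r div 2 = k" "fst s = a" "snd s div 2 = k"
        by blast
      then show "(fst r = fst s) = (snd r div 2 = snd s div 2)"
      proof cases
        case 1 then show ?thesis using c(4) by blast
      next
        case 2 then show ?thesis using lt[OF 2(1)] by simp
      next
        case 3 then show ?thesis using lt[OF 3(3)] 3(1,2) by (metis nat_less_le)
      next
        case 4 then show ?thesis by simp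
      qed
    qed
  qed
qed

text \<open>Below the cap the joined arc, in layer \<open>i\<close>, is still two arcs, so its layer
  is doubled. Labels above \<open>2 * i\<close> go up by two, the outer ends get
  \<open>2 * i\<close> and \<open>2 * i + 3\<close>, and the ends at the cap get the two labels
  between. Hence the cap arrives at an odd position and joins neighbouring layers.\<close>

lemma compatible_cap_join:
  assumes "compatible (map (\<lambda>c. if c = b then a else c) (U @ V)) (u @ v)" "length u = length U" "a \<noteq> b"
    "a \<in> set (U @ V)" "b \<in> set (U @ V)"
  obtains g x y i where "compatible (U @ [a, b] @ V) (map g u @ [x, y] @ map g v)"
    "x \<noteq> y" "min x y = 2 * i + 1" "max x y = 2 * i + 2" "strict_mono g"
    "\<forall>z \<in> set (map g (u @ v)). z < 2 * i + 1 \<or> 2 * i + 2 < z"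
    "smaller (2 * i + 1) (map g (u @ v)) = 2 * i + 1" "2 * i + 1 < length (u @ v)"
proof -
  let ?Z = "set (zip (U @ V) (u @ v))" and ?ren = "\<lambda>c. if c = b then a else c"
  note c = compatibleD[OF assms(1)]
  have len: "length (u @ v) = length (U @ V)" using c(1) by simp
  have ren: "?ren d = ?ren d' \<longleftrightarrow> l div 2 = l' div 2" if "(d, l) \<in> ?Z" "(d', l') \<in> ?Z" for d d' l l'
  proof -
    have "(?ren d, l) \<in> set (zip (map ?ren (U @ V)) (u @ v))" "(?ren d', l') \<in> set (zip (map ?ren (U @ V)) (u @ v))"
      using that unfolding zip_map1 set_map by (metis (no_types, lifting) case_prod_conv image_eqI)+
    from bspec[OF bspec[OF c(4) this(1)] this(2)] show ?thesis by (simp only: fst_conv snd_conv)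
  qed
  \<comment> \<open>The labels of the ends of the two arcs that do not meet at the cap.\<close>
  obtain la lb where l: "(a, la) \<in> ?Z" "(b, lb) \<in> ?Z"
    using assms(4,5) len by (metis in_set_impl_in_set_zip1)
  define i where "i = la div 2"
  have div: "lb div 2 = i" using ren[OF l] unfolding i_def by simp
  have "la \<noteq> lb" using set_zip_distinct[OF c(2) l(1)] l(2) assms(3) by blast
  then have lab: "la = 2 * i \<and> lb = 2 * i + 1 \<or> la = 2 * i + 1 \<and> lb = 2 * i"
    using div i_def by presburger
  have la: "l = la" if "(a, l) \<in> ?Z" for l
  proof (rule ccontr)
    assume ne: "l \<noteq> la"
    have "l div 2 = i" using ren[OF that l(1)] unfolding i_def by simp
    then have "l = 2 * i \<or> l = 2 * i + 1" by presburger
    with ne lab have "l = lb" by blast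
    then show False using set_zip_distinct[OF c(2) l(2)] that assms(3) by blast
  qed
  have lb: "l = lb" if "(b, l) \<in> ?Z" for l
  proof (rule ccontr)
    assume ne: "l \<noteq> lb"
    have "l div 2 = i" using ren[OF that l(1)] unfolding i_def by simp
    then have "l = 2 * i \<or> l = 2 * i + 1" by presburger
    with ne lab have "l = la" by blast
    then show False using set_zip_distinct[OF c(2) l(1)] that assms(3) by blast
  qed
  have lo: "l div 2 \<noteq> i" if "(d, l) \<in> ?Z" "d \<noteq> a" "d \<noteq> b" for d l
    using ren[OF that(1) l(1)] that(2) unfolding if_not_P[OF that(3)] if_not_P[OF assms(3)] i_def by blast
  define g where "g l = (if l \<le> 2 * i then l else l + 2)" for l
  \<comment> \<open>Each end at the cap has to share a layer with the other end of its own arc: the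
    arc with the outer label \<open>2 * i\<close> takes \<open>2 * i + 1\<close>.\<close>
  define x where "x = (if la < lb then 2 * i + 1 else 2 * i + 2)"
  define y where "y = (if la < lb then 2 * i + 2 else 2 * i + 1)"
  have xy: "x = 2 * i + 1 \<and> y = 2 * i + 2 \<or> x = 2 * i + 2 \<and> y = 2 * i + 1"
    unfolding x_def y_def by simp
  have gla: "g la div 2 = x div 2" and glb: "g lb div 2 = y div 2"
    using lab unfolding g_def x_def y_def by auto
  have xyi: "x div 2 = i \<and> y div 2 = i + 1 \<or> x div 2 = i + 1 \<and> y div 2 = i"
    using xy by auto
  have gdiv: "l div 2 < i \<and> g l div 2 = l div 2 \<or> i < l div 2 \<and> g l div 2 = l div 2 + 1" if "l div 2 \<noteq> i" for l
  proof (cases "l div 2 < i")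
    case True
    then have "l \<le> 2 * i" by simp
    then show ?thesis using True by (simp add: g_def)
  next
    case False
    then have "i < l div 2" using that by simp
    moreover from this have "\<not> l \<le> 2 * i" by simp
    ultimately show ?thesis by (simp add: g_def)
  qed
  have layer: "d \<noteq> a \<and> d \<noteq> b \<and> g l div 2 \<noteq> i \<and> g l div 2 \<noteq> i + 1 \<or> d = a \<and> g l div 2 = x div 2 \<or> d = b \<and> g l div 2 = y div 2"
    if "(d, l) \<in> ?Z" for d l
  proof -
    consider "d = a" | "d = b" | "d \<noteq> a" "d \<noteq> b" by blast
    then show ?thesis
    proof cases
      case 1 then show ?thesis using la that gla by blast
    next
      case 2 then show ?thesis using lb that glb by blast
    next
      case 3
      from gdiv[OF lo[OF that 3]] have "g l div 2 \<noteq> i \<and> g l div 2 \<noteq> i + 1" by linarith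
      then show ?thesis using 3 by blast
    qed
  qed
  have mem: "la < length (U @ V)" "lb < length (U @ V)"
    using set_zip_rightD[OF l(1)] set_zip_rightD[OF l(2)] unfolding c(3) by simp_all
  then have ile: "2 * i + 1 < length (u @ v)" using lab len by auto
  have mono: "strict_mono g" unfolding g_def by (rule strict_monoI) simp
  have avoid: "\<forall>z \<in> set (map g (u @ v)). z < 2 * i + 1 \<or> 2 * i + 2 < z"
    unfolding set_map g_def by auto
  have setg: "set (map g (u @ v)) = {..<length (U @ V) + 2} - {2 * i + 1, 2 * i + 2}"
    unfolding set_map c(3) length_map
  proof (intro equalityI subsetI)
    fix l assume "l \<in> g ` {..<length (U @ V)}"
    then obtain l' where "l' < length (U @ V)" "l = g l'" by blast
    then show "l \<in> {..<length (U @ V) + 2} - {2 * i + 1, 2 * i + 2}"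
      unfolding g_def by (cases "l' \<le> 2 * i") simp_all
  next
    fix l assume l: "l \<in> {..<length (U @ V) + 2} - {2 * i + 1, 2 * i + 2}"
    show "l \<in> g ` {..<length (U @ V)}"
    proof (cases "l \<le> 2 * i")
      case True
      then show ?thesis using ile len by (intro image_eqI[of _ _ l]) (simp_all add: g_def)
    next
      case False
      then have "l > 2 * i + 2" using l by auto
      then show ?thesis using l by (intro image_eqI[of _ _ "l - 2"]) (auto simp: g_def)
    qed
  qed
  have dist: "distinct (map g (u @ v))"
    using c(2) inj_on_subset[OF strict_mono_imp_inj_on[OF mono] subset_UNIV] unfolding distinct_map by blast
  have sm: "smaller (2 * i + 1) (map g (u @ v)) = 2 * i + 1"
  proof (rule smaller_distinct[OF dist])
    have "{..<2 * i + 1} \<subseteq> {..<length (U @ V) + 2} - {2 * i + 1, 2 * i + 2}"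
      using ile len by auto
    then show "{..<2 * i + 1} \<subseteq> set (map g (u @ v))" unfolding setg .
  qed
  have "compatible (U @ [a, b] @ V) (map g u @ [x, y] @ map g v)"
    unfolding compatible_def
  proof (intro conjI)
    show "length (map g u @ [x, y] @ map g v) = length (U @ [a, b] @ V)" using len by simp
    have xyset: "{x, y} = {2 * i + 1, 2 * i + 2}" using xy by auto
    have sub: "{2 * i + 1, 2 * i + 2} \<subseteq> {..<length (U @ V) + 2}" using ile len by simp
    have "set (map g u @ [x, y] @ map g v) = set (map g (u @ v)) \<union> {x, y}" by auto
    also have "\<dots> = {..<length (U @ V) + 2}"
      unfolding setg xyset Un_Diff_cancel2 by (rule Un_absorb2[OF sub])
    also have "\<dots> = {..<length (U @ [a, b] @ V)}" by simp
    finally show "set (map g u @ [x, y] @ map g v) = {..<length (U @ [a, b] @ V)}" .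
    have "x \<in> {2 * i + 1, 2 * i + 2}" "y \<in> {2 * i + 1, 2 * i + 2}"
      unfolding xyset[symmetric] by (rule insertI1, rule insertI2, rule insertI1)
    then have "x \<notin> set (map g (u @ v))" "y \<notin> set (map g (u @ v))"
      unfolding setg Diff_iff by blast+
    moreover have "x \<noteq> y" using xy by linarith
    ultimately show "distinct (map g u @ [x, y] @ map g v)"
      using dist by (simp add: insert_commute disjoint_iff)
    have "zip (U @ [a, b] @ V) (map g u @ [x, y] @ map g v) = zip U (map g u) @ [(a, x), (b, y)] @ zip V (map g v)"
      using assms(2) by simp
    moreover have "set (zip (U @ V) (map g (u @ v))) = set (zip U (map g u)) \<union> set (zip V (map g v))"
      using assms(2) by simp
    ultimately have "set (zip (U @ [a, b] @ V) (map g u @ [x, y] @ map g v)) = set (zip (U @ V) (map g (u @ v))) \<union> {(a, x), (b, y)}"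
      by (simp only: set_append list.set Un_insert_left Un_insert_right Un_empty_left Un_empty_right)
    then have Z: "set (zip (U @ [a, b] @ V) (map g u @ [x, y] @ map g v)) = (\<lambda>(d, l). (d, g l)) ` ?Z \<union> {(a, x), (b, y)}"
      by (simp only: zip_map2 set_map)
    have L: "(fst r \<noteq> a \<and> fst r \<noteq> b \<and> snd r div 2 \<noteq> i \<and> snd r div 2 \<noteq> i + 1 \<and> r \<in> (\<lambda>(d, l). (d, g l)) ` ?Z)
        \<or> fst r = a \<and> snd r div 2 = x div 2 \<or> fst r = b \<and> snd r div 2 = y div 2"
      if "r \<in> (\<lambda>(d, l). (d, g l)) ` ?Z \<union> {(a, x), (b, y)}" for r
      using that
    proof
      assume "r \<in> (\<lambda>(d, l). (d, g l)) ` ?Z"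
      then obtain d l where r: "(d, l) \<in> ?Z" "r = (d, g l)" by (rule image_apsndE)
      from r(1) have "(d, g l) \<in> (\<lambda>(d, l). (d, g l)) ` ?Z" by (rule rev_image_eqI) simp
      then show ?thesis using layer[OF r(1)] unfolding r(2) fst_conv snd_conv by blast
    qed auto
    show "\<forall>r\<in>set (zip (U @ [a, b] @ V) (map g u @ [x, y] @ map g v)).
      \<forall>s\<in>set (zip (U @ [a, b] @ V) (map g u @ [x, y] @ map g v)). (fst r = fst s) = (snd r div 2 = snd s div 2)"
      unfolding Z
    proof (intro ballI)
      fix r s assume "r \<in> (\<lambda>(d, l). (d, g l)) ` ?Z \<union> {(a, x), (b, y)}" "s \<in> (\<lambda>(d, l). (d, g l)) ` ?Z \<union> {(a, x), (b, y)}"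
      from L[OF this(1)] L[OF this(2)] show "(fst r = fst s) = (snd r div 2 = snd s div 2)"
      proof (elim disjE conjE)
        assume rs: "r \<in> (\<lambda>(d, l). (d, g l)) ` ?Z" "s \<in> (\<lambda>(d, l). (d, g l)) ` ?Z"
          and ne: "fst r \<noteq> a" "fst r \<noteq> b" "fst s \<noteq> a" "fst s \<noteq> b"
        from rs obtain d l d' l' where e: "(d, l) \<in> ?Z" "r = (d, g l)" "(d', l') \<in> ?Z" "s = (d', g l')"
          by (elim image_apsndE)
        note ne = ne[unfolded e fst_conv]
        have "d = d' \<longleftrightarrow> l div 2 = l' div 2" using ren[OF e(1,3)] unfolding if_not_P[OF ne(2)] if_not_P[OF ne(4)] .
        moreover have "g l div 2 = g l' div 2 \<longleftrightarrow> l div 2 = l' div 2"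
          using gdiv[OF lo[OF e(1) ne(1,2)]] gdiv[OF lo[OF e(3) ne(3,4)]]
          by (intro iffI; elim disjE; linarith)
        ultimately show ?thesis unfolding e fst_conv snd_conv by blast
      qed (use xyi assms(3) in \<open>metis n_not_Suc_n Suc_eq_plus1\<close>)+
    qed
  qed
  moreover have "x \<noteq> y" "min x y = 2 * i + 1" "max x y = 2 * i + 2" using xy by auto
  ultimately show thesis using that mono avoid sm ile by blast
qed

section \<open>Unknotting by induction on the slices\<close>

lemma split_two:
  assumes "j + 2 \<le> length w"
  obtains u x y v where "w = u @ [x, y] @ v" "length u = j"
proof
  show "w = take j w @ [w ! j, w ! Suc j] @ drop (Suc (Suc j)) w"
    using assms by (simp add: Cons_nth_drop_Suc)
  show "length (take j w) = j" using assms by simp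
qed

lemma split_at:
  assumes "j \<le> length w"
  obtains u v where "w = u @ v" "length u = j"
  using assms by (metis append_take_drop_id length_take min_absorb2)

lemma count_list_rename:
  "a \<noteq> b \<Longrightarrow> count_list (map (\<lambda>c. if c = b then a else c) w) d =
    (if d = b then 0 else if d = a then count_list w a + count_list w b else count_list w d)"
  by (induction w) auto

text \<open>The circles are the arcs closed so far. The choice \<open>xs'\<close> of crossings may
  depend on the labels \<open>w\<close>.\<close>

definition layable :: "diagram \<Rightarrow> nat \<Rightarrow> nat list \<Rightarrow> bool" where
  "layable xs k w \<longleftrightarrow> (\<exists>xs' n. shadow xs' = shadow xs \<and> tangle_isotopic 0 xs' (circles n @ cups k @ unsort w))"

lemma layable_cup:
  assumes "layable xs k w" "unsort w = unsort (u @ v)" "length (u @ v) = 2 * k"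
    "x \<noteq> y" "min x y = 2 * i" "\<forall>z \<in> set (u @ v). z < min x y \<or> max x y < z"
    "smaller (2 * i) (u @ v) = 2 * i" "2 * i \<le> 2 * k"
  shows "layable (xs @ [(length u, Cup)]) (Suc k) (u @ [x, y] @ v)"
proof -
  obtain xs' n where xs': "shadow xs' = shadow xs" "tangle_isotopic 0 xs' (circles n @ cups k @ unsort (u @ v))"
    using assms(1,2) by (auto simp: layable_def)
  note uv = tangle_unsort[of "u @ v", unfolded assms(3)]
  have cup: "tangle_isotopic (2 * k) (unsort (u @ v) @ [(length u, Cup)]) ((2 * i, Cup) # unsort (u @ [x, y] @ v))"
    using unsort_cup[OF assms(4,6)] unfolding assms(3,5,7) .
  have len: "length (u @ [x, y] @ v) = 2 * Suc k" using assms(3) by simp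
  note uxyv = tangle_unsort[of "u @ [x, y] @ v", unfolded len]
  have j: "length u \<le> 2 * k" using assms(3) by simp
  have "tangle_isotopic 0 (xs' @ [(length u, Cup)]) ((circles n @ cups k @ unsort (u @ v)) @ [(length u, Cup)])"
    by (rule tangle_replace[OF xs'(2), where xs = "[]" and ys = "[(length u, Cup)]"])
      (use tangle_isotopic_wf[OF xs'(2)] uv j in simp_all)
  also have "\<dots> = (circles n @ cups k) @ (unsort (u @ v) @ [(length u, Cup)])" by simp
  also have "tangle_isotopic 0 \<dots> ((circles n @ cups k) @ ((2 * i, Cup) # unsort (u @ [x, y] @ v)))"
    by (rule tangle_replace[OF cup, where xs = "circles n @ cups k" and ys = "[]"]) simp_all
  also have "\<dots> = circles n @ (cups k @ [(2 * i, Cup)]) @ unsort (u @ [x, y] @ v)" by simp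
  also have "tangle_isotopic 0 \<dots> (circles n @ cups (Suc k) @ unsort (u @ [x, y] @ v))"
    by (rule tangle_replace[OF cups_cup, where xs = "circles n" and ys = "unsort (u @ [x, y] @ v)"])
      (use assms(8) uxyv in simp_all)
  finally have "tangle_isotopic 0 (xs' @ [(length u, Cup)]) (circles n @ cups (Suc k) @ unsort (u @ [x, y] @ v))" .
  moreover have "shadow (xs' @ [(length u, Cup)]) = shadow (xs @ [(length u, Cup)])" using xs'(1) by simp
  ultimately show ?thesis unfolding layable_def by blast
qed

text \<open>The even value of \<open>m\<close> closes the last arc to a circle, an odd value joins
  two neighbouring arcs.\<close>

lemma layable_cap:
  assumes "layable xs (Suc k) (u @ [x, y] @ v)" "unsort w = unsort (u @ v)" "length (u @ v) = 2 * k"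
    "x \<noteq> y" "min x y = m" "\<forall>z \<in> set (u @ v). z < min x y \<or> max x y < z" "smaller m (u @ v) = m"
    "m = 2 * k \<or> (\<exists>i < k. m = 2 * i + 1)"
  shows "layable (xs @ [(length u, Cap)]) k w"
proof -
  obtain xs' n where xs': "shadow xs' = shadow xs"
    "tangle_isotopic 0 xs' (circles n @ cups (Suc k) @ unsort (u @ [x, y] @ v))"
    using assms(1) by (auto simp: layable_def)
  note uv = tangle_unsort[of "u @ v", unfolded assms(3)]
  have len: "length (u @ [x, y] @ v) = 2 * Suc k" using assms(3) by simp
  note uxyv = tangle_unsort[of "u @ [x, y] @ v", unfolded len]
  have cap: "tangle_isotopic (2 * Suc k) (unsort (u @ [x, y] @ v) @ [(length u, Cap)]) ((m, Cap) # unsort (u @ v))"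
    using unsort_cap[OF assms(4,6)] unfolding len assms(5,7) .
  have j: "length u \<le> 2 * k" using assms(3) by simp
  have "tangle_isotopic 0 (xs' @ [(length u, Cap)])
      ((circles n @ cups (Suc k) @ unsort (u @ [x, y] @ v)) @ [(length u, Cap)])"
    by (rule tangle_replace[OF xs'(2), where xs = "[]" and ys = "[(length u, Cap)]"])
      (use tangle_isotopic_wf[OF xs'(2)] uxyv j in simp_all)
  also have "\<dots> = (circles n @ cups (Suc k)) @ (unsort (u @ [x, y] @ v) @ [(length u, Cap)])" by simp
  also have "tangle_isotopic 0 \<dots> ((circles n @ cups (Suc k)) @ ((m, Cap) # unsort (u @ v)))"
    by (rule tangle_replace[OF cap, where xs = "circles n @ cups (Suc k)" and ys = "[]"]) simp_all
  finally have 1: "tangle_isotopic 0 (xs' @ [(length u, Cap)]) (circles n @ (cups (Suc k) @ [(m, Cap)]) @ unsort (u @ v))"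
    by simp
  have 2: "shadow (xs' @ [(length u, Cap)]) = shadow (xs @ [(length u, Cap)])" using xs'(1) by simp
  from assms(8) show ?thesis
  proof
    assume m: "m = 2 * k"
    note 1
    also have "circles n @ (cups (Suc k) @ [(m, Cap)]) @ unsort (u @ v) =
        (circles n @ cups k @ [(2 * k, Cup), (2 * k, Cap)]) @ unsort (u @ v)"
      by (simp add: cups_Suc m)
    also have "tangle_isotopic 0 \<dots> ((circles (Suc n) @ cups k) @ unsort (u @ v))"
      by (rule tangle_replace[OF cups_circle, where xs = "[]" and ys = "unsort (u @ v)"]) (use uv in simp_all)
    finally show ?thesis using 2 unfolding layable_def assms(2) append_assoc by blast
  next
    assume "\<exists>i<k. m = 2 * i + 1"
    then obtain i where i: "i < k" "m = 2 * i + 1" by blast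
    note 1
    also have "tangle_isotopic 0 (circles n @ (cups (Suc k) @ [(m, Cap)]) @ unsort (u @ v)) (circles n @ cups k @ unsort (u @ v))"
      by (rule tangle_replace[OF cups_cap[OF i(1)], where xs = "circles n" and ys = "unsort (u @ v)"]) (use uv i in simp_all)
    finally show ?thesis using 2 unfolding layable_def assms(2) by blast
  qed
qed

text \<open>Here crossings get changed: the labels dictate the type, whatever \<open>c\<close>
  is.\<close>

lemma layable_cross:
  assumes "layable xs k (u @ [x, y] @ v)" "length (u @ [x, y] @ v) = 2 * k" "x \<noteq> y"
  shows "layable (xs @ [(length u, Cross c)]) k (u @ [y, x] @ v)"
proof -
  obtain xs' n where xs': "shadow xs' = shadow xs"
    "tangle_isotopic 0 xs' (circles n @ cups k @ unsort (u @ [x, y] @ v))"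
    using assms(1) by (auto simp: layable_def)
  note uv = tangle_unsort[of "u @ [x, y] @ v", unfolded assms(2)]
  let ?s = "(length u, Cross (if x < y then Pos else Neg))"
  have cross: "tangle_isotopic (2 * k) (unsort (u @ [x, y] @ v) @ [?s]) (unsort (u @ [y, x] @ v))"
    using unsort_cross[OF assms(3), of u v] unfolding assms(2) .
  have j: "length u + 2 \<le> 2 * k" using assms(2) by simp
  have "tangle_isotopic 0 (xs' @ [?s]) ((circles n @ cups k @ unsort (u @ [x, y] @ v)) @ [?s])"
    by (rule tangle_replace[OF xs'(2), where xs = "[]" and ys = "[?s]"])
      (use tangle_isotopic_wf[OF xs'(2)] uv j in simp_all)
  also have "\<dots> = (circles n @ cups k) @ (unsort (u @ [x, y] @ v) @ [?s])" by simp
  also have "tangle_isotopic 0 \<dots> ((circles n @ cups k) @ unsort (u @ [y, x] @ v))"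
    by (rule tangle_replace[OF cross, where xs = "circles n @ cups k" and ys = "[]"]) simp_all
  finally have "tangle_isotopic 0 (xs' @ [?s]) (circles n @ cups k @ unsort (u @ [y, x] @ v))" by simp
  moreover have "shadow (xs' @ [?s]) = shadow (xs @ [(length u, Cross c)])" using xs'(1) by simp
  ultimately show ?thesis unfolding layable_def by blast
qed

text \<open>The layers wanted above a slice determine those needed below it, so the induction
  hypothesis must offer every compatible \<open>w\<close>. One fixed order would fail at a cap
  joining two arcs that are not neighbours. As arcs have two ends, each name occurs twice in
  \<open>M\<close>.\<close>

lemma descending_tangle:
  assumes "tangle 0 xs"
  shows "\<exists>M k. length M = 2 * k \<and> upper 0 xs = 2 * k \<and> (\<forall>a \<in> set M. count_list M a = 2) \<and>
    (\<forall>w. compatible M w \<longrightarrow> layable xs k w)"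
  using assms
proof (induction xs rule: rev_induct)
  case Nil
  have "layable [] 0 []"
    unfolding layable_def
    by (rule exI[of _ "[]"], rule exI[of _ 0]) (simp add: circles_def cups_def tangle_isotopic.refl)
  then show ?case by (intro exI[of _ "[]"] exI[of _ 0]) (simp add: compatible_def)
next
  case (snoc s xs)
  obtain j p where s: "s = (j, p)" by fastforce
  have "tangle 0 xs" using snoc.prems by simp
  from snoc.IH[OF this] obtain M0 k where IH: "length M0 = 2 * k" "upper 0 xs = 2 * k"
    "\<forall>a \<in> set M0. count_list M0 a = 2" "\<And>w. compatible M0 w \<Longrightarrow> layable xs k w" by blast
  have jp: "j + ins p \<le> 2 * k" using snoc.prems s IH(2) by simp
  show ?case
  proof (cases p)
    case Cup
    then have "j \<le> length M0" using jp IH(1) by simp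
    then obtain U V where M0: "M0 = U @ V" "length U = j" by (rule split_at)
    obtain f where f: "f \<notin> set M0" using ex_new_if_finite[of "set M0"] infinite_UNIV_nat by blast
    have count: "\<forall>a \<in> set (U @ [f, f] @ V). count_list (U @ [f, f] @ V) a = 2"
    proof
      fix a assume a: "a \<in> set (U @ [f, f] @ V)"
      show "count_list (U @ [f, f] @ V) a = 2"
      proof (cases "a = f")
        case True
        then show ?thesis using f M0(1) by (simp add: count_notin)
      next
        case False
        then have "a \<in> set M0" using a M0(1) by auto
        then show ?thesis using IH(3) False M0(1) by simp
      qed
    qed
    have "layable (xs @ [s]) (Suc k) w" if w: "compatible (U @ [f, f] @ V) w" for w
    proof -
      have "length w = length (U @ [f, f] @ V)" using compatibleD(1)[OF w] .
      then have "j + 2 \<le> length w" using M0(2) by simp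
      then obtain u x y v where wu: "w = u @ [x, y] @ v" "length u = j" by (rule split_two)
      note C = compatible_cup[OF w[unfolded wu(1)] wu(2)[folded M0(2)] f[unfolded M0(1)]]
      have len: "length (u @ v) = 2 * k"
        using compatibleD(1)[OF C(5)] IH(1) M0(1) by simp
      define i where "i = x div 2"
      have lt: "z < 2 * i \<or> 2 * i + 1 < z" if "z \<in> set (u @ v)" for z
        using bspec[OF C(4) that] unfolding C(2,3) i_def .
      have "unsort (map (\<lambda>l. if l < 2 * i then l else l - 2) (u @ v)) = unsort (u @ v)"
      proof (rule unsort_map)
        fix z z' assume "z \<in> set (u @ v)" "z' \<in> set (u @ v)"
        from lt[OF this(1)] lt[OF this(2)]
        show "((if z < 2 * i then z else z - 2) < (if z' < 2 * i then z' else z' - 2)) = (z < z')"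
          by (elim disjE) (simp_all, arith)
      qed
      then have "layable (xs @ [(length u, Cup)]) (Suc k) (u @ [x, y] @ v)"
        using C(7) unfolding len
        by (intro layable_cup[OF IH(4)[OF C(5)[folded M0(1)]] _ len C(1,2,4,6)]) (simp_all add: i_def)
      then show ?thesis unfolding s Cup wu .
    qed
    then show ?thesis
      using count IH(1,2) M0(1) s Cup
      by (intro exI[of _ "U @ [f, f] @ V"] exI[of _ "Suc k"]) simp
  next
    case Cap
    then obtain k' where k: "k = Suc k'" using jp by (cases k) auto
    have "j + 2 \<le> length M0" using jp IH(1) Cap by simp
    then obtain U a b V where M0: "M0 = U @ [a, b] @ V" "length U = j" by (rule split_two)
    have lenUV: "length (U @ V) = 2 * k'" using IH(1) M0(1) k by simp
    have upper: "upper 0 (xs @ [s]) = 2 * k'" using IH(2) k s Cap by simp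
    show ?thesis
    proof (cases "a = b")
      case True
      \<comment> \<open>Both ends of the arc are at the cap, so its name disappears above.\<close>
      have "count_list (U @ V) a = 0" using IH(3) M0(1) True by simp
      then have a: "a \<notin> set (U @ V)" by (metis count_list_0_iff)
      have count: "\<forall>d \<in> set (U @ V). count_list (U @ V) d = 2"
      proof
        fix d assume d: "d \<in> set (U @ V)"
        then have "d \<noteq> a" using a by blast
        moreover have "count_list M0 d = 2" using IH(3) d M0(1) by simp
        ultimately show "count_list (U @ V) d = 2" using M0(1) True by simp
      qed
      have "layable (xs @ [s]) k' w" if w: "compatible (U @ V) w" for w
      proof -
        have len: "length w = 2 * k'" using compatibleD(1)[OF w] lenUV by simp
        then have "j \<le> length w" using lenUV M0(2) by simp
        then obtain u v where wu: "w = u @ v" "length u = j" by (rule split_at)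
        note D = compatibleD[OF w, unfolded lenUV]
        have lt: "\<forall>z\<in>set (u @ v). z < min (2 * k') (2 * k' + 1) \<or> max (2 * k') (2 * k' + 1) < z"
          using D(3) unfolding wu(1) by simp
        have sm: "smaller (2 * k') (u @ v) = 2 * k'"
          using smaller_distinct[OF D(2), of "2 * k'"] D(3) unfolding wu(1) by simp
        have "compatible M0 (u @ [2 * k', 2 * k' + 1] @ v)"
          using compatible_cap_same[OF w[unfolded wu(1)] wu(2)[folded M0(2)] a lenUV] unfolding M0(1) True .
        then have "layable xs (Suc k') (u @ [2 * k', 2 * k' + 1] @ v)" using IH(4) k by simp
        then have "layable (xs @ [(length u, Cap)]) k' w"
          by (rule layable_cap[where m = "2 * k'"]) (use lt sm len wu(1) in simp_all)
        then show ?thesis unfolding s Cap wu(2) .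
      qed
      then show ?thesis
        using count lenUV upper by (intro exI[of _ "U @ V"] exI[of _ "k'"]) blast
    next
      case False
      have ab: "a \<in> set (U @ V)" "b \<in> set (U @ V)" "count_list (U @ V) a = 1" "count_list (U @ V) b = 1"
      proof -
        have "count_list M0 a = 2" "count_list M0 b = 2" using IH(3) M0(1) by simp_all
        then show "count_list (U @ V) a = 1" "count_list (U @ V) b = 1" using M0(1) False by simp_all
        then show "a \<in> set (U @ V)" "b \<in> set (U @ V)" by (metis count_list_0_iff zero_neq_one)+
      qed
      \<comment> \<open>Two arcs become one, which keeps the name \<open>a\<close>.\<close>
      let ?M = "map (\<lambda>c. if c = b then a else c) (U @ V)"
      have count: "\<forall>d \<in> set ?M. count_list ?M d = 2"
      proof
        fix d assume d: "d \<in> set ?M"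
        then have db: "d \<noteq> b" using False by auto
        show "count_list ?M d = 2"
        proof (cases "d = a")
          case True
          then show ?thesis unfolding count_list_rename[OF False] using False ab(3,4) by simp
        next
          case da: False
          have "d \<in> set (U @ V)" using d da by auto
          then have "count_list M0 d = 2" using IH(3) M0(1) by simp
          then show ?thesis unfolding count_list_rename[OF False] using da db M0(1) by simp
        qed
      qed
      have "layable (xs @ [s]) k' w" if w: "compatible ?M w" for w
      proof -
        have len: "length w = 2 * k'" using compatibleD(1)[OF w] lenUV by simp
        then have "j \<le> length w" using lenUV M0(2) by simp
        then obtain u v where wu: "w = u @ v" "length u = j" by (rule split_at)
        obtain g x y i where J: "compatible (U @ [a, b] @ V) (map g u @ [x, y] @ map g v)"
          "x \<noteq> y" "min x y = 2 * i + 1" "max x y = 2 * i + 2" "strict_mono g"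
          "\<forall>z \<in> set (map g (u @ v)). z < 2 * i + 1 \<or> 2 * i + 2 < z"
          "smaller (2 * i + 1) (map g (u @ v)) = 2 * i + 1" "2 * i + 1 < length (u @ v)"
          by (rule compatible_cap_join[OF w[unfolded wu(1)] wu(2)[folded M0(2)] False ab(1,2)])
        have lt: "\<forall>z\<in>set (map g u @ map g v). z < min x y \<or> max x y < z"
          using J(6) unfolding J(3,4) by (simp only: map_append)
        have un: "unsort w = unsort (map g u @ map g v)"
          unfolding wu(1) map_append[symmetric]
          by (rule unsort_map[symmetric]) (rule strict_mono_less[OF J(5)])
        have i: "i < k'" using J(8) len wu(1) by simp
        have "layable xs (Suc k') (map g u @ [x, y] @ map g v)" using IH(4) J(1) M0(1) k by simp
        then have "layable (xs @ [(length (map g u), Cap)]) k' w"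
          by (rule layable_cap[where m = "2 * i + 1", OF _ un _ J(2,3) lt])
            (use J(7) i len wu(1) in simp_all)
        then show ?thesis unfolding s Cap length_map wu(2) .
      qed
      then show ?thesis
        using count lenUV upper by (intro exI[of _ ?M] exI[of _ "k'"]) (simp only: length_map, blast)
    qed
  next
    case (Cross c)
    have "j + 2 \<le> length M0" using jp IH(1) Cross by simp
    then obtain U a b V where M0: "M0 = U @ [a, b] @ V" "length U = j" by (rule split_two)
    let ?M = "U @ [b, a] @ V"
    have count: "\<forall>d \<in> set ?M. count_list ?M d = 2"
    proof
      fix d assume "d \<in> set ?M"
      then have "d \<in> set M0" using M0(1) by auto
      then have "count_list M0 d = 2" using IH(3) by blast
      moreover have "count_list ?M d = count_list M0 d" unfolding M0(1) by simp
      ultimately show "count_list ?M d = 2" by simp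
    qed
    have len: "length ?M = 2 * k" using IH(1) M0(1) by simp
    have "layable (xs @ [s]) k w" if w: "compatible ?M w" for w
    proof -
      have lw: "length w = 2 * k" using compatibleD(1)[OF w] len by simp
      then have "j + 2 \<le> length w" using jp Cross by simp
      then obtain u y x v where wu: "w = u @ [y, x] @ v" "length u = j" by (rule split_two)
      have "x \<noteq> y" using compatibleD(2)[OF w] unfolding wu(1) by auto
      have "layable xs k (u @ [x, y] @ v)"
        using IH(4) compatible_cross[OF w[unfolded wu(1)] wu(2)[folded M0(2)]] M0(1) by simp
      then have "layable (xs @ [(length u, Cross c)]) k (u @ [y, x] @ v)"
        by (rule layable_cross) (use lw wu(1) \<open>x \<noteq> y\<close> in simp_all)
      then show ?thesis unfolding s Cross wu .
    qed
    moreover have "upper 0 (xs @ [s]) = 2 * k" using IH(2) s Cross jp by simp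
    ultimately show ?thesis
      using count len by (intro exI[of _ ?M] exI[of _ k]) blast
  qed
qed

lemma unknotting:
  assumes "link_diagram D"
  obtains D' n where "shadow D' = shadow D" "isotopic D' (circles n)" "link_diagram (circles n)"
proof -
  have D: "tangle 0 D" "upper 0 D = 0" using assms by (auto simp: link_diagram_iff_tangle)
  obtain M k where M: "length M = 2 * k" "upper 0 D = 2 * k" "\<And>w. compatible M w \<Longrightarrow> layable D k w"
    using descending_tangle[OF D(1)] by blast
  then have "M = []" "k = 0" using D(2) by auto
  then have "layable D 0 []" using M(3)[of "[]"] by (simp add: compatible_def)
  then obtain D' n where D': "shadow D' = shadow D" "tangle_isotopic 0 D' (circles n)"
    by (auto simp: layable_def cups_def)
  have "link_diagram D'" using shadow_link_diagram[OF D'(1)] assms by simp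
  then show thesis using that[OF D'(1)] tangle_isotopic_imp_isotopic[OF D'(2)] by blast
qed

section \<open>Induction over skein relations\<close>

definition crossings :: "diagram \<Rightarrow> nat" where
  "crossings D = length (filter (\<lambda>s. shadow_piece (snd s) = Cross Pos) D)"

lemma crossings_simps [simp]:
  "crossings (a @ b) = crossings a + crossings b"
  "crossings ((k, Cross c) # b) = Suc (crossings b)"
  "crossings ((k, Cup) # b) = crossings b"
  "crossings ((k, Cap) # b) = crossings b"
  by (auto simp: crossings_def)

lemma crossings_shadow: "shadow D = shadow D' \<Longrightarrow> crossings D = crossings D'"
proof -
  have "crossings D = length (filter (\<lambda>s. snd s = Cross Pos) (shadow D))" for D
    by (induction D) (auto simp: crossings_def)
  then show "shadow D = shadow D' \<Longrightarrow> crossings D = crossings D'" by simp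
qed

text \<open>The outer induction, on the number of crossings, provides both smoothings. The inner
  one, on the number of slices that differ from \<open>D'\<close>, changes one crossing at a time;
  \<open>step\<close> is an equivalence because the change may go in either direction. The crossings
  that may be changed are given by \<open>ok\<close>, which depends only on the shadow and so
  survives these changes.\<close>

lemma skein_induct:
  assumes ok: "\<And>D D' h. shadow D = shadow D' \<Longrightarrow> ok D h \<Longrightarrow> ok D' h"
    and base: "\<And>D. link_diagram D \<Longrightarrow>
      \<exists>D'. shadow D' = shadow D \<and> P D' \<and> (\<forall>h < length D. D' ! h \<noteq> D ! h \<longrightarrow> ok D h)"
    and step: "\<And>h Lp Lm L0 Li. conway_quadruple h Lp Lm L0 Li \<Longrightarrow> ok Lp h \<Longrightarrow> P L0 \<Longrightarrow> P Li \<Longrightarrow>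
      P Lp \<longleftrightarrow> P Lm"
    and "link_diagram D"
  shows "P D"
  using \<open>link_diagram D\<close>
proof (induction "crossings D" arbitrary: D rule: less_induct)
  case (less D)
  obtain D' where D': "shadow D' = shadow D" "P D'" "\<And>h. h < length D \<Longrightarrow> D' ! h \<noteq> D ! h \<Longrightarrow> ok D h"
    using base[OF less.prems] by blast
  have "P D2" if "shadow D2 = shadow D" "\<And>h. h < length D \<Longrightarrow> D' ! h \<noteq> D2 ! h \<Longrightarrow> ok D h" for D2
    using that
  proof (induction "card {h. h < length D \<and> D' ! h \<noteq> D2 ! h}" arbitrary: D2 rule: less_induct)
    case (less D2)
    note inner = less
    have len: "length D2 = length D" "length D' = length D"
      using shadow_length[OF inner(2)] shadow_length[OF D'(1)] by auto
    show ?case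
    proof (cases "D2 = D'")
      case True
      then show ?thesis using D'(2) by simp
    next
      case False
      then obtain h where h: "h < length D" "D' ! h \<noteq> D2 ! h"
        using len nth_equalityI[of D2 D'] by metis
      obtain k p where s: "D2 ! h = (k, p)" by fastforce
      have "shadow D2 = shadow D'" using inner(2) D'(1) by simp
      then obtain p' where s': "D' ! h = (k, p')" "shadow_piece p' = shadow_piece p"
        by (rule shadow_nth[OF _ _ s]) (use h len in auto)
      then have "p' \<noteq> p" using h s by auto
      then obtain c c' where c: "p = Cross c" "p' = Cross c'" "c \<noteq> c'"
        using s'(2) by (cases p; cases p') auto
      define xs where "xs = take h D2"
      define ys where "ys = drop (Suc h) D2"
      have D2: "D2 = xs @ [(k, Cross c)] @ ys" and xs: "length xs = h"
        using id_take_nth_drop[of h D2] h(1) len s c by (auto simp: xs_def ys_def)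
      let ?D3 = "xs @ [(k, Cross c')] @ ys" and ?L0 = "xs @ [(k, Cap), (k, Cup)] @ ys"
      have nth3: "?D3 ! l = (if l = h then D' ! h else D2 ! l)" for l
        unfolding D2 using xs s'(1) c(2) by (simp add: nth_append nth_Cons')
      have sh3: "shadow ?D3 = shadow D" using inner(2) unfolding D2 by simp
      have "{l. l < length D \<and> D' ! l \<noteq> ?D3 ! l} \<subset> {l. l < length D \<and> D' ! l \<noteq> D2 ! l}"
        unfolding nth3 using h by auto
      then have "card {l. l < length D \<and> D' ! l \<noteq> ?D3 ! l} < card {l. l < length D \<and> D' ! l \<noteq> D2 ! l}"
        by (intro psubset_card_mono) auto
      moreover have "ok D l" if "l < length D" "D' ! l \<noteq> ?D3 ! l" for l
        using that inner(3)[of l] unfolding nth3 by (auto split: if_splits)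
      ultimately have P3: "P ?D3" using inner(1)[of ?D3] sh3 by blast
      have link: "link_diagram D2" "link_diagram ?D3"
        using shadow_link_diagram[OF inner(2)] shadow_link_diagram[OF sh3] \<open>link_diagram D\<close> by auto
      have t: "tangle 0 xs" "k + 2 \<le> upper 0 xs" "tangle (upper 0 xs) ys" "upper (upper 0 xs) ys = 0"
        using link(1) unfolding D2 link_diagram_iff_tangle by auto
      \<comment> \<open>Two strands arrive at the crossing, so something lies below it and the
        smoothings are not empty.\<close>
      then have "xs \<noteq> []" by auto
      then have link': "link_diagram ?L0" "link_diagram (xs @ ys)"
        using t le_add_diff_inverse2[of 2 "upper 0 xs"] by (auto simp: link_diagram_iff_tangle)
      have "crossings D = Suc (crossings xs + crossings ys)"
        using crossings_shadow[OF inner(2)] unfolding D2 by simp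
      then have P0: "P ?L0" "P (xs @ ys)"
        using \<open>\<And>Da. crossings Da < crossings D \<Longrightarrow> link_diagram Da \<Longrightarrow> P Da\<close> link' by auto
      have ok': "ok D2 h" "ok ?D3 h"
        using ok[OF inner(2)[symmetric]] ok[OF sh3[symmetric]] inner(3)[OF h] by auto
      show ?thesis
      proof (cases c)
        case Pos
        then have "c' = Neg" using c(3) by (cases c') auto
        then have "conway_quadruple h D2 ?D3 ?L0 (xs @ ys)"
          unfolding conway_quadruple_def using link link' xs D2 Pos by blast
        then show ?thesis using step[OF _ ok'(1) P0] P3 by blast
      next
        case Neg
        then have "c' = Pos" using c(3) by (cases c') auto
        then have "conway_quadruple h ?D3 D2 ?L0 (xs @ ys)"
          unfolding conway_quadruple_def using link link' xs D2 Neg by blast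
        then show ?thesis using step[OF _ ok'(2) P0] P3 by blast
      qed
    qed
  qed
  from this[of D] D'(3) show ?case by blast
qed


section \<open>Monomial substitutions\<close>

lemma frag_cmul_eq_of_int: "frag_cmul c x = of_int c * x" for x :: laurent
proof -
  have nat: "frag_cmul (int n) x = of_nat n * x" for n
    by (induction n) (simp_all add: frag_cmul_distrib distrib_right)
  show ?thesis
  proof (cases "0 \<le> c")
    case True
    then show ?thesis using nat[of "nat c"] by simp
  next
    case False
    have "frag_cmul c x = - frag_cmul (int (nat (- c))) x" using False by simp
    then show ?thesis unfolding nat using False by simp
  qed
qed

lemma frag_of_mult: "frag_of a * frag_of b = frag_of (a + b)" for a b :: "'a::comm_monoid_add"
  by (simp add: mult_single)

lemma frag_of_zero [simp]: "frag_of (0 :: 'a::comm_monoid_add) = 1"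
  by (fact single_one)

lemma unit_inv_frag_of: "unit_inv (frag_of m) = frag_of (- m)"
  unfolding unit_inv_def
proof (rule the_equality)
  show inv: "frag_of m * frag_of (- m) = (1 :: laurent)" by (simp add: frag_of_mult)
  fix y :: laurent assume "frag_of m * y = 1"
  then have "frag_of (- m) * (frag_of m * y) = frag_of (- m)" by simp
  then show "y = frag_of (- m)"
    using inv by (metis mult.assoc mult.commute mult.left_neutral)
qed

lemma frag_of_power: "frag_of m ^ n = (frag_of (frag_cmul (int n) m) :: laurent)"
  by (induction n) (simp_all add: frag_of_mult frag_cmul_distrib)

lemma unit_powi_frag_of: "unit_powi (frag_of m) i = (frag_of (frag_cmul i m) :: laurent)"
  by (auto simp: unit_powi_def unit_inv_frag_of frag_of_power
      simp flip: frag_cmul_minus_one)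

lemma prod_frag_of: "finite A \<Longrightarrow> (\<Prod>v\<in>A. frag_of (f v)) = (frag_of (\<Sum>v\<in>A. f v) :: laurent)"
  by (induction A rule: finite_induct) (simp_all add: frag_of_mult)

text \<open>Laurent polynomials form the free abelian group on the exponent vectors, and these form
  the free abelian group on the indeterminates. A monomial substitution is linear extension on both
  levels.\<close>

lemma substitute_monomials:
  assumes "\<And>v. s v = frag_of (e v)"
  shows "substitute s p = frag_extend (frag_of \<circ> frag_extend e) p"
  unfolding substitute_def frag_extend_def assms unit_powi_frag_of
  by (simp add: frag_cmul_eq_of_int prod_frag_of)

text \<open>A monomial as one factor is enough here: the coefficients of the skein relations and the
  powers of $E$ are monomials.\<close>

lemma frag_extend_mult:
  fixes T :: "'a::comm_monoid_add \<Rightarrow> 'b::comm_monoid_add"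
  assumes "\<And>a b. T (a + b) = T a + T b"
  shows "frag_extend (frag_of \<circ> T) (frag_of m * p) = frag_of (T m) * frag_extend (frag_of \<circ> T) p"
  using subset_UNIV
proof (induction p rule: frag_induction)
  case (one x)
  then show ?case by (simp add: frag_of_mult assms)
next
  case (diff a b)
  then show ?case by (simp add: frag_extend_diff right_diff_distrib)
qed simp

lemma var_eq: "var v = frag_of (frag_of v)"
  by (simp add: var_def)

text \<open>\<open>E_part\<close> specialises $z$, $w$ and $a$ to 1.\<close>

definition E_part :: "laurent \<Rightarrow> int \<Rightarrow>\<^sub>0 int" where
  "E_part = frag_extend (frag_of \<circ> (\<lambda>m. Poly_Mapping.lookup m IE))"

lemma E_part_simps:
  "E_part (p + q) = E_part p + E_part q"
  "E_part (frag_of m * p) = frag_of (Poly_Mapping.lookup m IE) * E_part p"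
  "E_part 1 = 1"
proof -
  show "E_part (p + q) = E_part p + E_part q" by (simp add: E_part_def frag_extend_add)
  show "E_part (frag_of m * p) = frag_of (Poly_Mapping.lookup m IE) * E_part p"
    unfolding E_part_def by (rule frag_extend_mult) (simp add: lookup_add)
  show "E_part 1 = 1"
    unfolding E_part_def single_one[symmetric] frag_extend_of by simp
qed

lemma lookup_frag_of_mult: "Poly_Mapping.lookup (frag_of i * p) j = Poly_Mapping.lookup p (j - i)"
  for p :: "int \<Rightarrow>\<^sub>0 int"
  using subset_UNIV
proof (induction p rule: frag_induction)
  case (one x)
  then show ?case by (auto simp: frag_of_mult)
next
  case (diff a b)
  then show ?case by (simp add: right_diff_distrib lookup_minus)
qed simp

text \<open>A monomial factor free of $E$ specialises to 1.\<close>

lemma E_part_conway: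
  assumes "p + q = frag_of m * (r + s)" "Poly_Mapping.lookup m IE = 0"
  shows "Poly_Mapping.lookup (E_part p) j + Poly_Mapping.lookup (E_part q) j =
    Poly_Mapping.lookup (E_part r) j + Poly_Mapping.lookup (E_part s) j"
proof -
  have "E_part p + E_part q = E_part r + E_part s"
    using arg_cong[OF assms(1), of E_part] assms(2) by (simp add: E_part_simps)
  then show ?thesis by (metis lookup_add)
qed


section \<open>The Kauffman polynomial modulo 2 at $a = w = 1$\<close>

text \<open>At a = 1 a curl costs nothing, so the specialised value is invariant under isotopy and
  \<open>unknotting\<close> reduces the claim to circles. If both smoothings have odd values, their
  sum is even, and changing the crossing preserves the parity.\<close>

lemma odd_kauffman_Q:
  assumes "kauffman_Q Q" "link_diagram D"
  shows "odd (Poly_Mapping.lookup (E_part (Q D)) 0)"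
proof -
  let ?P = "\<lambda>D. odd (Poly_Mapping.lookup (E_part (Q D)) 0)"
  have inv: "regular_isotopy_invariant Q"
    and skein: "\<And>h Lp Lm L0 Li. conway_quadruple h Lp Lm L0 Li \<Longrightarrow> Q Lp + Q Lm = var Iw * (Q L0 + Q Li)"
    and curl: "\<And>s k xs u ys. curl s k u \<Longrightarrow> link_diagram (xs @ u @ ys) \<Longrightarrow> link_diagram (xs @ ys) \<Longrightarrow>
        Q (xs @ u @ ys) = unit_powi (var Ia) s * Q (xs @ ys)"
    and unknot: "Q [(0, Cup), (0, Cap)] = 1"
    using assms(1) unfolding kauffman_Q_def by blast+
  have E_curl: "E_part (Q (xs @ u @ ys)) = E_part (Q (xs @ ys))"
    if "curl s k u" "link_diagram (xs @ u @ ys)" "link_diagram (xs @ ys)" for s k xs u ys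
    unfolding curl[OF that] var_eq unit_powi_frag_of by (simp add: E_part_simps)
  have E_move: "E_part (Q D) = E_part (Q D')"
    if D: "local_change (\<lambda>u v. planar_move u v \<or> reidemeister1 u v \<or> reidemeister2 u v \<or> reidemeister3 u v) D D'" for D D'
  proof -
    obtain xs ys u v where m: "link_diagram D" "link_diagram D'" "D = xs @ u @ ys" "D' = xs @ v @ ys"
      "planar_move u v \<or> reidemeister1 u v \<or> reidemeister2 u v \<or> reidemeister3 u v"
      using D unfolding local_change_def by blast
    show ?thesis
    proof (cases "reidemeister1 u v")
      case True
      then show ?thesis using E_curl m by (auto elim!: reidemeister1.cases)
    next
      case False
      then have "local_change (\<lambda>u v. planar_move u v \<or> reidemeister2 u v \<or> reidemeister3 u v) D D'"
        using m unfolding local_change_def by blast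
      then have "regular_isotopic D D'" unfolding regular_isotopic_def by (rule r_into_equivclp)
      then show ?thesis using inv m unfolding regular_isotopy_invariant_def by metis
    qed
  qed
  have E_isotopic: "E_part (Q D) = E_part (Q D')" if "isotopic D D'" for D D'
    using that unfolding isotopic_def
    by (induction rule: equivclp_induct) (use E_move in auto)
  have P_skein: "Poly_Mapping.lookup (E_part (Q Lp)) 0 + Poly_Mapping.lookup (E_part (Q Lm)) 0 =
      Poly_Mapping.lookup (E_part (Q L0)) 0 + Poly_Mapping.lookup (E_part (Q Li)) 0"
    if "conway_quadruple h Lp Lm L0 Li" for h Lp Lm L0 Li
    by (rule E_part_conway[OF skein[OF that, unfolded var_eq]]) simp
  have circles: "?P (circles (Suc n))" for n
  proof (induction n)
    case 0
    have "circles (Suc 0) = [(0, Cup), (0, Cap)]" by (simp add: circles_def)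
    then show ?case using unknot by (simp add: E_part_simps)
  next
    case (Suc n)
    \<comment> \<open>The skein relation is applied to a curl on a circle: both curls and one
      smoothing are isotopic to the given circles, and the other smoothing adds a circle.\<close>
    let ?xs = "[(0, Cup)]" and ?ys = "(0, Cap) # circles n"
    define L where "L s = ?xs @ s @ ?ys" for s
    have c1: "circles (Suc n) = ?xs @ ?ys" by (simp add: circles_def)
    have c2: "circles (Suc (Suc n)) = ?xs @ (0, Cap) # circles (Suc n)" by (simp add: circles_def)
    have link: "link_diagram (?xs @ ?ys)" by (simp add: link_diagram_iff_tangle)
    have linkL: "link_diagram (L [(2, Cup), (1, Cross c), (2, Cap)])" for c
      by (simp add: link_diagram_iff_tangle L_def)
    have L1: "link_diagram (L [(2, Cup), (1, Cap), (1, Cup), (2, Cap)])" "link_diagram (L [(2, Cup), (2, Cap)])"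
      by (simp_all add: link_diagram_iff_tangle L_def)
    have "conway_quadruple 2 (L [(2, Cup), (1, Cross Pos), (2, Cap)]) (L [(2, Cup), (1, Cross Neg), (2, Cap)])
      (L [(2, Cup), (1, Cap), (1, Cup), (2, Cap)]) (L [(2, Cup), (2, Cap)])"
      unfolding conway_quadruple_def
      using linkL L1 by (auto simp: L_def intro!: exI[of _ "[(0, Cup), (2, Cup)]"])
    note sk = P_skein[OF this]
    have "curl (- 1) 1 [(2, Cup), (1, Cross Pos), (2, Cap)]" "curl 1 1 [(2, Cup), (1, Cross Neg), (2, Cap)]"
      using curl.right_neg[of 1] curl.right_pos[of 1] by (simp_all add: numeral_eq_Suc)
    then have curls: "E_part (Q (L [(2, Cup), (1, Cross c), (2, Cap)])) = E_part (Q (circles (Suc n)))" for c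
      using E_curl[OF _ linkL[unfolded L_def] link] unfolding L_def c1 by (cases c) blast+
    have "tangle_isotopic 0 (L [(2, Cup), (1, Cap), (1, Cup), (2, Cap)]) (L [(1, Cup), (2, Cap)])"
      by (rule tangle_replace_move[OF tangle_moves(2)[of 1], where xs = "?xs" and ys = "[(1, Cup), (2, Cap)] @ ?ys"])
        (simp_all add: L_def)
    also have "tangle_isotopic 0 \<dots> (circles (Suc n))"
      by (rule tangle_replace_move[OF tangle_moves(3)[of 1], where xs = "?xs" and ys = "?ys"])
        (simp_all add: L_def c1)
    finally have e0: "E_part (Q (L [(2, Cup), (1, Cap), (1, Cup), (2, Cap)])) = E_part (Q (circles (Suc n)))"
      using tangle_isotopic_imp_isotopic L1(1) E_isotopic by blast
    have "tangle_isotopic 0 (L [(2, Cup), (2, Cap)]) (circles (Suc (Suc n)))"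
      by (rule tangle_replace_sym[OF interchange[of 2 "[(0, Cap)]" 0 "[(0, Cup), (0, Cap)]"],
            where xs = "?xs" and ys = "circles n"])
        (simp_all add: L_def c2 c1)
    then have ei: "E_part (Q (L [(2, Cup), (2, Cap)])) = E_part (Q (circles (Suc (Suc n))))"
      using tangle_isotopic_imp_isotopic L1(2) E_isotopic by blast
    show ?case using sk Suc unfolding curls e0 ei by presburger
  qed
  show ?thesis
  proof (rule skein_induct[where P = ?P and ok = "\<lambda>_ _. True", OF _ _ _ assms(2)])
    fix D assume "link_diagram D"
    then obtain D' n where D': "shadow D' = shadow D" "isotopic D' (circles n)" "link_diagram (circles n)"
      by (rule unknotting)
    obtain n' where "n = Suc n'" using D'(3) by (cases n) (auto simp: circles_def link_diagram_def)
    then have "?P D'" using circles[of n'] E_isotopic[OF D'(2)] by simp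
    then show "\<exists>D'. shadow D' = shadow D \<and> ?P D' \<and> (\<forall>h<length D. D' ! h \<noteq> D ! h \<longrightarrow> True)"
      using D'(1) by blast
  next
    fix h Lp Lm L0 Li
    assume "conway_quadruple h Lp Lm L0 Li" "?P L0" "?P Li"
    then show "?P Lp \<longleftrightarrow> ?P Lm" using P_skein[of h Lp Lm L0 Li] by presburger
  qed simp
qed

section \<open>The invariants\<close>

lemma skein_induct_mixed [consumes 1, case_names union skein]:
  assumes "link_diagram D"
    and base: "\<And>D. union_of_unlinked_knots (num_components D) D \<Longrightarrow> P D"
    and step: "\<And>h Lp Lm L0 Li. conway_quadruple h Lp Lm L0 Li \<Longrightarrow> mixed_crossing Lp h \<Longrightarrow>
      P L0 \<Longrightarrow> P Li \<Longrightarrow> P Lp \<longleftrightarrow> P Lm"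
  shows "P D"
proof (rule skein_induct[where ok = mixed_crossing, OF shadow_mixed_crossing _ step \<open>link_diagram D\<close>])
  fix D assume "link_diagram D"
  then obtain D' where "shadow D' = shadow D" "union_of_unlinked_knots (num_components D') D'"
    "\<And>h. h < length D \<Longrightarrow> D' ! h \<noteq> D ! h \<Longrightarrow> mixed_crossing D h"
    by (rule unlinking) blast
  then show "\<exists>D'. shadow D' = shadow D \<and> P D' \<and> (\<forall>h<length D. D' ! h \<noteq> D ! h \<longrightarrow> mixed_crossing D h)"
    using base by blast
qed

text \<open>The exponent vectors of $z/w$ and of the images of the indeterminates under the substitutions
  \<open>w := z\<close> and \<open>z := w, E := E z/w\<close>.\<close>

definition zw_exponent :: "indet \<Rightarrow>\<^sub>0 int" where
  "zw_exponent = frag_of Iz - frag_of Iw"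

definition back_exponent :: "indet \<Rightarrow> (indet \<Rightarrow>\<^sub>0 int)" where
  "back_exponent = frag_of(Iz := frag_of Iw, IE := frag_of IE + zw_exponent)"

text \<open>With the composite of both substitutions, which sends $z$ and $w$ to $w$ and $E$ to $E
  z/w$, the formula becomes an identity about \<open>KQ\<close> alone.\<close>

definition round_trip :: "(indet \<Rightarrow>\<^sub>0 int) \<Rightarrow> (indet \<Rightarrow>\<^sub>0 int)" where
  "round_trip = frag_extend back_exponent \<circ> frag_extend (frag_of \<circ> id(Iw := Iz))"

lemma KK_of_eq: "KK_of KQ D = frag_extend (frag_of \<circ> frag_extend (frag_of \<circ> id(Iw := Iz))) (KQ D)"
  unfolding KK_of_def by (rule substitute_monomials) (simp add: var_eq)

lemma zw_eq: "var Iz * unit_inv (var Iw) = frag_of zw_exponent"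
  by (simp add: var_eq unit_inv_frag_of frag_of_mult zw_exponent_def)

lemma substitute_back:
  "substitute (var(Iz := var Iw, IE := var IE * (var Iz * unit_inv (var Iw)))) (KK_of KQ D) =
    frag_extend (frag_of \<circ> round_trip) (KQ D)"
proof -
  have "substitute (var(Iz := var Iw, IE := var IE * (var Iz * unit_inv (var Iw)))) (KK_of KQ D) =
    frag_extend (frag_of \<circ> frag_extend back_exponent) (KK_of KQ D)"
    by (rule substitute_monomials) (auto simp: var_eq unit_inv_frag_of zw_exponent_def frag_of_mult back_exponent_def)
  then show ?thesis
    unfolding KK_of_eq frag_extend_compose by (simp add: round_trip_def comp_assoc)
qed

lemma round_trip_eq: "round_trip m = frag_extend (back_exponent \<circ> id(Iw := Iz)) m"
  by (simp add: round_trip_def frag_extend_compose)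

lemma round_trip_add: "round_trip (a + b) = round_trip a + round_trip b"
  by (simp add: round_trip_eq frag_extend_add)

lemma round_trip_wa:
  assumes "Poly_Mapping.keys m \<subseteq> {Iw, Ia}"
  shows "round_trip m = m"
proof -
  have "round_trip m = frag_extend frag_of m"
    unfolding round_trip_eq
    by (rule frag_extend_eq) (use assms in \<open>auto simp: back_exponent_def\<close>)
  then show ?thesis by (simp flip: frag_expansion)
qed

text \<open>Since $z$ and $w$ both specialise to 1, replacing one by the other does not
  show.\<close>

lemma E_part_KK_of: "E_part (KK_of KQ D) = E_part (KQ D)"
proof -
  have "Poly_Mapping.lookup (frag_extend (frag_of \<circ> id(Iw := Iz)) m) IE = Poly_Mapping.lookup m IE" for m
    using subset_UNIV
  proof (induction m rule: frag_induction)
    case (one x)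
    then show ?case by (cases x) auto
  qed (simp_all add: frag_extend_diff lookup_minus)
  then show ?thesis
    unfolding E_part_def KK_of_eq frag_extend_compose by (simp add: comp_def)
qed

context
  fixes Q KQ :: "diagram \<Rightarrow> laurent"
  assumes Q: "kauffman_Q Q" and KQ: "invariant_KQ Q KQ"
begin

lemma KQ_skein:
  assumes "conway_quadruple h Lp Lm L0 Li" "mixed_crossing Lp h"
  shows "KQ Lp + KQ Lm = frag_of (frag_of Iz) * (KQ L0 + KQ Li)"
  using KQ assms unfolding invariant_KQ_def var_eq by blast

lemma KQ_union:
  assumes "union_of_unlinked_knots (num_components D) D"
  shows "KQ D = frag_of (frag_cmul (1 - int (num_components D)) (frag_of IE)) * Q D"
proof -
  have "num_components D \<ge> 1"
    using assms by (intro link_diagram_num_components) (simp add: union_of_unlinked_knots_def)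
  then show ?thesis
    using KQ assms unfolding invariant_KQ_def var_eq unit_powi_frag_of by blast
qed

lemma Q_keys:
  assumes "link_diagram D" "m \<in> Poly_Mapping.keys (Q D)"
  shows "Poly_Mapping.keys m \<subseteq> {Iw, Ia}"
  using Q assms unfolding kauffman_Q_def indets_def by blast

text \<open>The substitution turns the coefficient $z$ of the skein relation into $w$; as the
  smoothings have one component less, one factor $z/w$ is left over and turns it back into $z$. On
  unions of knots $Q$ is fixed, involving only $w$ and $a$, while $E^{1-n}$ produces $(z/w)^{1-n}$,
  which the power in front cancels.\<close>

lemma KQ_round_trip:
  assumes "link_diagram D"
  shows "KQ D = frag_of zw_exponent ^ (num_components D - 1) * frag_extend (frag_of \<circ> round_trip) (KQ D)"
  using assms
proof (induction D rule: skein_induct_mixed)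
  case (union D)
  let ?n = "num_components D"
  have link: "link_diagram D" using union by (simp add: union_of_unlinked_knots_def)
  have n: "?n \<ge> 1" using link by (rule link_diagram_num_components)
  have "frag_extend (frag_of \<circ> round_trip) (Q D) = frag_extend frag_of (Q D)"
    by (rule frag_extend_eq) (simp add: round_trip_wa[OF Q_keys[OF link]])
  then have Q_fix: "frag_extend (frag_of \<circ> round_trip) (Q D) = Q D" by (simp flip: frag_expansion)
  have "round_trip (frag_cmul i (frag_of IE)) = frag_cmul i (frag_of IE + zw_exponent)" for i
    by (simp add: round_trip_eq frag_extend_cmul back_exponent_def)
  then have H: "frag_extend (frag_of \<circ> round_trip) (KQ D) =
      frag_of (frag_cmul (1 - int ?n) (frag_of IE + zw_exponent)) * Q D"
    unfolding KQ_union[OF union] frag_extend_mult[OF round_trip_add] Q_fix by simp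
  have e: "frag_cmul (int (?n - 1)) zw_exponent + frag_cmul (1 - int ?n) (frag_of IE + zw_exponent) =
      frag_cmul (1 - int ?n) (frag_of IE)"
    using n by (simp add: frag_cmul_distrib2 of_nat_diff frag_cmul_diff_distrib)
  show ?case
    unfolding frag_of_power H mult.assoc[symmetric] frag_of_mult e by (rule KQ_union[OF union])
next
  case (skein h Lp Lm L0 Li)
  let ?H = "frag_extend (frag_of \<circ> round_trip)" and ?t = "frag_of zw_exponent :: laurent"
  note n = conway_quadruple_components[OF skein(1,2)]
  obtain N where N: "num_components Lp = Suc (Suc N)" "num_components Lm = Suc (Suc N)"
    "num_components L0 = Suc N" "num_components Li = Suc N"
  proof -
    have "link_diagram L0" using skein(1) by (simp add: conway_quadruple_def)
    then have "num_components L0 \<ge> 1" by (rule link_diagram_num_components)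
    then show thesis using n that[of "num_components L0 - 1"] by simp
  qed
  note rel = KQ_skein[OF skein(1,2)]
  have "round_trip (frag_of Iz) = frag_of Iw"
    by (simp add: round_trip_eq back_exponent_def)
  then have "?H (KQ Lp) + ?H (KQ Lm) = frag_of (frag_of Iw) * (?H (KQ L0) + ?H (KQ Li))"
    using arg_cong[OF rel, of ?H] by (simp add: frag_extend_add frag_extend_mult[OF round_trip_add])
  then have "?t ^ Suc N * ?H (KQ Lp) + ?t ^ Suc N * ?H (KQ Lm) =
      (?t * frag_of (frag_of Iw)) * (?t ^ N * ?H (KQ L0) + ?t ^ N * ?H (KQ Li))"
    by (simp add: algebra_simps flip: distrib_left)
  also have "?t * frag_of (frag_of Iw) = frag_of (frag_of Iz)"
    by (simp add: frag_of_mult zw_exponent_def)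
  also have "?t ^ N * ?H (KQ L0) = KQ L0"
    using skein(3) unfolding N diff_Suc_1 by (rule HOL.sym)
  also have "?t ^ N * ?H (KQ Li) = KQ Li"
    using skein(4) unfolding N diff_Suc_1 by (rule HOL.sym)
  finally have "?t ^ Suc N * ?H (KQ Lp) + ?t ^ Suc N * ?H (KQ Lm) = KQ Lp + KQ Lm"
    unfolding rel .
  then show ?case unfolding N diff_Suc_1 by (metis add_left_cancel add_right_cancel)
qed

text \<open>Both smoothings have equally many components, hence coefficients of equal parity and an
  even sum. So changing a mixed crossing preserves the parity of every coefficient.\<close>

lemma odd_E_part_KQ:
  assumes "link_diagram D"
  shows "\<forall>j. odd (Poly_Mapping.lookup (E_part (KQ D)) j) \<longleftrightarrow> j = 1 - int (num_components D)"
  using assms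
proof (induction D rule: skein_induct_mixed)
  case (union D)
  have link: "link_diagram D" using union by (simp add: union_of_unlinked_knots_def)
  \<comment> \<open>\<open>Q D\<close> does not involve $E$, so its specialisation is concentrated
    in degree 0, where \<open>odd_kauffman_Q\<close> applies.\<close>
  have "E_part (Q D) = frag_extend (\<lambda>_. 1) (Q D)"
    unfolding E_part_def
  proof (rule frag_extend_eq)
    fix m assume "m \<in> Poly_Mapping.keys (Q D)"
    then have "IE \<notin> Poly_Mapping.keys m" using Q_keys[OF link] by blast
    then show "(frag_of \<circ> (\<lambda>m. Poly_Mapping.lookup m IE)) m = 1"
      by (simp add: not_in_keys_iff_lookup_eq_zero)
  qed
  then have "Poly_Mapping.keys (E_part (Q D)) \<subseteq> {0}"
    using keys_frag_extend[of "\<lambda>_. 1 :: int \<Rightarrow>\<^sub>0 int" "Q D"]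
    by (metis UN_least keys_one order_refl subset_trans)
  then have "j \<noteq> 0 \<Longrightarrow> Poly_Mapping.lookup (E_part (Q D)) j = 0" for j
    by (meson in_keys_iff singletonD subsetD)
  then have "odd (Poly_Mapping.lookup (E_part (Q D)) j) \<longleftrightarrow> j = 0" for j
    using odd_kauffman_Q[OF Q link] by (cases "j = 0") auto
  then show ?case
    unfolding KQ_union[OF union] E_part_simps lookup_frag_of_mult by simp
next
  case (skein h Lp Lm L0 Li)
  have "Poly_Mapping.lookup (E_part (KQ Lp)) j + Poly_Mapping.lookup (E_part (KQ Lm)) j =
    Poly_Mapping.lookup (E_part (KQ L0)) j + Poly_Mapping.lookup (E_part (KQ Li)) j" for j
    by (rule E_part_conway[OF KQ_skein[OF skein(1,2)]]) simp
  then have "odd (Poly_Mapping.lookup (E_part (KQ Lp)) j) \<longleftrightarrow> odd (Poly_Mapping.lookup (E_part (KQ Lm)) j)" for j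
    using skein(3,4) conway_quadruple_components[OF skein(1,2)] by (metis (no_types, lifting) even_add nat.inject)
  then show ?case using conway_quadruple_components(1)[OF skein(1,2)] by simp
qed

end

theorem proposition7:
  fixes Q KQ :: "diagram \<Rightarrow> laurent"
  assumes "kauffman_Q Q"
    and "invariant_KQ Q KQ"
  shows "topologically_equivalent KQ (KK_of KQ) \<and>
    (\<forall>L n. link_diagram L \<longrightarrow> num_components L = n \<longrightarrow> n \<ge> 1 \<longrightarrow>
      KQ L = (var Iz * unit_inv (var Iw)) ^ (n - 1) *
        substitute (var(Iz := var Iw, IE := var IE * (var Iz * unit_inv (var Iw)))) (KK_of KQ L))"
proof -
  have formula: "KQ L = (var Iz * unit_inv (var Iw)) ^ (num_components L - 1) *
      substitute (var(Iz := var Iw, IE := var IE * (var Iz * unit_inv (var Iw)))) (KK_of KQ L)"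
    if "link_diagram L" for L
    unfolding substitute_back unfolding zw_eq by (rule KQ_round_trip[OF assms that])
  have "KQ D = KQ D' \<longleftrightarrow> KK_of KQ D = KK_of KQ D'" if link: "link_diagram D" "link_diagram D'" for D D'
  proof
    assume eq: "KK_of KQ D = KK_of KQ D'"
    then have "E_part (KQ D) = E_part (KQ D')" by (metis E_part_KK_of)
    then have "1 - int (num_components D) = 1 - int (num_components D')"
      using odd_E_part_KQ[OF assms link(1)] odd_E_part_KQ[OF assms link(2)] by metis
    then have "num_components D = num_components D'" by simp
    then show "KQ D = KQ D'" using formula[OF link(1)] formula[OF link(2)] eq by metis
  qed (simp add: KK_of_def)
  then show ?thesis unfolding topologically_equivalent_def using formula by blast
qed


end
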